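(* Let $G$ be a finite group, suppose $H_1\le Q_1\le G$ and $H_2\le Q_2\le G$ are subgroups, and let $\chi_i$ be an irreducible complex character of $H_i$ for $i=1,2$. Set $\tau_i=\mathrm{Ind}_{H_i}^{Q_i}\chi_i$ and $\rho_i=\mathrm{tr}\,\tau_i$. Assume that $\tau_2$ is irreducible. Then $$\mu(\rho_2,\mathrm{Res}_{Q_2}\mathrm{Ind}_{Q_1}^{G}\rho_1)=\frac{[\mathbb{Q}(\tau_1):\mathbb{Q}]}{|H_1|\cdot|H_2|}\sum_{[U]\in CC_{\mathrm{cyc}}(G)}|N_G(U)|\,\phi(|U|)\cdot\sum_{\substack{D_1\le H_1\\ D_1\sim U}}\mathrm{tr}^*\chi_1(D_1)\cdot\sum_{\substack{D_2\le H_2\\ D_2\sim U}}\mathrm{tr}^*\chi_2(D_2).$$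
   Context: For a complex character $\chi$ of a finite group, $\mathbb{Q}(\chi)$ is the field generated by its values, $\mathrm{tr}\,\chi=\sum_{\sigma\in\mathrm{Gal}(\mathbb{Q}(\chi)/\mathbb{Q})}\chi^\sigma$, and $\mathrm{tr}^*\chi=\frac{1}{[\mathbb{Q}(\chi):\mathbb{Q}]}\mathrm{tr}\,\chi$. If $\chi$ is irreducible, $\mathrm{tr}\,\chi$ is called a $\mathbb{Q}$-irreducible character. For a $\mathbb{Q}$-irreducible character $\alpha$ and a $\mathbb{Q}$-valued virtual character $\beta$, $\mu(\alpha,\beta)=\langle\alpha,\beta\rangle/\langle\alpha,\alpha\rangle$ with the usual inner product of characters. For a rational-valued class function $\tau$ that is a $\mathbb{Q}$-linear combination of $\mathbb{Q}$-valued characters, and a cyclic subgroup $D$, $\tau(D)$ denotes $\tau(y)$ for any generator $y$ of $D$ (this is independent of $y$). $CC_{\mathrm{cyc}}(G)$ is the set of $G$-conjugacy classes $[U]$ of cyclic subgroups $U$ of $G$; $D\sim U$ means that $D$ and $U$ are conjugate in $G$; $\phi$ is Euler's totient function; $N_G(U)$ is the normaliser of $U$. *)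

theory Defs
  imports
    "HOL-Algebra.Algebra"
    "HOL-Number_Theory.Totient"
    "Jordan_Normal_Form.VS_Connect"
begin

text \<open>
  Class functions and characters of a group \<open>G\<close> are functions \<open>'a \<Rightarrow> complex\<close> of which only the
  values on \<^term>\<open>carrier G\<close> matter. A subgroup \<open>H\<close> of \<open>G\<close> is viewed as a group in its own right by
  passing to \<^term>\<open>G\<lparr>carrier := H\<rparr>\<close>.
\<close>


subsection \<open>Irreducible complex characters\<close>

definition GL :: "nat \<Rightarrow> complex mat monoid" where
  "GL n = units_of (ring_mat TYPE(complex) n ())"

definition irreducible_rep ::
    "('a, 'b) monoid_scheme \<Rightarrow> nat \<Rightarrow> ('a \<Rightarrow> complex mat) \<Rightarrow> bool" where
  "irreducible_rep G n R \<longleftrightarrow>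
     R \<in> hom G (GL n) \<and> n > 0 \<and>
     (\<forall>W. subspace class_ring W (module_vec TYPE(complex) n) \<longrightarrow>
          (\<forall>g \<in> carrier G. \<forall>w \<in> W. R g *\<^sub>v w \<in> W) \<longrightarrow>
          W = {0\<^sub>v n} \<or> W = carrier_vec n)"

definition irreducible_char :: "('a, 'b) monoid_scheme \<Rightarrow> ('a \<Rightarrow> complex) \<Rightarrow> bool" where
  "irreducible_char G \<chi> \<longleftrightarrow>
     (\<exists>n R. irreducible_rep G n R \<and> (\<forall>g \<in> carrier G. \<chi> g = sum_list (diag_mat (R g))))"


subsection \<open>Induction and the inner product\<close>

definition ind_char ::
    "('a, 'b) monoid_scheme \<Rightarrow> 'a set \<Rightarrow> ('a \<Rightarrow> complex) \<Rightarrow> 'a \<Rightarrow> complex" where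
  "ind_char G H \<chi> g =
     (\<Sum>x \<in> {x \<in> carrier G. inv\<^bsub>G\<^esub> x \<otimes>\<^bsub>G\<^esub> g \<otimes>\<^bsub>G\<^esub> x \<in> H}. \<chi> (inv\<^bsub>G\<^esub> x \<otimes>\<^bsub>G\<^esub> g \<otimes>\<^bsub>G\<^esub> x))
       / of_nat (card H)"

definition char_inner ::
    "('a, 'b) monoid_scheme \<Rightarrow> ('a \<Rightarrow> complex) \<Rightarrow> ('a \<Rightarrow> complex) \<Rightarrow> complex" where
  "char_inner G \<alpha> \<beta> = (\<Sum>g \<in> carrier G. \<alpha> g * cnj (\<beta> g)) / of_nat (card (carrier G))"

definition char_mu ::
    "('a, 'b) monoid_scheme \<Rightarrow> ('a \<Rightarrow> complex) \<Rightarrow> ('a \<Rightarrow> complex) \<Rightarrow> complex" where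
  "char_mu G \<alpha> \<beta> = char_inner G \<alpha> \<beta> / char_inner G \<alpha> \<alpha>"


subsection \<open>Fields of values and Galois traces\<close>

definition char_field :: "('a, 'b) monoid_scheme \<Rightarrow> ('a \<Rightarrow> complex) \<Rightarrow> complex set" where
  "char_field G \<chi> = generate_field class_ring (\<chi> ` carrier G)"

definition char_field_degree :: "('a, 'b) monoid_scheme \<Rightarrow> ('a \<Rightarrow> complex) \<Rightarrow> nat" where
  "char_field_degree G \<chi> = ring.dim class_ring \<rat> (char_field G \<chi>)"

text \<open>
  Automorphisms are taken to be extensional, so that each automorphism of \<open>K\<close> is represented by
  exactly one function on the complex numbers and sums over the Galois group count it once.
\<close>

definition gal_over_rats :: "complex set \<Rightarrow> (complex \<Rightarrow> complex) set" where
  "gal_over_rats K =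
     {\<sigma> \<in> extensional K.
        \<sigma> \<in> ring_iso (class_ring\<lparr>carrier := K\<rparr>) (class_ring\<lparr>carrier := K\<rparr>) \<and>
        (\<forall>q \<in> \<rat>. \<sigma> q = q)}"

definition char_tr :: "('a, 'b) monoid_scheme \<Rightarrow> ('a \<Rightarrow> complex) \<Rightarrow> 'a \<Rightarrow> complex" where
  "char_tr G \<chi> g = (\<Sum>\<sigma> \<in> gal_over_rats (char_field G \<chi>). \<sigma> (\<chi> g))"

definition char_tr_star :: "('a, 'b) monoid_scheme \<Rightarrow> ('a \<Rightarrow> complex) \<Rightarrow> 'a \<Rightarrow> complex" where
  "char_tr_star G \<chi> g = char_tr G \<chi> g / of_nat (char_field_degree G \<chi>)"


subsection \<open>Conjugacy classes of cyclic subgroups\<close>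

definition cyclic_subgroups :: "('a, 'b) monoid_scheme \<Rightarrow> 'a set set" where
  "cyclic_subgroups G = {U. subgroup U G \<and> cyclic_group (G\<lparr>carrier := U\<rparr>)}"

definition conj_subset :: "('a, 'b) monoid_scheme \<Rightarrow> 'a \<Rightarrow> 'a set \<Rightarrow> 'a set" where
  "conj_subset G g U = g <#\<^bsub>G\<^esub> U #>\<^bsub>G\<^esub> (inv\<^bsub>G\<^esub> g)"

definition conjugate_in :: "('a, 'b) monoid_scheme \<Rightarrow> 'a set \<Rightarrow> 'a set \<Rightarrow> bool" where
  "conjugate_in G D U \<longleftrightarrow> (\<exists>g \<in> carrier G. D = conj_subset G g U)"

definition CC_cyc :: "('a, 'b) monoid_scheme \<Rightarrow> 'a set set set" where
  "CC_cyc G = orbits G (cyclic_subgroups G) (conj_subset G)"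

definition class_rep :: "'a set set \<Rightarrow> 'a set" where
  "class_rep C = (SOME U. U \<in> C)"

text \<open>
  Any generator of \<open>D\<close> may be chosen: a rational combination of rational-valued characters takes
  the same value on all generators of a cyclic subgroup.
\<close>

definition val_at_cyclic ::
    "('a, 'b) monoid_scheme \<Rightarrow> ('a \<Rightarrow> complex) \<Rightarrow> 'a set \<Rightarrow> complex" where
  "val_at_cyclic G \<tau> D = \<tau> (SOME y. y \<in> carrier G \<and> generate G {y} = D)"

end

theory Submission
  imports
    Defs
    "Jordan_Normal_Form.Spectral_Radius"
    "HOL-Computational_Algebra.Field_as_Ring"
    "HOL-Computational_Algebra.Polynomial_Factorial"
begin

text \<open>
  Let \<open>N = |G|\<close> and let \<open>\<zeta>\<close> be a primitive \<open>N\<close>-th root of unity. For \<open>k\<close> coprime to \<open>N\<close> the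
  automorphism \<open>\<zeta> \<mapsto> \<zeta> ^ k\<close> of \<open>\<rat>(\<zeta>)\<close> sends \<open>\<chi>(g)\<close> to \<open>\<chi>(g ^ k)\<close>, both for irreducible \<open>\<chi>\<close> and
  for characters induced from these. Hence \<open>tr\<^sup>* \<chi>(g)\<close> is the average of \<open>\<chi>(g ^ k)\<close> over the units
  \<open>k\<close> modulo \<open>N\<close>, and \<open>tr\<^sup>*\<close> commutes with induction. Since the Galois conjugates of \<open>\<tau>\<^sub>2\<close> are
  orthonormal, \<open>\<langle>\<rho>\<^sub>2, \<rho>\<^sub>2\<rangle> = [\<rat>(\<tau>\<^sub>2):\<rat>]\<close>, so Frobenius reciprocity and transitivity of induction give
  \<open>\<mu> = [\<rat>(\<tau>\<^sub>1):\<rat>] / (|H\<^sub>1| |H\<^sub>2|) * \<Sum>h\<in>H\<^sub>2. tr\<^sup>* \<chi>\<^sub>2(h) * \<Sum>x. tr\<^sup>* \<chi>\<^sub>1(x\<^sup>-\<^sup>1 h x)\<close>, the inner sum being over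
  the \<open>x \<in> G\<close> with \<open>x\<^sup>-\<^sup>1 h x \<in> H\<^sub>1\<close>. The averages depend only on the subgroup generated by their
  argument: grouping the \<open>h\<close> by the subgroup \<open>D\<close> they generate and the \<open>x\<close> by \<open>x\<^sup>-\<^sup>1 D x\<close> yields the
  factors \<open>\<phi>(|D|)\<close> and \<open>|N\<^sub>G(D)|\<close>.
\<close>


subsection \<open>Conjugates of roots of unity\<close>

text \<open>The definitions speak of all automorphisms of \<rat>(\<chi>) and of its dimension over
  \<rat>, whereas every computation runs over exponents modulo N; much of the work closes this gap.
  That \<zeta> and \<zeta> ^ k satisfy the same rational equations is the irreducibility of the
  cyclotomic polynomial in disguise, and without it \<zeta> \<mapsto> \<zeta> ^ k is not even a
  well-defined map. That \<rat> is the fixed field needs no degree count: the trace of \<zeta> ^ i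
  is a Ramanujan sum, hence rational. That \<rat>(\<chi>) has no automorphisms beyond the
  restrictions comes from counting the roots of a polynomial satisfied by a primitive element.
  Orthogonality of Galois conjugates meets another obstacle: the twist \<chi>(g ^ k) is given as a
  function, with no matrices that realise it, so two representations cannot be compared. Schur's
  lemma is applied to the representation of \<chi> alone, with the twist as a class function of
  coefficients. One modulus serves all subgroups, and averages over its units do not see the fields
  \<rat>(\<chi>) and \<rat>(\<tau>), which may differ.\<close>

lemma prime_dvd_binomial_diff:
  fixes a b :: "'a :: comm_ring_1"
  assumes "Factorial_Ring.prime p"
  shows "of_nat p dvd (a + b) ^ p - a ^ p - b ^ p"
proof -
  have p0: "p > 0" using assms prime_gt_0_nat by blast
  let ?t = "\<lambda>k. of_nat (p choose k) * a ^ k * b ^ (p - k)"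
  have "(a + b) ^ p = (\<Sum>k\<le>p. ?t k)" by (rule binomial_ring)
  also have "{..p} = insert 0 (insert p {0<..<p})" using p0 by auto
  also have "(\<Sum>k\<in>insert 0 (insert p {0<..<p}). ?t k) = b ^ p + (a ^ p + (\<Sum>k\<in>{0<..<p}. ?t k))"
    using p0 by (subst sum.insert; auto)+
  finally have eq: "(a + b) ^ p - a ^ p - b ^ p = (\<Sum>k\<in>{0<..<p}. ?t k)" by simp
  have "of_nat p dvd ?t k" if "k \<in> {0<..<p}" for k
  proof -
    have "p dvd (p choose k)" using assms that by (intro dvd_choose_prime) auto
    hence "(of_nat p :: 'a) dvd of_nat (p choose k)" by auto
    thus ?thesis by (simp add: dvd_mult2)
  qed
  thus ?thesis unfolding eq by (intro dvd_sum)
qed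

lemma prime_dvd_power_self_diff:
  fixes a :: int
  assumes "Factorial_Ring.prime p"
  shows "int p dvd a ^ p - a"
proof -
  have p0: "p > 0" using assms prime_gt_0_nat by blast
  have nat: "int p dvd int n ^ p - int n" for n
  proof (induction n)
    case (Suc n)
    have "int p dvd (int n + 1) ^ p - int n ^ p - 1 ^ p"
      using prime_dvd_binomial_diff[OF assms, of "int n" 1] by simp
    from dvd_add[OF this Suc] show ?case by (simp add: algebra_simps)
  qed (use p0 in \<open>auto simp: power_0_left\<close>)
  define n where "n = nat (a mod int p)"
  have n: "int n = a mod int p" using p0 by (simp add: n_def)
  have "[a = int n] (mod int p)" unfolding n by (simp add: cong_def)
  hence "[a ^ p - a = int n ^ p - int n] (mod int p)" by (intro cong_diff cong_pow)
  thus ?thesis using nat[of n] cong_dvd_iff by blast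
qed

text \<open>Stands in for the Frobenius map of F_p[x]: raising to the power \<open>p\<close> is
  additive modulo \<open>p\<close>, and Fermat's little theorem fixes the constants, so induction on
  the coefficients suffices.\<close>

lemma int_poly_frobenius:
  fixes f :: "int poly"
  assumes "Factorial_Ring.prime p"
  shows "of_nat p dvd f ^ p - pcompose f (Polynomial.monom 1 p)"
proof (induction f)
  case 0
  show ?case using assms prime_gt_0_nat by (simp add: power_0_left)
next
  case (pCons a q)
  let ?X = "[:0, 1 :: int:]"
  have X: "?X ^ p = Polynomial.monom 1 p" by (simp add: x_as_monom monom_power)
  have 1: "pCons a q = [:a:] + ?X * q" by simp
  have "of_nat p dvd (pCons a q) ^ p - [:a:] ^ p - (?X * q) ^ p"
    unfolding 1 by (rule prime_dvd_binomial_diff[OF assms])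
  moreover have "of_nat p dvd [:a:] ^ p - [:a:]"
  proof -
    have "[:a:] ^ p - [:a:] = [:a ^ p - a:]" by (simp add: poly_const_pow)
    thus ?thesis using prime_dvd_power_self_diff[OF assms, of a]
      by (simp add: of_nat_poly)
  qed
  moreover have "of_nat p dvd (?X * q) ^ p - Polynomial.monom 1 p * pcompose q (Polynomial.monom 1 p)"
    unfolding power_mult_distrib X right_diff_distrib[symmetric] using pCons by simp
  ultimately have "of_nat p dvd ((pCons a q) ^ p - [:a:] ^ p - (?X * q) ^ p) + ([:a:] ^ p - [:a:])
     + ((?X * q) ^ p - Polynomial.monom 1 p * pcompose q (Polynomial.monom 1 p))"
    by (intro dvd_add)
  also have "\<dots> = pCons a q ^ p - pcompose (pCons a q) (Polynomial.monom 1 p)"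
    by (simp add: pcompose_pCons)
  finally show ?case .
qed

text \<open>Gauss's lemma in disguise. Let \<open>f1\<close> be a primitive annihilator of least
  degree. Pseudo-division only gives \<open>c * h = f1 * q\<close>, but contents are multiplicative,
  so \<open>c\<close> divides the content of \<open>q\<close> and cancels. As \<open>f1\<close>
  divides the monic polynomial x ^ N - 1, its leading coefficient is a unit.\<close>

lemma root_of_unity_minimal_int_poly:
  fixes w :: complex
  assumes "w ^ N = 1" "N > 0"
  obtains f :: "int poly" where "Polynomial.lead_coeff f = 1" "Polynomial.degree f > 0"
    "poly (of_int_poly f) w = 0" "\<And>h. poly (of_int_poly h) w = 0 \<Longrightarrow> f dvd h"
proof -
  define P where "P d \<longleftrightarrow> (\<exists>f :: int poly. f \<noteq> 0 \<and> poly (of_int_poly f) w = 0 \<and> Polynomial.degree f = d)" for d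
  let ?g = "Polynomial.monom 1 N - 1 :: int poly"
  have g: "?g \<noteq> 0" "Polynomial.lead_coeff ?g = 1" "poly (of_int_poly ?g) w = 0"
  proof -
    have d: "Polynomial.degree ?g = N"
      using assms by (metis degree_add_eq_left degree_minus degree_monom_eq degree_1 diff_conv_add_uminus one_neq_zero)
    show "Polynomial.lead_coeff ?g = 1" unfolding d using assms(2) by (simp add: coeff_1)
    thus "?g \<noteq> 0" by force
    show "poly (of_int_poly ?g) w = 0" using assms by (simp add: hom_distribs poly_monom)
  qed
  have "P (Polynomial.degree ?g)" unfolding P_def using g by blast
  hence PL: "P (LEAST d. P d)" by (rule LeastI)
  then obtain f0 where f0: "f0 \<noteq> 0" "poly (of_int_poly f0) w = 0" "Polynomial.degree f0 = (LEAST d. P d)"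
    unfolding P_def by blast
  define f1 where "f1 = primitive_part f0"
  have f1: "f1 \<noteq> 0" "content f1 = 1" "Polynomial.degree f1 = (LEAST d. P d)"
    using f0 by (auto simp: f1_def)
  have "f0 = Polynomial.smult (content f0) f1" by (simp add: f1_def)
  hence "of_int (content f0) * poly (of_int_poly f1) w = 0" using f0(2)
    by (metis of_int_hom.map_poly_hom_smult poly_smult)
  hence f1w: "poly (of_int_poly f1) w = 0" using f0(1) by simp
  have dv: "f1 dvd h" if h: "poly (of_int_poly h) w = 0" for h
  proof -
    obtain q r where qr: "pseudo_divmod h f1 = (q, r)" by fastforce
    from pseudo_divmod(1)[OF f1(1) qr] obtain c where c: "Polynomial.smult c h = f1 * q + r"
      "c = Polynomial.lead_coeff f1 ^ (Suc (Polynomial.degree h) - Polynomial.degree f1)" by blast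
    have c0: "c \<noteq> 0" using c(2) f1(1) by auto
    have "poly (of_int_poly (Polynomial.smult c h)) w = 0" using h by (simp add: hom_distribs)
    hence rw: "poly (of_int_poly r) w = 0" unfolding c(1) using f1w by (simp add: hom_distribs)
    have "r = 0"
    proof (rule ccontr)
      assume r: "r \<noteq> 0"
      hence "P (Polynomial.degree r)" unfolding P_def using rw by blast
      hence "Polynomial.degree f1 \<le> Polynomial.degree r" unfolding f1 by (rule Least_le)
      with pseudo_divmod(2)[OF f1(1) qr] r show False by auto
    qed
    with c have c': "Polynomial.smult c h = f1 * q" by simp
    hence "content (Polynomial.smult c h) = content q" by (simp add: content_mult f1)
    hence "c dvd content q" by (metis content_smult dvd_triv_left normalize_dvd_iff)
    hence "[:c:] dvd q" by (simp add: const_poly_dvd_iff_dvd_content)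
    then obtain q' where "q = Polynomial.smult c q'" by (auto simp: dvd_def)
    with c' have "Polynomial.smult c h = Polynomial.smult c (f1 * q')" by simp
    hence "h = f1 * q'" using c0 by (simp add: smult_cancel)
    thus ?thesis by simp
  qed
  from dv[OF g(3)] obtain q where q: "?g = f1 * q" by blast
  have "Polynomial.lead_coeff f1 * Polynomial.lead_coeff q = 1"
    using g(2) unfolding q by (simp only: lead_coeff_mult)
  hence "Polynomial.lead_coeff f1 dvd 1" by (metis dvd_triv_left)
  hence lc: "Polynomial.lead_coeff f1 = 1 \<or> Polynomial.lead_coeff f1 = -1" by auto
  have d: "Polynomial.degree f1 > 0"
  proof (rule ccontr)
    assume "\<not> ?thesis"
    then obtain c where "f1 = [:c:]" by (metis degree_eq_zeroE gr0I)
    with f1w f1(1) show False by simp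
  qed
  show thesis
  proof (cases "Polynomial.lead_coeff f1 = 1")
    case True
    from that[OF True d f1w dv] show thesis .
  next
    case False
    with lc have "Polynomial.lead_coeff (- f1) = 1" by simp
    moreover have "poly (of_int_poly (- f1)) w = 0" using f1w by (simp add: hom_distribs)
    ultimately show thesis using that[of "- f1"] d dv by simp
  qed
qed

text \<open>
  Dedekind's argument, phrased without reduction modulo \<open>p\<close>: if the minimal polynomial \<open>f\<close> of \<open>w\<close>
  did not vanish at \<open>w ^ p\<close>, then differentiating \<open>f * q = x ^ N - 1\<close> at \<open>w ^ p\<close> would give
  \<open>N = p * v(w)\<close> with an integer polynomial \<open>v\<close>, and hence \<open>p dvd N\<close>.
\<close>

lemma root_of_unity_prime_power_conjugate:
  fixes w :: complex
  assumes "w ^ N = 1" "N > 0" "Factorial_Ring.prime p" "\<not> p dvd N" and h: "poly (of_int_poly h) w = 0"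
  shows "poly (of_int_poly h) (w ^ p) = 0"
proof -
  let ?e = "\<lambda>h z. poly (of_int_poly h) z :: complex"
  obtain f :: "int poly" where f: "Polynomial.lead_coeff f = 1" "Polynomial.degree f > 0"
    "?e f w = 0" "\<And>h. ?e h w = 0 \<Longrightarrow> f dvd h"
    using root_of_unity_minimal_int_poly[OF assms(1,2)] by blast
  have "?e f (w ^ p) = 0"
  proof (rule ccontr)
    assume nz: "?e f (w ^ p) \<noteq> 0"
    let ?g = "Polynomial.monom 1 N - 1 :: int poly"
    have g: "?e ?g z = z ^ N - 1" for z by (simp add: hom_distribs poly_monom)
    from f(4)[of ?g] g assms(1) obtain q where q: "?g = f * q" by auto
    have wp: "(w ^ p) ^ N = 1" using assms(1) by (metis power_mult mult.commute power_one)
    have "?e f (w ^ p) * ?e q (w ^ p) = 0"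
      using g[of "w ^ p"] wp unfolding q by (simp add: hom_distribs)
    hence qw: "?e q (w ^ p) = 0" using nz by simp
    have pd: "pderiv ?g = Polynomial.monom (int N) (N - 1)" by (simp add: pderiv_diff pderiv_monom)
    have "?e (pderiv ?g) (w ^ p) = ?e f (w ^ p) * ?e (pderiv q) (w ^ p)"
      unfolding q pderiv_mult using qw by (simp add: hom_distribs)
    hence "?e f (w ^ p) * ?e (pderiv q) (w ^ p) = of_nat N * (w ^ p) ^ (N - 1)"
      unfolding pd by (simp add: hom_distribs poly_monom)
    hence "?e f (w ^ p) * ?e (pderiv q) (w ^ p) * w ^ p = of_nat N * ((w ^ p) ^ (N - 1) * w ^ p)"
      by simp
    also have "(w ^ p) ^ (N - 1) * w ^ p = 1" using wp assms(2) by (metis power_minus_mult)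
    finally have N: "?e f (w ^ p) * ?e (pderiv q) (w ^ p) * w ^ p = of_nat N" by simp
    obtain u where u: "f ^ p - pcompose f (Polynomial.monom 1 p) = of_nat p * u"
      using int_poly_frobenius[OF assms(3), of f] by blast
    have comp: "?e (pcompose r (Polynomial.monom 1 p)) w = ?e r (w ^ p)" for r
      by (simp only: of_int_hom.map_poly_pcompose poly_pcompose) (simp add: hom_distribs poly_monom)
    have "?e (f ^ p) w - ?e f (w ^ p) = of_nat p * ?e u w"
      using arg_cong[OF u, of "\<lambda>r. ?e r w"]
      by (simp only: of_int_poly_hom.hom_minus of_int_poly_hom.hom_mult poly_diff poly_mult comp) (simp add: hom_distribs)
    moreover have "?e (f ^ p) w = 0" using f(3) assms(3) prime_gt_0_nat[of p] by (simp add: hom_distribs)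
    ultimately have fw: "?e f (w ^ p) = - of_nat p * ?e u w"
      by (metis add.inverse_inverse diff_0 mult_minus_left)
    define v where "v = - u * pcompose (pderiv q) (Polynomial.monom 1 p) * Polynomial.monom 1 p"
    have v: "of_nat p * ?e v w = of_nat N"
      unfolding v_def N[symmetric] fw of_int_poly_hom.hom_mult poly_mult comp
      by (simp add: hom_distribs poly_monom)
    \<comment> \<open>Since \<open>f\<close> is monic, \<open>v\<close> has an integral remainder
      \<open>r\<close> modulo \<open>f\<close>. Then \<open>N - p * r\<close> vanishes at
      \<open>w\<close> and has smaller degree than \<open>f\<close>, so it is the zero polynomial;
      its constant coefficient gives the divisibility.\<close>
    obtain a r where ar: "pseudo_divmod v f = (a, r)" by fastforce
    have f0: "f \<noteq> 0" using f by auto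
    from pseudo_divmod[OF f0 ar] f(1) have ar': "v = f * a + r" "Polynomial.degree r < Polynomial.degree f"
      using f(2) by auto
    have "?e v w = ?e r w" unfolding ar' using f(3) by (simp add: hom_distribs)
    hence "?e ([:int N:] - Polynomial.smult (int p) r) w = 0" using v by (simp add: hom_distribs)
    hence "f dvd [:int N:] - Polynomial.smult (int p) r" by (rule f(4))
    moreover have "Polynomial.degree ([:int N:] - Polynomial.smult (int p) r) < Polynomial.degree f"
      using ar'(2) f(2) by (intro degree_diff_less) (auto intro: le_less_trans[OF degree_smult_le])
    ultimately have "[:int N:] - Polynomial.smult (int p) r = 0"
      by (metis dvd_imp_degree_le leD)
    hence "Polynomial.coeff ([:int N:] - Polynomial.smult (int p) r) 0 = 0" by simp
    hence "int N = int p * Polynomial.coeff r 0" by simp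
    hence "p dvd N" by (metis dvd_triv_left int_dvd_int_iff)
    with assms(4) show False by contradiction
  qed
  moreover from f(4)[OF h] obtain b where "h = f * b" by blast
  ultimately show ?thesis by (simp add: hom_distribs)
qed

text \<open>Induction on the factorisation of \<open>k\<close>: a prime factor of \<open>k\<close>
  cannot divide \<open>N\<close>, and \<open>w ^ m\<close> is again an \<open>N\<close>-th root of
  unity, so the prime case applies to it.\<close>

lemma root_of_unity_power_conjugate:
  fixes w :: complex
  assumes "w ^ N = 1" "N > 0" "coprime k N" "poly (of_int_poly h) w = 0"
  shows "poly (of_int_poly h) (w ^ k) = 0"
  using assms(1,3,4)
proof (induction k arbitrary: w rule: less_induct)
  case (less k)
  show ?case
  proof (cases "k \<le> 1")
    case True
    \<comment> \<open>For \<open>k = 0\<close> coprimality forces \<open>N = 1\<close>, so that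
      \<open>w = 1\<close>.\<close>
    hence "k = 0 \<or> k = 1" by auto
    thus ?thesis using less.prems by auto
  next
    case False
    then obtain p where p: "Factorial_Ring.prime p" "p dvd k" using prime_factor_nat[of k] by auto
    then obtain m where m: "k = p * m" by blast
    have "m > 0" using m False by (cases m) auto
    hence mk: "m < k" using p m prime_gt_1_nat[of p] by simp
    have cop: "coprime m N" "coprime p N" using less.prems(2) unfolding m by auto
    hence "\<not> p dvd N" using p(1) by (metis coprime_absorb_left not_prime_unit)
    moreover from less.IH[OF mk less.prems(1) cop(1) less.prems(3)]
    have "poly (of_int_poly h) (w ^ m) = 0" .
    moreover have "(w ^ m) ^ N = 1" using less.prems(1) by (metis power_mult mult.commute power_one)
    ultimately have "poly (of_int_poly h) ((w ^ m) ^ p) = 0"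
      using root_of_unity_prime_power_conjugate[OF _ assms(2) p(1)] by blast
    thus ?thesis unfolding m by (simp add: power_mult mult.commute)
  qed
qed

lemma rat_poly_clear_denominators:
  fixes q :: "rat poly"
  obtains c h where "c \<noteq> 0" "Polynomial.smult (of_int c) q = of_int_poly h"
proof -
  have "\<exists>c h. c \<noteq> 0 \<and> Polynomial.smult (of_int c) q = of_int_poly h"
  proof (induction q)
    case 0
    show ?case by (intro exI[of _ 1] exI[of _ 0]) auto
  next
    case (pCons a q)
    then obtain c h where c: "c \<noteq> 0" "Polynomial.smult (of_int c) q = of_int_poly h" by blast
    obtain x y where xy: "quotient_of a = (x, y)" by fastforce
    have y: "y > 0" and a: "a = of_int x / of_int y"
      using quotient_of_denom_pos[OF xy] quotient_of_div[OF xy] by auto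
    have "Polynomial.smult (of_int (c * y)) (pCons a q)
          = of_int_poly (pCons (c * x) (Polynomial.smult y h))"
      using y by (simp add: a hom_distribs c(2)[symmetric] mult.commute)
    thus ?case using c y by (metis mult_eq_0_iff less_irrefl)
  qed
  thus thesis using that by blast
qed

lemma root_of_unity_rat_conjugate:
  fixes w :: complex
  assumes "w ^ N = 1" "N > 0" "coprime k N" "poly (map_poly of_rat q) w = 0"
  shows "poly (map_poly of_rat q) (w ^ k) = 0"
proof -
  obtain c h where c: "c \<noteq> 0" "Polynomial.smult (of_int c) q = of_int_poly h"
    by (rule rat_poly_clear_denominators)
  have "map_poly of_rat (of_int_poly h) = (of_int_poly h :: complex poly)"
    by (simp add: map_poly_map_poly o_def)
  hence *: "of_int c * poly (map_poly of_rat q) z = poly (of_int_poly h) z" for z :: complex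
    using arg_cong[OF c(2), of "\<lambda>r. poly (map_poly of_rat r) z"] by (simp add: hom_distribs)
  have "poly (of_int_poly h) w = 0" using *[of w] assms(4) by simp
  hence "poly (of_int_poly h) (w ^ k) = 0" by (rule root_of_unity_power_conjugate[OF assms(1-3)])
  thus ?thesis using *[of "w ^ k"] c(1) by simp
qed

subsection \<open>The cyclotomic field and its automorphisms\<close>

definition zeta :: "nat \<Rightarrow> complex" where
  "zeta N = cis (2 * pi / real N)"

definition eval_rat :: "rat poly \<Rightarrow> complex \<Rightarrow> complex" where
  "eval_rat q z = poly (map_poly of_rat q) z"

text \<open>As defined this is only the ring \<rat>[\<zeta>]; inverses are supplied by
  \<open>cyc_field_inverse\<close>. Having every element as the value of a polynomial lets
  automorphisms act by moving the point of evaluation.\<close>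

definition cyc_field :: "nat \<Rightarrow> complex set" where
  "cyc_field N = range (\<lambda>q. eval_rat q (zeta N))"

definition cyc_aut :: "nat \<Rightarrow> nat \<Rightarrow> complex \<Rightarrow> complex" where
  "cyc_aut N k x = eval_rat (SOME q. eval_rat q (zeta N) = x) (zeta N ^ k)"

text \<open>
  \<open>cyc_aut N k\<close> is the automorphism \<open>\<zeta> \<mapsto> \<zeta> ^ k\<close> of the cyclotomic field. For \<open>k\<close> coprime to \<open>N\<close>,
  and only then, its value does not depend on the chosen polynomial.
\<close>

lemma eval_rat_simps [simp]:
  "eval_rat 0 z = 0" "eval_rat 1 z = 1" "eval_rat [:c:] z = of_rat c"
  "eval_rat (p + q) z = eval_rat p z + eval_rat q z"
  "eval_rat (p - q) z = eval_rat p z - eval_rat q z"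
  "eval_rat (- p) z = - eval_rat p z"
  "eval_rat (p * q) z = eval_rat p z * eval_rat q z"
  "eval_rat (Polynomial.monom 1 n) z = z ^ n"
proof -
  interpret map_poly_comm_ring_hom "of_rat :: rat \<Rightarrow> complex" ..
  show "eval_rat 0 z = 0" "eval_rat 1 z = 1" "eval_rat [:c:] z = of_rat c"
    "eval_rat (p + q) z = eval_rat p z + eval_rat q z"
    "eval_rat (p - q) z = eval_rat p z - eval_rat q z"
    "eval_rat (- p) z = - eval_rat p z"
    "eval_rat (p * q) z = eval_rat p z * eval_rat q z"
    "eval_rat (Polynomial.monom 1 n) z = z ^ n"
    by (simp_all add: eval_rat_def hom_distribs poly_monom)
qed

lemma eval_rat_pcompose_monom:
  "eval_rat (pcompose q (Polynomial.monom 1 k)) z = eval_rat q (z ^ k)"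
  unfolding eval_rat_def by (simp only: of_rat_hom.map_poly_pcompose poly_pcompose) (simp add: hom_distribs poly_monom)

lemma zeta_root: "N > 0 \<Longrightarrow> zeta N ^ N = 1"
  by (simp add: zeta_def DeMoivre)

lemma root_of_unity_eq_zeta_power:
  assumes "z ^ N = 1" "N > 0"
  obtains i where "z = zeta N ^ i"
proof -
  have "z \<in> (\<lambda>k. cis (2 * pi * real k / real N)) ` {..<N}"
    using bij_betw_roots_unity[OF assms(2)] assms(1) by (simp add: bij_betw_def)
  then obtain j where "z = cis (2 * pi * real j / real N)" by blast
  also have "\<dots> = zeta N ^ j" by (simp add: zeta_def DeMoivre mult_ac)
  finally show thesis using that by blast
qed

section \<open>Rationality of sums over roots of unity\<close>

lemma sum_powers_root_of_unity:
  fixes w :: complex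
  assumes "w ^ N = 1"
  shows "(\<Sum>k\<in>{0<..N}. w ^ k) \<in> \<rat>"
proof (cases "w = 1")
  case False
  have "(\<Sum>k\<in>{0<..N}. w ^ k) = (\<Sum>k<N. w ^ Suc k)"
    by (rule sum.reindex_bij_witness[of _ Suc "\<lambda>k. k - 1"]) auto
  also have "\<dots> = w * (\<Sum>k<N. w ^ k)" by (simp add: sum_distrib_left)
  also have "(\<Sum>k<N. w ^ k) = 0" using geometric_sum[OF False, of N] assms by simp
  finally show ?thesis by simp
qed auto

text \<open>Sorting 1, ..., N by d = gcd(k, N) turns the class of d into the same kind of sum for
  \<open>N div d\<close> and \<open>w ^ d\<close>. Strong induction covers d > 1, the sum over all k
  is geometric, and the class d = 1 is what remains.\<close>

lemma ramanujan_sum_rational: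
  fixes w :: complex
  assumes "N > 0" "w ^ N = 1"
  shows "(\<Sum>k\<in>totatives N. w ^ k) \<in> \<rat>"
  using assms
proof (induction N arbitrary: w rule: less_induct)
  case (less N)
  let ?B = "\<lambda>d. {k\<in>{0<..N}. gcd k N = d}"
  have un: "{0<..N} = (\<Union>d\<in>{d. d dvd N}. ?B d)" by auto
  have fin: "finite {d. d dvd N}" using less.prems by simp
  have "(\<Sum>k\<in>{0<..N}. w ^ k) = (\<Sum>k\<in>(\<Union>d\<in>{d. d dvd N}. ?B d). w ^ k)"
    by (rule sum.cong[OF un refl])
  also have "\<dots> = (\<Sum>d\<in>{d. d dvd N}. \<Sum>k\<in>?B d. w ^ k)"
    by (rule sum.UNION_disjoint) (use fin in auto)
  also have "\<dots> = (\<Sum>k\<in>?B 1. w ^ k) + (\<Sum>d\<in>{d. d dvd N} - {1}. \<Sum>k\<in>?B d. w ^ k)"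
    using fin by (subst sum.remove[of _ 1]) auto
  also have "?B 1 = totatives N" by (auto simp: totatives_def coprime_iff_gcd_eq_1)
  finally have eq: "(\<Sum>k\<in>totatives N. w ^ k)
      = (\<Sum>k\<in>{0<..N}. w ^ k) - (\<Sum>d\<in>{d. d dvd N} - {1}. \<Sum>k\<in>?B d. w ^ k)" by simp
  have "(\<Sum>k\<in>?B d. w ^ k) \<in> \<rat>" if d: "d \<in> {d. d dvd N} - {1}" for d
  proof -
    have dN: "d dvd N" and d1: "d > 1" using d less.prems by (auto simp: nat_neq_iff dest: dvd_pos_nat)
    have "(\<Sum>k\<in>?B d. w ^ k) = (\<Sum>k\<in>totatives (N div d). w ^ (k * d))"
      by (rule sum.reindex_bij_betw[symmetric]) (rule bij_betw_totatives_gcd_eq[OF dN less.prems(1)])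
    also have "\<dots> = (\<Sum>k\<in>totatives (N div d). (w ^ d) ^ k)"
      by (simp add: mult.commute flip: power_mult)
    also have "\<dots> \<in> \<rat>"
      using d1 dN less.prems
      by (intro less.IH) (auto simp flip: power_mult intro: dvd_pos_nat simp: div_greater_zero_iff dvd_imp_le)
    finally show ?thesis .
  qed
  hence "(\<Sum>d\<in>{d. d dvd N} - {1}. \<Sum>k\<in>?B d. w ^ k) \<in> \<rat>" by (rule Rats_sum)
  thus ?case unfolding eq by (rule Rats_diff[OF sum_powers_root_of_unity[OF less.prems(2)]])
qed

lemma sum_eval_rat_rational:
  assumes "N > 0" "w ^ N = 1"
  shows "(\<Sum>k\<in>totatives N. eval_rat q (w ^ k)) \<in> \<rat>"
proof -
  have "(\<Sum>k\<in>totatives N. eval_rat q (w ^ k))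
    = (\<Sum>k\<in>totatives N. \<Sum>i\<le>Polynomial.degree q. of_rat (Polynomial.coeff q i) * (w ^ i) ^ k)"
    by (simp add: eval_rat_def poly_altdef mult.commute flip: power_mult)
  also have "\<dots> = (\<Sum>i\<le>Polynomial.degree q. of_rat (Polynomial.coeff q i) * (\<Sum>k\<in>totatives N. (w ^ i) ^ k))"
    by (subst sum.swap) (simp add: sum_distrib_left)
  also have "\<dots> \<in> \<rat>"
  proof (rule Rats_sum, rule Rats_mult)
    have "(w ^ i) ^ N = 1" for i using assms(2) by (metis power_mult mult.commute power_one)
    thus "(\<Sum>k\<in>totatives N. (w ^ i) ^ k) \<in> \<rat>" for i by (rule ramanujan_sum_rational[OF assms(1)])
  qed auto
  finally show ?thesis .
qed

section \<open>Field and automorphism laws for the cyclotomic field\<close>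

context
  fixes N :: nat
  assumes N: "N > 0"
begin

lemma cyc_aut_eval:
  assumes "coprime k N"
  shows "cyc_aut N k (eval_rat q (zeta N)) = eval_rat q (zeta N ^ k)"
proof -
  let ?r = "SOME r. eval_rat r (zeta N) = eval_rat q (zeta N)"
  have "eval_rat ?r (zeta N) = eval_rat q (zeta N)" by (rule someI_ex) auto
  hence "eval_rat (?r - q) (zeta N) = 0" by simp
  hence "eval_rat (?r - q) (zeta N ^ k) = 0"
    unfolding eval_rat_def by (rule root_of_unity_rat_conjugate[OF zeta_root[OF N] N assms])
  thus ?thesis by (simp add: cyc_aut_def)
qed

lemma cyc_fieldI: "eval_rat q (zeta N) \<in> cyc_field N" by (simp add: cyc_field_def)

lemma cyc_fieldE: assumes "x \<in> cyc_field N" obtains q where "x = eval_rat q (zeta N)"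
  using assms by (auto simp: cyc_field_def)

lemma cyc_field_closed:
  "x \<in> cyc_field N \<Longrightarrow> y \<in> cyc_field N \<Longrightarrow> x + y \<in> cyc_field N"
  "x \<in> cyc_field N \<Longrightarrow> y \<in> cyc_field N \<Longrightarrow> x * y \<in> cyc_field N"
  "x \<in> cyc_field N \<Longrightarrow> - x \<in> cyc_field N"
  "1 \<in> cyc_field N" "0 \<in> cyc_field N" "of_rat r \<in> cyc_field N" "zeta N ^ i \<in> cyc_field N"
  using cyc_fieldI[of 1] cyc_fieldI[of 0] cyc_fieldI[of "[:r:]"] cyc_fieldI[of "Polynomial.monom 1 i"]
proof -
  show "x + y \<in> cyc_field N" "x * y \<in> cyc_field N"
    if "x \<in> cyc_field N" "y \<in> cyc_field N"
    using that by (auto elim!: cyc_fieldE simp flip: eval_rat_simps intro: cyc_fieldI)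
  show "- x \<in> cyc_field N" if "x \<in> cyc_field N"
    using that by (auto elim!: cyc_fieldE simp flip: eval_rat_simps intro: cyc_fieldI)
qed simp_all

lemma cyc_field_sum: "(\<And>i. i \<in> I \<Longrightarrow> f i \<in> cyc_field N) \<Longrightarrow> (\<Sum>i\<in>I. f i) \<in> cyc_field N"
  by (induction I rule: infinite_finite_induct) (auto simp: cyc_field_closed)

lemma cyc_aut_add:
  assumes "coprime k N" "x \<in> cyc_field N" "y \<in> cyc_field N"
  shows "cyc_aut N k (x + y) = cyc_aut N k x + cyc_aut N k y"
  using assms by (elim cyc_fieldE) (simp add: cyc_aut_eval flip: eval_rat_simps(4))

lemma cyc_aut_mult:
  assumes "coprime k N" "x \<in> cyc_field N" "y \<in> cyc_field N"
  shows "cyc_aut N k (x * y) = cyc_aut N k x * cyc_aut N k y"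
  using assms by (elim cyc_fieldE) (simp add: cyc_aut_eval flip: eval_rat_simps(7))

lemma cyc_aut_uminus:
  assumes "coprime k N" "x \<in> cyc_field N"
  shows "cyc_aut N k (- x) = - cyc_aut N k x"
  using assms by (elim cyc_fieldE) (simp add: cyc_aut_eval flip: eval_rat_simps(6))

lemma cyc_aut_Rats:
  assumes "coprime k N" "x \<in> \<rat>"
  shows "cyc_aut N k x = x"
proof -
  from assms(2) obtain r where "x = eval_rat [:r:] (zeta N)" by (auto elim: Rats_cases)
  thus ?thesis using assms(1) by (simp only: cyc_aut_eval) simp
qed

lemma cyc_aut_sum:
  assumes "coprime k N" "\<And>i. i \<in> I \<Longrightarrow> f i \<in> cyc_field N"
  shows "cyc_aut N k (\<Sum>i\<in>I. f i) = (\<Sum>i\<in>I. cyc_aut N k (f i))"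
  using assms(2)
  by (induction I rule: infinite_finite_induct)
     (use assms(1) cyc_aut_Rats[of k 0] in \<open>auto simp: cyc_aut_add cyc_field_sum\<close>)

lemma cyc_aut_zeta:
  assumes "coprime k N"
  shows "cyc_aut N k (zeta N ^ i) = zeta N ^ (i * k)"
  using cyc_aut_eval[OF assms, of "Polynomial.monom 1 i"] by (simp add: mult.commute flip: power_mult)

lemma cyc_aut_closed:
  assumes "coprime k N" "x \<in> cyc_field N"
  shows "cyc_aut N k x \<in> cyc_field N"
  using assms(2) by (elim cyc_fieldE) (simp add: cyc_aut_eval[OF assms(1)] cyc_fieldI flip: eval_rat_pcompose_monom)

lemma cyc_aut_comp:
  assumes "coprime k N" "coprime l N" "x \<in> cyc_field N"
  shows "cyc_aut N k (cyc_aut N l x) = cyc_aut N (k * l) x"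
  using assms(3)
  by (elim cyc_fieldE) (simp add: cyc_aut_eval assms(1,2) power_mult flip: eval_rat_pcompose_monom[of _ l "zeta N"],
     simp add: eval_rat_pcompose_monom)

lemma cyc_aut_1: "x \<in> cyc_field N \<Longrightarrow> cyc_aut N 1 x = x"
  by (elim cyc_fieldE) (simp add: cyc_aut_eval[of 1, simplified])

lemma zeta_power_cong:
  assumes "[i = j] (mod N)"
  shows "zeta N ^ i = zeta N ^ j"
proof -
  have "zeta N ^ i = zeta N ^ (i mod N)" for i
    using zeta_root[OF N] by (metis div_mult_mod_eq mult.commute mult.left_neutral power_add power_mult power_one)
  thus ?thesis using assms by (metis cong_def)
qed

lemma cyc_aut_cong: "[k = l] (mod N) \<Longrightarrow> cyc_aut N k x = cyc_aut N l x"
  by (simp add: cyc_aut_def zeta_power_cong)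

lemma cyc_aut_trace_rational:
  assumes "x \<in> cyc_field N"
  shows "(\<Sum>k\<in>totatives N. cyc_aut N k x) \<in> \<rat>"
proof -
  from assms obtain q where q: "x = eval_rat q (zeta N)" by (rule cyc_fieldE)
  have "(\<Sum>k\<in>totatives N. cyc_aut N k x) = (\<Sum>k\<in>totatives N. eval_rat q (zeta N ^ k))"
    unfolding q by (intro sum.cong refl cyc_aut_eval) (auto simp: totatives_def)
  thus ?thesis using sum_eval_rat_rational[OF N zeta_root[OF N]] by simp
qed

text \<open>A fixed element is the average of its conjugates, and the trace is rational.\<close>

lemma cyc_aut_fixed:
  assumes "x \<in> cyc_field N" "\<And>k. k \<in> totatives N \<Longrightarrow> cyc_aut N k x = x"
  shows "x \<in> \<rat>"
proof -
  have "of_nat (totient N) * x \<in> \<rat>"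
    using cyc_aut_trace_rational[OF assms(1)] assms(2) by (simp add: totient_def)
  hence "of_nat (totient N) * x / of_nat (totient N) \<in> \<rat>" by (intro Rats_divide) auto
  thus ?thesis using N by simp
qed

text \<open>Let \<open>m\<close> be an annihilator of \<zeta> of least degree. Since
  \<open>q\<close> does not vanish at \<zeta>, neither does \<open>gcd q m\<close>, so the cofactor
  \<open>m'\<close> annihilates \<zeta> too. Minimality makes the gcd constant, and Bezout's
  identity evaluated at \<zeta> exhibits the inverse.\<close>

lemma cyc_field_inverse:
  assumes "x \<in> cyc_field N"
  shows "inverse x \<in> cyc_field N"
proof (cases "x = 0")
  case False
  from assms obtain q where q: "x = eval_rat q (zeta N)" by (rule cyc_fieldE)
  define P where "P d \<longleftrightarrow> (\<exists>m. m \<noteq> 0 \<and> eval_rat m (zeta N) = 0 \<and> Polynomial.degree m = d)" for d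
  have "Polynomial.coeff (Polynomial.monom 1 N - 1 :: rat poly) N \<noteq> 0" using N by (simp add: coeff_1)
  hence "Polynomial.monom 1 N - 1 \<noteq> (0 :: rat poly)" by (metis coeff_0)
  hence "P (Polynomial.degree (Polynomial.monom 1 N - 1 :: rat poly))"
    unfolding P_def using zeta_root[OF N] by (intro exI[of _ "Polynomial.monom 1 N - 1"]) simp
  hence "P (LEAST d. P d)" by (rule LeastI)
  then obtain m where m: "m \<noteq> 0" "eval_rat m (zeta N) = 0" "Polynomial.degree m = (LEAST d. P d)"
    unfolding P_def by blast
  obtain m' where m': "m = gcd q m * m'" by (metis gcd_dvd2 dvdE)
  obtain q' where q': "q = gcd q m * q'" by (metis gcd_dvd1 dvdE)
  have "eval_rat (gcd q m) (zeta N) \<noteq> 0"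
    using False unfolding q by (subst (asm) q') auto
  hence "eval_rat m' (zeta N) = 0" using m(2) by (subst (asm) m') simp
  moreover have m'0: "m' \<noteq> 0" using m' m(1) by auto
  ultimately have "P (Polynomial.degree m')" unfolding P_def by blast
  hence le: "Polynomial.degree m \<le> Polynomial.degree m'" unfolding m by (rule Least_le)
  have g0: "gcd q m \<noteq> 0" using m(1) by simp
  have "Polynomial.degree m = Polynomial.degree (gcd q m) + Polynomial.degree m'"
    by (subst m', rule degree_mult_eq[OF g0 m'0])
  hence "Polynomial.degree (gcd q m) = 0" using le by simp
  hence "is_unit (gcd q m)" using g0 by (simp add: is_unit_iff_degree)
  hence "gcd q m = 1" using normalize_gcd is_unit_normalize by metis
  moreover obtain a b where "a * q + b * m = gcd q m" using bezout_coefficients[of q m] by (metis prod.collapse)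
  ultimately have "a * q + b * m = 1" by simp
  hence "eval_rat (a * q + b * m) (zeta N) = 1" by simp
  hence "eval_rat a (zeta N) * x = 1" using m(2) q by simp
  hence "inverse x = eval_rat a (zeta N)" by (metis inverse_unique mult.commute)
  thus ?thesis by (simp add: cyc_fieldI)
qed (simp add: cyc_field_closed)

lemma cyc_aut_eq_0_iff:
  assumes "coprime k N" "x \<in> cyc_field N"
  shows "cyc_aut N k x = 0 \<longleftrightarrow> x = 0"
proof
  assume 0: "cyc_aut N k x = 0"
  show "x = 0"
  proof (rule ccontr)
    assume "x \<noteq> 0"
    hence "cyc_aut N k (x * inverse x) = 1" using cyc_aut_Rats[of k 1] assms by simp
    thus False using 0 assms by (simp add: cyc_aut_mult cyc_field_inverse)
  qed
qed (use cyc_aut_Rats[of k 0] assms in auto)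

lemma cyc_aut_inverse:
  assumes "coprime k N" "x \<in> cyc_field N"
  shows "cyc_aut N k (inverse x) = inverse (cyc_aut N k x)"
proof (cases "x = 0")
  case False
  hence "cyc_aut N k (x * inverse x) = 1" using cyc_aut_Rats[of k 1] assms by simp
  hence "cyc_aut N k x * cyc_aut N k (inverse x) = 1" using assms by (simp add: cyc_aut_mult cyc_field_inverse)
  thus ?thesis by (metis inverse_unique)
qed (use cyc_aut_Rats[of k 0] assms in auto)

end

subsection \<open>Galois groups and degrees of subfields\<close>

lemma class_ring_m_inv:
  fixes x :: "'a :: field"
  assumes "x \<noteq> 0"
  shows "inv\<^bsub>class_ring\<^esub> x = inverse x"
  using assms by (intro class_cring.comm_inv_char) (auto simp: class_ring_simps)

lemma generate_field_class_ring_closed: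
  fixes V :: "complex set"
  defines "K \<equiv> generate_field class_ring V"
  shows "V \<subseteq> K" "1 \<in> K" "0 \<in> K"
    "x \<in> K \<Longrightarrow> y \<in> K \<Longrightarrow> x + y \<in> K"
    "x \<in> K \<Longrightarrow> y \<in> K \<Longrightarrow> x * y \<in> K"
    "x \<in> K \<Longrightarrow> - x \<in> K" "x \<in> K \<Longrightarrow> inverse x \<in> K"
proof -
  show "V \<subseteq> K" unfolding K_def by (auto intro: generate_field.incl)
  show 1: "1 \<in> K" using generate_field.one[of class_ring V] by (simp add: K_def)
  show add: "x \<in> K \<Longrightarrow> y \<in> K \<Longrightarrow> x + y \<in> K" for x y
    using generate_field.eng_add[of x class_ring V y] by (simp add: K_def)
  show "x \<in> K \<Longrightarrow> y \<in> K \<Longrightarrow> x * y \<in> K"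
    using generate_field.eng_mult[of x class_ring V y] by (simp add: K_def)
  show um: "x \<in> K \<Longrightarrow> - x \<in> K" for x
    using generate_field.a_inv[of x class_ring V] by (simp add: K_def class_ring_simps)
  show 0: "0 \<in> K" using add[OF 1 um[OF 1]] by simp
  show "x \<in> K \<Longrightarrow> inverse x \<in> K"
    using generate_field.m_inv[of x class_ring V] 0
    by (cases "x = 0") (simp_all add: K_def class_ring_m_inv)
qed

lemma generate_field_class_ring_induct [consumes 1, case_names one incl uminus inverse add mult]:
  fixes V :: "complex set"
  assumes "x \<in> generate_field class_ring V"
    and "P 1" "\<And>v. v \<in> V \<Longrightarrow> P v" "\<And>x. P x \<Longrightarrow> P (- x)"
    and "\<And>x. P x \<Longrightarrow> x \<noteq> 0 \<Longrightarrow> P (inverse x)"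
    and "\<And>x y. P x \<Longrightarrow> P y \<Longrightarrow> P (x + y)" "\<And>x y. P x \<Longrightarrow> P y \<Longrightarrow> P (x * y)"
  shows "P x"
  using assms(1)
  by (induction rule: generate_field.induct)
     (use assms(2-) in \<open>auto simp: class_ring_simps class_ring_m_inv\<close>)

lemma Rats_subset_generate_field:
  fixes V :: "complex set"
  shows "\<rat> \<subseteq> generate_field class_ring V"
proof -
  let ?K = "generate_field class_ring V"
  note cl = generate_field_class_ring_closed[where V = V]
  have nat: "of_nat n \<in> ?K" for n by (induction n) (auto simp: cl)
  have int: "of_int i \<in> ?K" for i by (cases i rule: int_cases2) (auto simp: cl nat)
  show ?thesis
  proof
    fix x :: complex assume "x \<in> \<rat>"
    then obtain a b where "x = of_int a / of_int b" by (elim Rats_cases') auto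
    thus "x \<in> ?K" by (simp add: divide_inverse cl int)
  qed
qed

lemma cyc_field_generate:
  assumes "N > 0" "V \<subseteq> cyc_field N"
  shows "generate_field class_ring V \<subseteq> cyc_field N"
proof
  fix x assume "x \<in> generate_field class_ring V"
  thus "x \<in> cyc_field N"
    by (induction rule: generate_field_class_ring_induct)
       (use assms in \<open>auto simp: cyc_field_closed cyc_field_inverse\<close>)
qed

lemma cyc_field_diff:
  "N > 0 \<Longrightarrow> x \<in> cyc_field N \<Longrightarrow> y \<in> cyc_field N \<Longrightarrow> x - y \<in> cyc_field N"
  using cyc_field_closed(1)[of N x "- y"] by (simp add: cyc_field_closed)

text \<open>Newton interpolation: a new node is met by adding a multiple of the product of the
  \<open>X - n s\<close> over the old nodes, which leaves the old values alone. The coefficients are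
  kept in the cyclotomic field so that \<open>cyc_aut\<close> can act on them; the degree bound is
  put on coefficients so that it makes sense for empty \<open>R\<close>.\<close>

lemma interpolation_in_cyc_field:
  assumes "N > 0" "finite R" "inj_on n R" "n ` R \<subseteq> cyc_field N" "v ` R \<subseteq> cyc_field N"
  shows "\<exists>P. (\<forall>i \<ge> card R. Polynomial.coeff P i = 0) \<and> (\<forall>i. Polynomial.coeff P i \<in> cyc_field N) \<and>
    (\<forall>s\<in>R. poly P (n s) = v s)"
  using assms(2-)
proof (induction R rule: finite_induct)
  case empty
  show ?case by (intro exI[of _ 0]) (auto simp: cyc_field_closed assms(1))
next
  case (insert r R)
  note cl = cyc_field_diff[OF assms(1)] cyc_field_closed[OF assms(1)] cyc_field_inverse[OF assms(1)] cyc_field_sum[OF assms(1)]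
  from insert obtain P where P: "\<forall>i \<ge> card R. Polynomial.coeff P i = 0"
    "\<forall>i. Polynomial.coeff P i \<in> cyc_field N" "\<forall>s\<in>R. poly P (n s) = v s" by auto
  define Q where "Q = (\<Prod>s\<in>R. [:- n s, 1:])"
  have "\<forall>i. Polynomial.coeff (\<Prod>s\<in>S. [:- n s, 1:]) i \<in> cyc_field N" if "S \<subseteq> R" for S
    using finite_subset[OF that insert.hyps(1)] that
  proof (induction S rule: finite_induct)
    case (insert s S)
    hence "n s \<in> cyc_field N" using insert.prems \<open>n ` (Set.insert r R) \<subseteq> _\<close> by auto
    with insert show ?case by (auto simp: coeff_pCons cl split: nat.split)
  qed (auto simp: coeff_1 cl)
  hence Qc: "Polynomial.coeff Q i \<in> cyc_field N" for i unfolding Q_def by blast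
  have Qd: "Polynomial.degree Q = card R" unfolding Q_def by (subst degree_prod_eq_sum_degree) auto
  have Qr: "poly Q (n s) = 0" if "s \<in> R" for s
    unfolding Q_def poly_prod using insert.hyps(1) that by (auto simp: prod_zero_iff)
  have Q0: "poly Q (n r) \<noteq> 0"
    unfolding Q_def poly_prod using insert by (auto simp: prod_zero_iff inj_on_def)
  have ev: "poly T (n r) \<in> cyc_field N" if "\<forall>i. Polynomial.coeff T i \<in> cyc_field N" for T
  proof -
    have nr: "n r \<in> cyc_field N" using insert.prems by auto
    have "n r ^ i \<in> cyc_field N" for i by (induction i) (auto simp: cl nr)
    thus ?thesis using that by (auto simp: poly_altdef cl)
  qed
  define c where "c = (v r - poly P (n r)) * inverse (poly Q (n r))"
  hence c: "c \<in> cyc_field N" unfolding c_def using insert.prems ev[OF P(2)] ev Qc by (simp add: cl)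
  show ?case
  proof (intro exI[of _ "P + Polynomial.smult c Q"] conjI allI impI ballI)
    fix i assume "card (insert r R) \<le> i"
    hence "i > card R" using insert.hyps by simp
    thus "Polynomial.coeff (P + Polynomial.smult c Q) i = 0" using P(1) Qd by (simp add: coeff_eq_0)
  next
    fix i show "Polynomial.coeff (P + Polynomial.smult c Q) i \<in> cyc_field N" using P(2) Qc c by (simp add: cl)
  next
    fix s assume "s \<in> insert r R"
    thus "poly (P + Polynomial.smult c Q) (n s) = v s" using P(3) Qr Q0 by (auto simp: c_def mult.assoc)
  qed
qed

text \<open>\<open>totatives N\<close> lies in {1..N}, so the residue 0 has to become 1 when
  \<open>N = 1\<close>; for larger \<open>N\<close> no unit is congruent to 0.\<close>

definition totatives_rep :: "nat \<Rightarrow> nat \<Rightarrow> nat" where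
  "totatives_rep N k = (if N = 1 then 1 else k mod N)"

lemma totatives_rep:
  assumes "N > 0"
  shows "[totatives_rep N k = k] (mod N)"
    and "coprime k N \<Longrightarrow> totatives_rep N k \<in> totatives N"
  using assms by (auto simp: totatives_rep_def cong_def totatives_def coprime_iff_gcd_eq_1 intro!: Nat.gr0I)

lemma totatives_cong_eq:
  assumes "[k = l] (mod N)" "k \<in> totatives N" "l \<in> totatives N"
  shows "k = l"
proof (cases "N = 1")
  case True
  thus ?thesis using assms by (auto simp: totatives_def)
next
  case False
  hence "m < N" if "m \<in> totatives N" for m using that by (auto simp: totatives_def le_less)
  hence "k < N" "l < N" using assms(2,3) by auto
  thus ?thesis using assms(1) by (simp add: cong_def)
qed

text \<open>Multiplication by the unit \<open>l\<close> permutes the units modulo \<open>N\<close>.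
  The products \<open>k * l\<close> leave the system of representatives, so \<open>f\<close> has to
  depend on residues alone.\<close>

lemma sum_totatives_mult:
  fixes f :: "nat \<Rightarrow> 'a :: comm_monoid_add"
  assumes "N > 0" "coprime l N" "\<And>k k'. [k = k'] (mod N) \<Longrightarrow> f k = f k'"
  shows "(\<Sum>k\<in>totatives N. f (k * l)) = (\<Sum>k\<in>totatives N. f k)"
proof -
  let ?h = "\<lambda>k. totatives_rep N (k * l)"
  have inj: "inj_on ?h (totatives N)"
  proof (rule inj_onI)
    fix k k' assume k: "k \<in> totatives N" "k' \<in> totatives N" "?h k = ?h k'"
    hence "[k * l = k' * l] (mod N)"
      using totatives_rep(1)[OF assms(1), of "k * l"] totatives_rep(1)[OF assms(1), of "k' * l"]
      by (metis cong_sym cong_trans)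
    hence "[k = k'] (mod N)" using assms(2) by (simp add: cong_mult_rcancel_nat)
    thus "k = k'" using k totatives_cong_eq by blast
  qed
  have "?h ` totatives N \<subseteq> totatives N"
    using assms(2) by (auto intro!: totatives_rep(2)[OF assms(1)] simp: in_totatives_iff)
  hence "bij_betw ?h (totatives N) (totatives N)"
    using inj by (simp add: bij_betw_def endo_inj_surj)
  from sum.reindex_bij_betw[OF this, of f]
  have "(\<Sum>k\<in>totatives N. f (?h k)) = (\<Sum>k\<in>totatives N. f k)" .
  thus ?thesis using assms(3)[OF totatives_rep(1)[OF assms(1)]] by simp
qed

text \<open>\<open>V\<close> will be the set of values of a character, which is stable because
  conjugating \<chi>(g) gives \<chi>(g ^ k). Stability of \<open>V\<close> makes each
  \<open>cyc_aut N k\<close> restrict to the field generated by \<open>V\<close>.\<close>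

locale galois_stable_set =
  fixes N :: nat and V :: "complex set"
  assumes N: "N > 0" and finV: "finite V" and VN: "V \<subseteq> cyc_field N"
    and stable: "\<And>k v. k \<in> totatives N \<Longrightarrow> v \<in> V \<Longrightarrow> cyc_aut N k v \<in> V"
begin

definition K :: "complex set" where "K = generate_field class_ring V"

text \<open>Made extensional, as \<open>gal_over_rats\<close> demands, so that exponents acting
  alike on \<open>K\<close> give one and the same element of \<open>auts\<close>.\<close>

definition res_aut :: "nat \<Rightarrow> complex \<Rightarrow> complex" where
  "res_aut k = restrict (cyc_aut N k) K"

definition auts :: "(complex \<Rightarrow> complex) set" where
  "auts = res_aut ` totatives N"

lemmas K_closed = generate_field_class_ring_closed[where V = V, folded K_def]

lemma K_sub: "x \<in> K \<Longrightarrow> x \<in> cyc_field N"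
  using cyc_field_generate[OF N VN] by (auto simp: K_def)

lemma Rats_K: "\<rat> \<subseteq> K"
  unfolding K_def by (rule Rats_subset_generate_field)

lemma cyc_aut_K:
  assumes "k \<in> totatives N" "x \<in> K"
  shows "cyc_aut N k x \<in> K"
proof -
  have k: "coprime k N" using assms by (simp add: in_totatives_iff)
  \<comment> \<open>Membership in the cyclotomic field is carried through the induction, since the
    laws of \<open>cyc_aut\<close> are available only there.\<close>
  have "x \<in> cyc_field N \<and> cyc_aut N k x \<in> K"
    using assms(2) unfolding K_def
  proof (induction rule: generate_field_class_ring_induct)
    case one
    thus ?case using cyc_aut_Rats[OF N k, of 1] cyc_field_closed(4)[OF N] K_closed(2) by (simp add: K_def)
  next
    case (incl v)
    thus ?case using stable[OF assms(1)] VN K_closed(1) by (auto simp: K_def)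
  qed (use N k in \<open>auto simp: cyc_field_closed cyc_field_inverse cyc_aut_uminus cyc_aut_inverse cyc_aut_add cyc_aut_mult
        intro: K_closed[unfolded K_def]\<close>)
  thus ?thesis by simp
qed

lemma res_aut_eq_iff:
  assumes "k \<in> totatives N" "l \<in> totatives N"
  shows "res_aut k = res_aut l \<longleftrightarrow> (\<forall>v\<in>V. cyc_aut N k v = cyc_aut N l v)"
proof
  assume "res_aut k = res_aut l"
  thus "\<forall>v\<in>V. cyc_aut N k v = cyc_aut N l v"
    using K_closed(1) unfolding res_aut_def by (metis restrict_apply' subsetD)
next
  assume *: "\<forall>v\<in>V. cyc_aut N k v = cyc_aut N l v"
  have kl: "coprime k N" "coprime l N" using assms by (simp_all add: in_totatives_iff)
  have "x \<in> cyc_field N \<and> cyc_aut N k x = cyc_aut N l x" if "x \<in> K" for x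
    using that unfolding K_def
  proof (induction rule: generate_field_class_ring_induct)
    case one
    thus ?case using cyc_aut_Rats[OF N kl(1), of 1] cyc_aut_Rats[OF N kl(2), of 1]
      cyc_field_closed(4)[OF N] by simp
  next
    case (incl v)
    thus ?case using * VN by auto
  qed (use N kl in \<open>auto simp: cyc_field_closed cyc_field_inverse cyc_aut_uminus cyc_aut_inverse cyc_aut_add cyc_aut_mult\<close>)
  thus "res_aut k = res_aut l" unfolding res_aut_def by (intro restrict_ext) simp
qed

lemma totatives_inverse:
  assumes "k \<in> totatives N"
  obtains l where "l \<in> totatives N" "[k * l = 1] (mod N)"
proof -
  have "coprime k N" using assms by (simp add: in_totatives_iff)
  then obtain l where l: "[k * l = 1] (mod N)" using cong_solve_coprime_nat by (metis One_nat_def)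
  hence "coprime l N" by (metis cong_imp_coprime cong_sym coprime_1_left coprime_mult_left_iff)
  moreover have "[k * totatives_rep N l = k * l] (mod N)"
    using totatives_rep(1)[OF N] by (intro cong_mult) auto
  ultimately show thesis using that[of "totatives_rep N l"] totatives_rep(2)[OF N] l cong_trans by blast
qed

lemma res_aut_in_gal:
  assumes "k \<in> totatives N"
  shows "res_aut k \<in> gal_over_rats K"
proof -
  have k: "coprime k N" using assms by (simp add: in_totatives_iff)
  obtain l where l: "l \<in> totatives N" "[k * l = 1] (mod N)" using totatives_inverse[OF assms] .
  have l': "coprime l N" using l by (simp add: in_totatives_iff)
  have inv: "cyc_aut N k (cyc_aut N l x) = x" "cyc_aut N l (cyc_aut N k x) = x" if "x \<in> K" for x
    using cyc_aut_comp[OF N k l' K_sub[OF that]] cyc_aut_comp[OF N l' k K_sub[OF that]]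
      cyc_aut_cong[OF N l(2)] cyc_aut_1[OF N K_sub[OF that]] by (simp_all add: mult.commute)
  have "bij_betw (cyc_aut N k) K K"
    by (rule bij_betw_byWitness[of _ "cyc_aut N l"]) (use inv cyc_aut_K assms l(1) in auto)
  moreover have "cyc_aut N k 1 = 1" using cyc_aut_Rats[OF N k, of 1] by simp
  ultimately show ?thesis
    using Rats_K unfolding gal_over_rats_def res_aut_def ring_iso_def Ring.ring_hom_def
    by (auto simp: bij_betw_restrict_eq K_closed cyc_aut_K[OF assms] K_sub cyc_aut_add[OF N k] cyc_aut_mult[OF N k]
       cyc_aut_Rats[OF N k])
qed

lemma gal_props:
  assumes "\<sigma> \<in> gal_over_rats K"
  shows "x \<in> K \<Longrightarrow> y \<in> K \<Longrightarrow> \<sigma> (x + y) = \<sigma> x + \<sigma> y"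
    "x \<in> K \<Longrightarrow> y \<in> K \<Longrightarrow> \<sigma> (x * y) = \<sigma> x * \<sigma> y"
    "x \<in> K \<Longrightarrow> \<sigma> x \<in> K" "\<sigma> (of_rat r) = of_rat r" "x \<notin> K \<Longrightarrow> \<sigma> x = undefined"
  using assms unfolding gal_over_rats_def ring_iso_def Ring.ring_hom_def
  by (auto simp: extensional_def)

lemma auts_sub: "auts \<subseteq> gal_over_rats K"
  using res_aut_in_gal by (auto simp: auts_def)

lemma finite_auts: "finite auts" by (simp add: auts_def)

lemma eval_rat_K: "x \<in> K \<Longrightarrow> eval_rat q x \<in> K"
proof (induction q)
  case (pCons a q)
  have "eval_rat (pCons a q) x = of_rat a + x * eval_rat q x" by (simp add: eval_rat_def hom_distribs)
  moreover have "of_rat a \<in> K" using Rats_K by auto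
  ultimately show ?case using pCons by (simp add: K_closed)
qed (simp add: K_closed)

lemma gal_eval_rat:
  assumes "\<sigma> \<in> gal_over_rats K" "x \<in> K"
  shows "\<sigma> (eval_rat q x) = eval_rat q (\<sigma> x)"
proof (induction q)
  case 0
  show ?case using gal_props(4)[OF assms(1), of 0] by simp
next
  case (pCons a q)
  have *: "eval_rat (pCons a q) x = of_rat a + x * eval_rat q x" for x by (simp add: eval_rat_def hom_distribs)
  have "of_rat a \<in> K" using Rats_K by auto
  thus ?case unfolding * using pCons assms(2) eval_rat_K[OF assms(2)]
    by (simp add: gal_props[OF assms(1)] K_closed)
qed

text \<open>\<open>\<theta>\<close> is the value at a natural number \<open>t\<close> of the
  polynomial that has the elements of \<open>V\<close> as coefficients, at distinct exponents
  \<open>i v\<close>. Two different restrictions differ at some \<open>v\<close>, so the polynomial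
  \<open>P\<close> of their differences is nonzero, and \<open>t\<close> only has to avoid the
  finitely many roots of these. That \<theta> generates \<open>K\<close> emerges later, from
  \<open>rational_interpolation\<close>.\<close>

lemma primitive_element:
  obtains \<theta> where "\<theta> \<in> K" "inj_on (\<lambda>\<sigma>. \<sigma> \<theta>) auts"
proof -
  obtain i :: "complex \<Rightarrow> nat" where i: "inj_on i V" using finite_imp_inj_to_nat_seg[OF finV] by blast
  define D where "D = {p \<in> auts \<times> auts. fst p \<noteq> snd p}"
  define P where "P p = (\<Sum>v\<in>V. Polynomial.monom (fst p v - snd p v) (i v))" for p :: "(complex \<Rightarrow> complex) \<times> _"
  have finD: "finite D" unfolding D_def using finite_auts by simp
  have nz: "P p \<noteq> 0" if "p \<in> D" for p
  proof
    assume 0: "P p = 0"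
    from that obtain k l where kl: "k \<in> totatives N" "l \<in> totatives N" "p = (res_aut k, res_aut l)"
      "res_aut k \<noteq> res_aut l" by (auto simp: D_def auts_def)
    then obtain v where v: "v \<in> V" "cyc_aut N k v \<noteq> cyc_aut N l v" using res_aut_eq_iff by blast
    have "Polynomial.coeff (P p) (i v) = (\<Sum>u\<in>V. if u = v then fst p u - snd p u else 0)"
      unfolding P_def Polynomial.coeff_sum using i v(1) by (intro sum.cong) (auto simp: inj_on_def)
    also have "\<dots> = fst p v - snd p v" using finV v(1) by simp
    also have "\<dots> \<noteq> 0" using v K_closed(1) by (auto simp: kl(3) res_aut_def)
    finally show False using 0 by simp
  qed
  have "finite (\<Union>p\<in>D. {z. poly (P p) z = 0})" using finD nz poly_roots_finite by blast
  hence "finite (of_nat -` (\<Union>p\<in>D. {z. poly (P p) z = 0}) :: nat set)"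
    by (rule finite_vimageI) (simp add: inj_on_def)
  then obtain t :: nat where t: "t \<notin> of_nat -` (\<Union>p\<in>D. {z. poly (P p) z = 0})"
    using ex_new_if_finite infinite_UNIV_nat by blast
  define \<theta> where "\<theta> = (\<Sum>v\<in>V. of_nat t ^ i v * v)"
  have tK: "of_nat t ^ n * v \<in> K" if "v \<in> K" for n v
    using Rats_K that by (intro K_closed) (auto intro: Rats_power)
  have \<theta>: "(\<Sum>v\<in>U. of_nat t ^ i v * v) \<in> K \<and>
      \<sigma> (\<Sum>v\<in>U. of_nat t ^ i v * v) = (\<Sum>v\<in>U. of_nat t ^ i v * \<sigma> v)"
    if "U \<subseteq> V" "\<sigma> \<in> gal_over_rats K" for U \<sigma>
    using finite_subset[OF that(1) finV] that(1)
  proof (induction U rule: finite_induct)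
    case empty
    show ?case using gal_props(4)[OF that(2), of 0] by (simp add: K_closed)
  next
    case (insert u U)
    have u: "u \<in> K" using insert.prems K_closed(1) by auto
    have r: "of_nat t ^ i u = complex_of_rat (of_nat t ^ i u)" by (simp add: of_rat_power)
    have "\<sigma> (of_nat t ^ i u * u) = of_nat t ^ i u * \<sigma> u"
      using Rats_K u unfolding r by (subst gal_props(2)[OF that(2)]) (auto simp: gal_props(4)[OF that(2)])
    with insert u tK show ?case by (auto simp: gal_props(1)[OF that(2)] K_closed)
  qed
  have "inj_on (\<lambda>\<sigma>. \<sigma> \<theta>) auts"
  proof (rule inj_onI, rule ccontr)
    fix \<sigma> \<sigma>' assume s: "\<sigma> \<in> auts" "\<sigma>' \<in> auts" "\<sigma> \<theta> = \<sigma>' \<theta>" "\<sigma> \<noteq> \<sigma>'"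
    have "\<sigma> \<theta> = (\<Sum>v\<in>V. of_nat t ^ i v * \<sigma> v)" "\<sigma>' \<theta> = (\<Sum>v\<in>V. of_nat t ^ i v * \<sigma>' v)"
      unfolding \<theta>_def using s auts_sub \<theta>[of V] by blast+
    hence "poly (P (\<sigma>, \<sigma>')) (of_nat t) = \<sigma> \<theta> - \<sigma>' \<theta>"
      unfolding P_def by (simp add: poly_sum poly_monom sum_subtractf algebra_simps)
    moreover have "(\<sigma>, \<sigma>') \<in> D" using s by (simp add: D_def)
    ultimately show False using t s(3) by auto
  qed
  moreover have "\<theta> \<in> K" unfolding \<theta>_def using \<theta>[of V "res_aut 1"] res_aut_in_gal[of 1] N by simp
  ultimately show thesis using that by blast
qed

lemma cyc_aut_res_aut:
  assumes "k \<in> totatives N" "l \<in> totatives N" "x \<in> K"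
  shows "cyc_aut N k (res_aut l x) = res_aut (totatives_rep N (k * l)) x"
proof -
  have kl: "coprime k N" "coprime l N" using assms by (simp_all add: in_totatives_iff)
  show ?thesis
    using cyc_aut_comp[OF N kl K_sub[OF assms(3)]] cyc_aut_cong[OF N totatives_rep(1)[OF N, of "k * l"]]
      assms(3) by (simp add: res_aut_def)
qed

text \<open>
  The polynomial of degree less than \<open>card auts\<close> interpolating \<open>\<sigma> \<theta> \<mapsto> \<sigma> x\<close> is unique, hence
  invariant under the Galois action on its coefficients, hence rational.
\<close>

lemma rational_interpolation:
  assumes \<theta>: "\<theta> \<in> K" "inj_on (\<lambda>\<sigma>. \<sigma> \<theta>) auts" and x: "x \<in> K"
  obtains q where "\<And>i. i \<ge> card auts \<Longrightarrow> Polynomial.coeff q i = 0" "x = eval_rat q \<theta>"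
proof -
  have a: "\<sigma> y \<in> cyc_field N" if "\<sigma> \<in> auts" "y \<in> K" for \<sigma> y
    using that auts_sub gal_props(3) K_sub by blast
  have "\<exists>P. (\<forall>i \<ge> card auts. Polynomial.coeff P i = 0) \<and> (\<forall>i. Polynomial.coeff P i \<in> cyc_field N) \<and>
      (\<forall>\<sigma>\<in>auts. poly P (\<sigma> \<theta>) = \<sigma> x)"
    by (rule interpolation_in_cyc_field[OF N finite_auts \<theta>(2)]) (use a \<theta>(1) x in auto)
  then obtain P where P: "\<And>i. i \<ge> card auts \<Longrightarrow> Polynomial.coeff P i = 0"
    "\<And>i. Polynomial.coeff P i \<in> cyc_field N" "\<And>\<sigma>. \<sigma> \<in> auts \<Longrightarrow> poly P (\<sigma> \<theta>) = \<sigma> x" by blast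
  have ne: "card auts > 0" using finite_auts N by (auto simp: auts_def card_gt_0_iff)
  have degP: "Polynomial.degree P < card auts"
    using P(1) ne by (metis degree_eq_zeroE leading_coeff_0_iff leI degree_0)
  have fixed: "cyc_aut N k (Polynomial.coeff P i) = Polynomial.coeff P i" if k: "k \<in> totatives N" for k i
  proof -
    have k': "coprime k N" using k by (simp add: in_totatives_iff)
    define P' where "P' = map_poly (cyc_aut N k) P"
    have c0: "cyc_aut N k 0 = 0" using cyc_aut_Rats[OF N k', of 0] by simp
    have cP': "Polynomial.coeff P' j = cyc_aut N k (Polynomial.coeff P j)" for j
      by (simp add: P'_def coeff_map_poly c0)
    have degP': "Polynomial.degree P' < card auts"
      unfolding P'_def using degree_map_poly_le degP le_less_trans by blast
    have ev: "poly P' (cyc_aut N k y) = cyc_aut N k (poly P y)" if y: "y \<in> cyc_field N" for y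
    proof -
      have yp: "y ^ j \<in> cyc_field N \<and> cyc_aut N k (y ^ j) = cyc_aut N k y ^ j" for j
        by (induction j) (use y cyc_aut_Rats[OF N k', of 1] in \<open>auto simp: cyc_field_closed[OF N] cyc_aut_mult[OF N k']\<close>)
      have "poly P' z = (\<Sum>j\<le>Polynomial.degree P. Polynomial.coeff P' j * z ^ j)" for z
        unfolding poly_altdef P'_def using degree_map_poly_le[of "cyc_aut N k" P]
        by (intro sum.mono_neutral_left) (auto simp: coeff_eq_0)
      thus ?thesis
        unfolding poly_altdef[of P] using P(2) yp
        by (simp add: cP' cyc_aut_sum[OF N k'] cyc_field_closed[OF N] cyc_aut_mult[OF N k'])
    qed
    have "P' = P"
    proof (rule poly_eqI_degree)
      show "Polynomial.degree P' < card ((\<lambda>\<sigma>. \<sigma> \<theta>) ` auts)"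
        "Polynomial.degree P < card ((\<lambda>\<sigma>. \<sigma> \<theta>) ` auts)"
        using degP degP' \<theta>(2) by (simp_all add: card_image)
      fix y assume "y \<in> (\<lambda>\<sigma>. \<sigma> \<theta>) ` auts"
      then obtain l where l: "l \<in> totatives N" "y = res_aut l \<theta>" by (auto simp: auts_def)
      \<comment> \<open>\<open>m\<close> stands for \<open>l\<close> divided by \<open>k\<close>
        modulo \<open>N\<close>: \<open>cyc_aut N k\<close> carries the node
        \<open>res_aut m \<theta>\<close> to the node \<open>res_aut l \<theta>\<close>, and the
        prescribed values in the same way.\<close>
      obtain k2 where k2: "k2 \<in> totatives N" "[k * k2 = 1] (mod N)" using totatives_inverse[OF k] .
      define m where "m = totatives_rep N (k2 * l)"
      have co: "coprime k2 N" "coprime l N" using k2 l by (simp_all add: in_totatives_iff)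
      have m: "m \<in> totatives N" unfolding m_def using co by (intro totatives_rep[OF N]) auto
      have "cyc_aut N k (res_aut m z) = res_aut l z" if z: "z \<in> K" for z
      proof -
        have mz: "res_aut m z = cyc_aut N k2 (res_aut l z)"
          using cyc_aut_res_aut[OF k2(1) l(1) z] by (simp add: m_def)
        have lz: "res_aut l z \<in> cyc_field N"
          using z l(1) cyc_aut_K K_sub by (auto simp: res_aut_def)
        show ?thesis unfolding mz
          using cyc_aut_comp[OF N k' co(1) lz] cyc_aut_cong[OF N k2(2)] cyc_aut_1[OF N lz] by simp
      qed
      hence y: "y = cyc_aut N k (res_aut m \<theta>)" "res_aut l x = cyc_aut N k (res_aut m x)"
        using \<theta>(1) x l(2) by auto
      have "res_aut m \<in> auts" "res_aut l \<in> auts" using m l by (auto simp: auts_def)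
      hence "poly P' y = cyc_aut N k (res_aut m x)"
        unfolding y using P(3)[of "res_aut m"] a[of "res_aut m" \<theta>] \<theta>(1) by (simp add: ev)
      also have "\<dots> = poly P y" using P(3)[OF \<open>res_aut l \<in> auts\<close>] l(2) y(2) by simp
      finally show "poly P' y = poly P y" .
    qed
    thus ?thesis using cP' by metis
  qed
  have "Polynomial.coeff P i \<in> \<rat>" for i using cyc_aut_fixed[OF N P(2)] fixed by blast
  hence "\<forall>i. \<exists>c. Polynomial.coeff P i = of_rat c" by (auto elim: Rats_cases)
  then obtain c where c: "\<And>i. Polynomial.coeff P i = of_rat (c i)" by metis
  define q where "q = Abs_poly c"
  have "\<forall>\<^sub>\<infinity> i. c i = 0" using P(1) c by (auto simp: MOST_nat_le intro!: exI[of _ "card auts"])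
  hence cq: "Polynomial.coeff q = c" unfolding q_def by (rule Abs_poly_inverse[simplified])
  have Pq: "P = map_poly of_rat q" by (rule poly_eqI) (simp add: coeff_map_poly cq c)
  have "\<And>i. i \<ge> card auts \<Longrightarrow> Polynomial.coeff q i = 0" using P(1) c cq by auto
  \<comment> \<open>The exponent 1 gives the identity of \<open>K\<close>, so the value of
    \<open>P\<close> at this node is \<open>x\<close> itself.\<close>
  moreover have "res_aut 1 \<in> auts" using N by (simp add: auts_def)
  hence "poly P (res_aut 1 \<theta>) = res_aut 1 x" by (rule P(3))
  hence "x = eval_rat q \<theta>"
    using \<theta>(1) x cyc_aut_1[OF N] K_sub by (simp add: res_aut_def eval_rat_def Pq)
  ultimately show thesis using that by blast
qed

text \<open>Writing \<open>\<theta> ^ card auts\<close> as a polynomial of smaller degree in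
  \<theta> gives a nonzero rational polynomial \<open>F\<close> of degree \<open>card auts\<close>
  with root \<theta>. Any automorphism permutes its roots, which the images of \<theta> under
  \<open>auts\<close> already exhaust, and an automorphism is determined on \<open>K\<close> by the
  image of \<theta>.\<close>

theorem gal_over_rats_K: "gal_over_rats K = auts"
proof
  show "gal_over_rats K \<subseteq> auts"
  proof
    fix \<sigma> assume s: "\<sigma> \<in> gal_over_rats K"
    obtain \<theta> where \<theta>: "\<theta> \<in> K" "inj_on (\<lambda>\<sigma>. \<sigma> \<theta>) auts" by (rule primitive_element)
    have pw: "\<theta> ^ card auts \<in> K"
    proof -
      have "\<theta> ^ n \<in> K" for n by (induction n) (use \<theta>(1) in \<open>auto simp: K_closed\<close>)
      thus ?thesis .
    qed
    obtain q where q: "\<And>i. i \<ge> card auts \<Longrightarrow> Polynomial.coeff q i = 0" "\<theta> ^ card auts = eval_rat q \<theta>"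
      using rational_interpolation[OF \<theta> pw] by metis
    define F where "F = Polynomial.monom 1 (card auts) - q"
    have cF: "Polynomial.coeff F (card auts) = 1" using q(1)[of "card auts"] by (simp add: F_def)
    have "Polynomial.degree F \<le> card auts"
      using q(1) by (intro degree_le) (auto simp: F_def)
    have F0: "eval_rat F \<theta> = 0" using q(2) by (simp add: F_def)
    define F' where "F' = (map_poly of_rat F :: complex poly)"
    have F': "F' \<noteq> 0" "Polynomial.degree F' \<le> card auts"
    proof -
      have "Polynomial.coeff F' (card auts) = 1" using cF by (simp add: F'_def coeff_map_poly)
      thus "F' \<noteq> 0" by force
      show "Polynomial.degree F' \<le> card auts"
        unfolding F'_def using degree_map_poly_le \<open>Polynomial.degree F \<le> _\<close> le_trans by blast
    qed
    have root: "poly F' (\<tau> \<theta>) = 0" if "\<tau> \<in> gal_over_rats K" for \<tau>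
      using gal_eval_rat[OF that \<theta>(1), of F] gal_props(4)[OF that, of 0] F0 by (simp add: F'_def eval_rat_def)
    have "\<sigma> \<theta> \<in> (\<lambda>\<sigma>. \<sigma> \<theta>) ` auts"
    proof (rule ccontr)
      assume "\<sigma> \<theta> \<notin> (\<lambda>\<sigma>. \<sigma> \<theta>) ` auts"
      hence "Suc (card auts) = card (insert (\<sigma> \<theta>) ((\<lambda>\<sigma>. \<sigma> \<theta>) ` auts))"
        using finite_auts \<theta>(2) by (simp add: card_image)
      also have "\<dots> \<le> card {z. poly F' z = 0}"
        using root auts_sub s by (intro card_mono poly_roots_finite F') auto
      also have "\<dots> \<le> card auts" using card_poly_roots_bound[OF F'(1)] F'(2) le_trans by blast
      finally show False by simp
    qed
    then obtain \<sigma>' where s': "\<sigma>' \<in> auts" "\<sigma> \<theta> = \<sigma>' \<theta>" by auto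
    hence g': "\<sigma>' \<in> gal_over_rats K" using auts_sub by blast
    have "\<sigma> x = \<sigma>' x" for x
    proof (cases "x \<in> K")
      case True
      obtain r where "x = eval_rat r \<theta>" using rational_interpolation[OF \<theta> True] by metis
      thus ?thesis using gal_eval_rat[OF s \<theta>(1)] gal_eval_rat[OF g' \<theta>(1)] s'(2) by simp
    qed (simp add: gal_props(5)[OF s] gal_props(5)[OF g'])
    thus "\<sigma> \<in> auts" using s'(1) by (metis ext)
  qed
qed (rule auts_sub)

section \<open>The degree of \<open>K\<close> over the rationals\<close>

lemma combine_powers:
  fixes \<theta> :: complex
  shows "ring.combine class_ring (map of_rat cs) (map (\<lambda>i. \<theta> ^ i) [j..<j + length cs])
    = \<theta> ^ j * eval_rat (Poly cs) \<theta>"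
proof (induction cs arbitrary: j)
  case (Cons c cs)
  have "[j..<j + length (c # cs)] = j # [Suc j..<Suc j + length cs]"
    by (simp add: upt_conv_Cons del: upt_Suc)
  thus ?case using Cons[of "Suc j"]
    by (simp add: ring.combine.simps[OF class_ring.ring_axioms] class_ring_simps eval_rat_def hom_distribs algebra_simps
         del: upt_Suc)
qed (simp add: ring.combine.simps[OF class_ring.ring_axioms] class_ring_simps)

lemma rats_subfield: "subfield \<rat> (class_ring :: complex ring)"
  by (rule field.subfieldI'[OF class_field])
     (auto intro!: ring.subringI[OF class_ring.ring_axioms] simp: class_ring_simps class_ring_m_inv)

text \<open>The first \<open>card auts\<close> powers of \<theta> form a basis: they span by
  \<open>rational_interpolation\<close>, and a rational relation among them would be a polynomial of
  degree below \<open>card auts\<close> with the \<open>card auts\<close> distinct roots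
  \<sigma>(\<theta>).\<close>

theorem dim_K: "ring.dim class_ring \<rat> K = card auts"
proof -
  note R = class_ring.ring_axioms[where 'a = complex]
  let ?combine = "ring.combine (class_ring :: complex ring)"
  let ?d = "card auts"
  obtain \<theta> where \<theta>: "\<theta> \<in> K" "inj_on (\<lambda>\<sigma>. \<sigma> \<theta>) auts" by (rule primitive_element)
  let ?Us = "map (\<lambda>i. \<theta> ^ i) [0..<?d]"
  have comb: "?combine (map of_rat cs) ?Us = eval_rat (Poly cs) \<theta>" if "length cs = ?d" for cs
    using combine_powers[of cs \<theta> 0] that by simp
  have rat_list: "\<exists>cs. Ks = map of_rat cs" if "set Ks \<subseteq> \<rat>" for Ks :: "complex list"
    using that by (induction Ks) (auto elim!: Rats_cases intro: exI[of _ "_ # _"] simp: map_eq_Cons_conv Cons_eq_map_conv)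
  have span: "ring.Span class_ring \<rat> ?Us = K"
  proof -
    have "ring.Span class_ring \<rat> ?Us = {?combine Ks ?Us | Ks. length Ks = length ?Us \<and> set Ks \<subseteq> \<rat>}"
      by (rule ring.Span_eq_combine_set_length_version[OF R rats_subfield]) simp
    also have "\<dots> = K"
    proof safe
      fix Ks :: "complex list" assume Ks: "length Ks = length ?Us" "set Ks \<subseteq> \<rat>"
      then obtain cs where "Ks = map of_rat cs" using rat_list by blast
      thus "?combine Ks ?Us \<in> K" using comb[of cs] Ks(1) eval_rat_K[OF \<theta>(1)] by simp
    next
      fix x assume "x \<in> K"
      then obtain q where q: "\<And>i. i \<ge> ?d \<Longrightarrow> Polynomial.coeff q i = 0" "x = eval_rat q \<theta>"
        using rational_interpolation[OF \<theta>] by metis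
      let ?cs = "map (Polynomial.coeff q) [0..<?d]"
      have "Poly ?cs = q" using q(1) by (intro poly_eqI) (auto simp: coeff_Poly_eq nth_default_def)
      hence "x = ?combine (map of_rat ?cs) ?Us" using comb[of ?cs] q(2) by simp
      thus "\<exists>Ks. x = ?combine Ks ?Us \<and> length Ks = length ?Us \<and> set Ks \<subseteq> \<rat>"
        by (intro exI[of _ "map of_rat ?cs"]) auto
    qed
    finally show ?thesis .
  qed
  have ind: "ring.independent class_ring \<rat> ?Us"
  proof (rule ccontr)
    assume "\<not> ring.independent class_ring \<rat> ?Us"
    then obtain Ks where Ks: "length Ks = length ?Us" "?combine Ks ?Us = 0" "set Ks \<subseteq> \<rat>" "set Ks \<noteq> {0}"
      using ring.dependent_imp_non_trivial_combine[OF R rats_subfield, of ?Us] by auto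
    then obtain cs where cs: "Ks = map of_rat cs" using rat_list by blast
    have len: "length cs = ?d" using Ks(1) cs by simp
    have 0: "eval_rat (Poly cs) \<theta> = 0" using comb[OF len] Ks(2) cs by simp
    let ?F = "map_poly of_rat (Poly cs) :: complex poly"
    have ne: "?d > 0" using finite_auts N by (auto simp: auts_def card_gt_0_iff)
    have deg: "Polynomial.degree ?F < ?d"
    proof -
      have "Polynomial.degree (Poly cs) \<le> ?d - 1"
      proof (rule degree_le, intro allI impI)
        fix i assume "?d - 1 < i"
        hence "length cs \<le> i" using len by linarith
        thus "Polynomial.coeff (Poly cs) i = 0" by (simp add: coeff_Poly_eq nth_default_beyond)
      qed
      hence "Polynomial.degree (Poly cs) < ?d" using ne by linarith
      thus ?thesis by (rule le_less_trans[OF degree_map_poly_le])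
    qed
    have "?F = 0"
    proof (rule poly_eqI_degree)
      show "Polynomial.degree ?F < card ((\<lambda>\<sigma>. \<sigma> \<theta>) ` auts)"
        "Polynomial.degree (0 :: complex poly) < card ((\<lambda>\<sigma>. \<sigma> \<theta>) ` auts)"
        using deg ne \<theta>(2) by (simp_all add: card_image)
      fix y assume "y \<in> (\<lambda>\<sigma>. \<sigma> \<theta>) ` auts"
      then obtain \<sigma> where s: "\<sigma> \<in> gal_over_rats K" "y = \<sigma> \<theta>" using auts_sub by auto
      show "poly ?F y = poly 0 y"
        using gal_eval_rat[OF s(1) \<theta>(1), of "Poly cs"] gal_props(4)[OF s(1), of 0] 0 s(2)
        by (simp add: eval_rat_def)
    qed
    hence "Polynomial.coeff ?F i = 0" for i by simp
    hence "nth_default 0 cs i = 0" for i by (simp add: coeff_map_poly coeff_Poly_eq)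
    hence "c = 0" if "c \<in> set cs" for c using that by (metis in_set_conv_nth nth_default_nth)
    hence "set Ks \<subseteq> {0}" unfolding cs by auto
    \<comment> \<open>An empty list of coefficients would also satisfy
      \<open>set Ks \<noteq> {0}\<close>; it is excluded because \<open>auts\<close> is
      nonempty.\<close>
    moreover have "Ks \<noteq> []" using len ne cs by auto
    ultimately show False using Ks(4) by (cases Ks) auto
  qed
  have dim: "ring.dimension class_ring ?d \<rat> K" using ring.dimension_independent[OF R ind] span by simp
  hence "ring.dim class_ring \<rat> K = ?d" using ring.dimI[OF R rats_subfield dim] by (simp add: over_def)
  thus ?thesis .
qed

section \<open>Counting the exponents that restrict to a given automorphism\<close>

definition stab :: "nat set" where
  "stab = {k \<in> totatives N. \<forall>v\<in>V. cyc_aut N k v = v}"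

text \<open>The fibres are the cosets of \<open>stab\<close>. With the size written as a sum of
  indicators, \<open>sum_totatives_mult\<close> replaces \<open>k\<close> by \<open>l * k\<close>,
  and injectivity of \<open>cyc_aut N l\<close> then removes \<open>l\<close> from the
  condition.\<close>

lemma card_fibre:
  assumes l: "l \<in> totatives N"
  shows "card {k \<in> totatives N. res_aut k = res_aut l} = card stab"
proof -
  have l': "coprime l N" using l by (simp add: in_totatives_iff)
  let ?f = "\<lambda>k. of_bool (\<forall>v\<in>V. cyc_aut N k v = cyc_aut N l v) :: nat"
  have "{k \<in> totatives N. res_aut k = res_aut l} = totatives N \<inter> {k. \<forall>v\<in>V. cyc_aut N k v = cyc_aut N l v}"
    using res_aut_eq_iff l by blast
  hence "card {k \<in> totatives N. res_aut k = res_aut l} = (\<Sum>k\<in>totatives N. ?f k)" by (simp add: sum_of_bool_eq)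
  also have "\<dots> = (\<Sum>k\<in>totatives N. ?f (l * k))"
    using sum_totatives_mult[OF N l', of ?f] cyc_aut_cong[OF N] by (simp add: mult.commute)
  also have "\<dots> = (\<Sum>k\<in>totatives N. of_bool (\<forall>v\<in>V. cyc_aut N k v = v))"
  proof (rule sum.cong[OF refl])
    fix k assume "k \<in> totatives N"
    hence k: "coprime k N" by (simp add: in_totatives_iff)
    have "cyc_aut N (l * k) v = cyc_aut N l v \<longleftrightarrow> cyc_aut N k v = v" if "v \<in> V" for v
    proof -
      have v: "v \<in> cyc_field N" using that VN by auto
      have kv: "cyc_aut N k v \<in> cyc_field N" by (rule cyc_aut_closed[OF N k v])
      have "cyc_aut N l (cyc_aut N k v + - v) = cyc_aut N (l * k) v + - cyc_aut N l v"
        unfolding cyc_aut_add[OF N l' kv cyc_field_closed(3)[OF N v]] cyc_aut_comp[OF N l' k v]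
          cyc_aut_uminus[OF N l' v] ..
      hence "cyc_aut N (l * k) v = cyc_aut N l v \<longleftrightarrow> cyc_aut N l (cyc_aut N k v + - v) = 0" by simp
      also have "\<dots> \<longleftrightarrow> cyc_aut N k v = v"
        using v cyc_aut_closed[OF N k v] by (subst cyc_aut_eq_0_iff[OF N l']) (auto simp: cyc_field_diff[OF N])
      finally show ?thesis .
    qed
    thus "?f (l * k) = of_bool (\<forall>v\<in>V. cyc_aut N k v = v)" by (auto intro!: arg_cong[of _ _ of_bool])
  qed
  also have "\<dots> = card stab"
    by (simp add: sum_of_bool_eq stab_def Int_def)
  finally show ?thesis .
qed

lemma sum_totatives_res_aut:
  fixes f :: "(complex \<Rightarrow> complex) \<Rightarrow> complex"
  shows "(\<Sum>k\<in>totatives N. f (res_aut k)) = of_nat (card stab) * (\<Sum>\<sigma>\<in>auts. f \<sigma>)"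
proof -
  have "(\<Sum>k\<in>totatives N. f (res_aut k)) = (\<Sum>\<sigma>\<in>auts. \<Sum>k\<in>{k \<in> totatives N. res_aut k = \<sigma>}. f (res_aut k))"
    by (rule sum.group[symmetric]) (auto simp: auts_def)
  also have "\<dots> = (\<Sum>\<sigma>\<in>auts. of_nat (card stab) * f \<sigma>)"
    by (rule sum.cong) (auto simp: auts_def card_fibre)
  finally show ?thesis by (simp add: sum_distrib_left)
qed

theorem card_auts_stab: "card stab * card auts = totient N"
proof -
  have "of_nat (totient N) = (of_nat (card stab * card auts) :: complex)"
    using sum_totatives_res_aut[of "\<lambda>_. 1"] by (simp add: totient_def)
  thus ?thesis by (simp only: of_nat_eq_iff)
qed

theorem gal_trace:
  assumes "x \<in> K"
  shows "(\<Sum>\<sigma>\<in>gal_over_rats K. \<sigma> x)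
    = of_nat (card auts) / of_nat (totient N) * (\<Sum>k\<in>totatives N. cyc_aut N k x)"
proof -
  have "(\<Sum>k\<in>totatives N. cyc_aut N k x) = of_nat (card stab) * (\<Sum>\<sigma>\<in>auts. \<sigma> x)"
    using sum_totatives_res_aut[of "\<lambda>\<sigma>. \<sigma> x"] assms by (simp add: res_aut_def)
  moreover have "of_nat (card auts) * of_nat (card stab) = (of_nat (totient N) :: complex)"
    using card_auts_stab by (metis of_nat_mult mult.commute)
  moreover have "totient N \<noteq> 0" using N by simp
  ultimately show ?thesis unfolding gal_over_rats_K by (simp add: field_simps)
qed

end

subsection \<open>Matrix representations and Schur's lemma\<close>

definition mtrace :: "complex mat \<Rightarrow> complex" where
  "mtrace A = sum_list (diag_mat A)"

lemma mtrace_eq: "A \<in> carrier_mat n n \<Longrightarrow> mtrace A = (\<Sum>i<n. A $$ (i, i))"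
  by (simp add: mtrace_def diag_mat_def interv_sum_list_conv_sum_set_nat atLeast0LessThan)

lemma mult_mat_entry:
  assumes "A \<in> carrier_mat n n" "B \<in> carrier_mat n n" "i < n" "j < n"
  shows "(A * B) $$ (i, j) = (\<Sum>k<n. A $$ (i, k) * B $$ (k, j))"
  using assms by (simp add: scalar_prod_def atLeast0LessThan)

lemma mtrace_commute:
  assumes "A \<in> carrier_mat n n" "B \<in> carrier_mat n n"
  shows "mtrace (A * B) = mtrace (B * A)"
proof -
  have "mtrace (A * B) = (\<Sum>i<n. \<Sum>j<n. A $$ (i, j) * B $$ (j, i))"
    using assms by (simp add: mtrace_eq[of _ n] scalar_prod_def atLeast0LessThan)
  also have "\<dots> = (\<Sum>j<n. \<Sum>i<n. B $$ (j, i) * A $$ (i, j))"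
    by (subst sum.swap) (simp add: mult.commute)
  also have "\<dots> = mtrace (B * A)"
    using assms by (simp add: mtrace_eq[of _ n] scalar_prod_def atLeast0LessThan)
  finally show ?thesis .
qed

lemma mtrace_smult: "A \<in> carrier_mat n n \<Longrightarrow> mtrace (c \<cdot>\<^sub>m A) = c * mtrace A"
  by (simp add: mtrace_eq[of _ n] sum_distrib_left)

lemma upper_triangular_pow_diag:
  fixes B :: "complex mat"
  assumes B: "B \<in> carrier_mat n n" "upper_triangular B"
  shows "upper_triangular (B ^\<^sub>m k) \<and> (\<forall>i<n. (B ^\<^sub>m k) $$ (i, i) = B $$ (i, i) ^ k)"
proof (induction k)
  case 0
  show ?case using B by auto
next
  case (Suc k)
  have Bk: "B ^\<^sub>m k \<in> carrier_mat n n" using B by simp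
  have entry: "(B ^\<^sub>m Suc k) $$ (i, j) = (\<Sum>l<n. (B ^\<^sub>m k) $$ (i, l) * B $$ (l, j))" if "i < n" "j < n" for i j
    using that B Bk by (simp add: scalar_prod_def atLeast0LessThan)
  have z: "B $$ (i, j) = 0" "(B ^\<^sub>m k) $$ (i, j) = 0" if "j < i" "i < n" for i j
    using that B Bk Suc by (auto simp: upper_triangular_def)
  have "(B ^\<^sub>m Suc k) $$ (i, j) = 0" if "j < i" "i < n" for i j
  proof -
    have "(B ^\<^sub>m k) $$ (i, l) * B $$ (l, j) = 0" if "l < n" for l
      using z[of l i] z[of j l] that \<open>j < i\<close> \<open>i < n\<close> by (cases "l < i") auto
    thus ?thesis using that by (subst entry) (auto intro: sum.neutral)
  qed
  moreover have "(B ^\<^sub>m Suc k) $$ (i, i) = B $$ (i, i) ^ Suc k" if "i < n" for i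
  proof -
    have "(B ^\<^sub>m k) $$ (i, l) * B $$ (l, i) = (if l = i then B $$ (i, i) ^ Suc k else 0)" if "l < n" for l
      using z[of l i] z[of i l] that \<open>i < n\<close> Suc by (cases l i rule: linorder_cases) auto
    thus ?thesis using that by (subst entry) auto
  qed
  ultimately show ?case using B by (auto simp: upper_triangular_def)
qed

text \<open>Triangularisation suffices: the diagonal of a triangular matrix of finite order consists
  of roots of unity, and powers of the matrix have the powers on the diagonal. One family
  \<open>e\<close> serves all \<open>k\<close>, which is what makes \<zeta> \<mapsto> \<zeta> ^ k
  act on traces by taking powers of the matrix.\<close>

lemma finite_order_matrix_trace_powers:
  fixes A :: "complex mat"
  assumes A: "A \<in> carrier_mat n n" "A ^\<^sub>m N = 1\<^sub>m n" and N: "N > 0"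
  obtains e where "\<And>k. mtrace (A ^\<^sub>m k) = (\<Sum>i<n. zeta N ^ (e i * k))"
proof -
  obtain as where "char_poly A = (\<Prod>a\<leftarrow>as. [:- a, 1:])" using char_poly_factorized[OF A(1)] by auto
  then obtain B where B: "B \<in> carrier_mat n n" "upper_triangular B" "similar_mat A B"
    using schur_decomposition_exists[OF A(1)] by blast
  then obtain P Q where wit: "similar_mat_wit A B P Q" unfolding similar_mat_def by blast
  note PQ = similar_mat_witD2[OF A(1) wit] and pow = similar_mat_wit_pow_id[OF wit]
  have tr: "mtrace (A ^\<^sub>m k) = (\<Sum>i<n. (B $$ (i, i)) ^ k)" for k
  proof -
    have Bk: "B ^\<^sub>m k \<in> carrier_mat n n" using B by simp
    have "mtrace (A ^\<^sub>m k) = mtrace (Q * (P * B ^\<^sub>m k))"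
      unfolding pow[of k] using PQ Bk by (intro mtrace_commute[of _ n]) auto
    also have "Q * (P * B ^\<^sub>m k) = (Q * P) * B ^\<^sub>m k" by (rule assoc_mult_mat[OF PQ(7) PQ(6) Bk, symmetric])
    also have "\<dots> = B ^\<^sub>m k" using PQ Bk by simp
    finally show ?thesis using upper_triangular_pow_diag[OF B(1,2), of k] Bk by (simp add: mtrace_eq)
  qed
  have "B ^\<^sub>m N = 1\<^sub>m n"
  proof -
    have "B ^\<^sub>m N = Q * A ^\<^sub>m N * P" by (rule similar_mat_wit_pow_id[OF similar_mat_wit_sym[OF wit]])
    thus ?thesis using PQ A(2) by simp
  qed
  hence "B $$ (i, i) ^ N = 1" if "i < n" for i
    using upper_triangular_pow_diag[OF B(1,2), of N] that by auto
  hence "\<forall>i. \<exists>e. i < n \<longrightarrow> B $$ (i, i) = zeta N ^ e" using root_of_unity_eq_zeta_power[OF _ N] by metis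
  then obtain e where "\<And>i. i < n \<Longrightarrow> B $$ (i, i) = zeta N ^ e i" by metis
  hence "mtrace (A ^\<^sub>m k) = (\<Sum>i<n. zeta N ^ (e i * k))" for k unfolding tr by (simp add: power_mult)
  thus thesis using that by blast
qed

text \<open>The size \<open>n\<close> is an argument because the matrix type does not show it: even
  an empty sum has to be an \<open>n\<close> by \<open>n\<close> matrix.\<close>

definition msum :: "nat \<Rightarrow> 'a set \<Rightarrow> ('a \<Rightarrow> complex mat) \<Rightarrow> complex mat" where
  "msum n S F = mat n n (\<lambda>(i, j). \<Sum>h\<in>S. F h $$ (i, j))"

lemma msum_carrier [simp]: "msum n S F \<in> carrier_mat n n" by (simp add: msum_def)

lemma msum_cong: "(\<And>h. h \<in> S \<Longrightarrow> F h = F' h) \<Longrightarrow> msum n S F = msum n S F'"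
  by (simp add: msum_def)

lemma mult_msum:
  assumes "A \<in> carrier_mat n n" "\<And>h. h \<in> S \<Longrightarrow> F h \<in> carrier_mat n n"
  shows "A * msum n S F = msum n S (\<lambda>h. A * F h)" "msum n S F * A = msum n S (\<lambda>h. F h * A)"
proof -
  have 1: "(A * F h) $$ (i, j) = (\<Sum>k<n. A $$ (i, k) * F h $$ (k, j))"
   and 2: "(F h * A) $$ (i, j) = (\<Sum>k<n. F h $$ (i, k) * A $$ (k, j))"
    if "h \<in> S" "i < n" "j < n" for h i j
    using assms(1) assms(2)[OF that(1)] that by (simp_all add: scalar_prod_def atLeast0LessThan)
  show "A * msum n S F = msum n S (\<lambda>h. A * F h)"
    using assms(1) by (intro eq_matI)
     (auto simp: msum_def scalar_prod_def atLeast0LessThan 1 sum_distrib_left intro: sum.swap)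
  show "msum n S F * A = msum n S (\<lambda>h. F h * A)"
    using assms(1) by (intro eq_matI)
     (auto simp: msum_def scalar_prod_def atLeast0LessThan 2 sum_distrib_right intro: sum.swap)
qed

lemma mtrace_msum:
  assumes "\<And>h. h \<in> S \<Longrightarrow> F h \<in> carrier_mat n n"
  shows "mtrace (msum n S F) = (\<Sum>h\<in>S. mtrace (F h))"
proof -
  have "mtrace (msum n S F) = (\<Sum>i<n. \<Sum>h\<in>S. F h $$ (i, i))"
    by (simp add: mtrace_eq[of _ n]) (simp add: msum_def)
  also have "\<dots> = (\<Sum>h\<in>S. \<Sum>i<n. F h $$ (i, i))" by (rule sum.swap)
  also have "\<dots> = (\<Sum>h\<in>S. mtrace (F h))" by (intro sum.cong refl) (rule mtrace_eq[OF assms, symmetric])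
  finally show ?thesis .
qed

lemma msum_reindex:
  assumes "bij_betw f S T"
  shows "msum n S (\<lambda>h. F (f h)) = msum n T F"
proof -
  have "(\<Sum>h\<in>S. F (f h) $$ ij) = (\<Sum>h\<in>T. F h $$ ij)" for ij
    by (rule sum.reindex_bij_betw[OF assms])
  thus ?thesis by (simp add: msum_def)
qed

lemma (in group) mult_inv_cancel:
  assumes "g \<in> carrier G" "a \<in> carrier G"
  shows "g \<otimes> (inv g \<otimes> a) = a" "inv g \<otimes> (g \<otimes> a) = a"
  using assms by (simp_all flip: m_assoc)

section \<open>Irreducible matrix representations of a finite group\<close>

locale matrix_irrep = group G for G (structure) +
  fixes n :: nat and R :: "'a \<Rightarrow> complex mat"
  assumes fin: "finite (carrier G)" and irr: "irreducible_rep G n R"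
begin

lemma n_pos: "n > 0" using irr by (simp add: irreducible_rep_def)

lemma R_hom: "R \<in> hom G (GL n)" using irr by (simp add: irreducible_rep_def)

lemma group_GL: "Group.group (GL n)"
proof -
  interpret ring "ring_mat TYPE(complex) n ()" by (rule ring_mat)
  show ?thesis unfolding GL_def by (rule units_group)
qed

lemma R_carrier [simp]: "g \<in> carrier G \<Longrightarrow> R g \<in> carrier_mat n n"
  using R_hom by (auto simp: hom_def GL_def units_of_carrier Units_def ring_mat_simps)

lemma R_mult: "g \<in> carrier G \<Longrightarrow> h \<in> carrier G \<Longrightarrow> R (g \<otimes> h) = R g * R h"
  using R_hom by (auto simp: hom_def GL_def units_of_mult ring_mat_simps)

lemma R_one: "R \<one> = 1\<^sub>m n"
proof -
  have "R \<one> = \<one>\<^bsub>GL n\<^esub>" by (rule hom_one[OF R_hom is_group group_GL])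
  thus ?thesis by (simp add: GL_def units_of_one ring_mat_simps)
qed

lemma R_pow: "g \<in> carrier G \<Longrightarrow> R (g [^] k) = R g ^\<^sub>m k"
  by (induction k) (auto simp: R_one R_mult carrier_matD[OF R_carrier])

text \<open>An eigenspace \<open>W\<close> of \<open>M\<close> is stable under every
  \<open>R g\<close>, as these commute with \<open>M\<close>; being nonzero, it is the whole space
  by irreducibility.\<close>

lemma schur_scalar:
  assumes M: "M \<in> carrier_mat n n" and comm: "\<And>g. g \<in> carrier G \<Longrightarrow> R g * M = M * R g"
  obtains c where "M = c \<cdot>\<^sub>m 1\<^sub>m n"
proof -
  obtain c where "c \<in> spectrum M" using spectrum_non_empty[OF M n_pos] by auto
  then obtain v where v: "eigenvector M v c" by (auto simp: spectrum_def eigenvalue_def)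
  define W where "W = {v \<in> carrier_vec n. M *\<^sub>v v = c \<cdot>\<^sub>v v}"
  have sub: "subspace class_ring W (module_vec TYPE(complex) n)"
  proof -
    have "submodule class_ring W (module_vec TYPE(complex) n)"
      using M by (intro submodule.intro vec_module)
        (auto simp: W_def module_vec_simps mult_add_distrib_mat_vec mult_mat_vec smult_add_distrib_vec
          smult_smult_assoc mult.commute)
    thus ?thesis by (intro subspace.intro vec_vs)
  qed
  have inv: "R g *\<^sub>v w \<in> W" if "g \<in> carrier G" "w \<in> W" for g w
  proof -
    have w: "w \<in> carrier_vec n" "M *\<^sub>v w = c \<cdot>\<^sub>v w" using that(2) by (auto simp: W_def)
    have "M *\<^sub>v (R g *\<^sub>v w) = (M * R g) *\<^sub>v w"
      by (rule assoc_mult_mat_vec[OF M R_carrier[OF that(1)] w(1), symmetric])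
    also have "\<dots> = R g *\<^sub>v (M *\<^sub>v w)"
      unfolding comm[OF that(1), symmetric] using M that(1) w by (simp add: assoc_mult_mat_vec[of _ n n _ n])
    also have "\<dots> = c \<cdot>\<^sub>v (R g *\<^sub>v w)" unfolding w(2) using w(1) that(1) by (simp add: mult_mat_vec[of _ n n])
    finally show ?thesis using that(1) w(1) by (auto simp: W_def intro: mult_mat_vec_carrier[of _ n n])
  qed
  have "W = {0\<^sub>v n} \<or> W = carrier_vec n"
    using irr sub inv unfolding irreducible_rep_def by blast
  moreover have "v \<in> W" "v \<noteq> 0\<^sub>v n" using v M by (auto simp: eigenvector_def W_def)
  ultimately have W: "W = carrier_vec n" by auto
  have "M = c \<cdot>\<^sub>m 1\<^sub>m n"
  proof (rule eq_matI)
    fix i j assume ij: "i < dim_row (c \<cdot>\<^sub>m 1\<^sub>m n)" "j < dim_col (c \<cdot>\<^sub>m 1\<^sub>m n)"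
    have "unit_vec n j \<in> W" using W by simp
    hence "M *\<^sub>v unit_vec n j = c \<cdot>\<^sub>v unit_vec n j" by (simp add: W_def)
    hence "(M *\<^sub>v unit_vec n j) $ i = c * unit_vec n j $ i" using ij by simp
    moreover have "(M *\<^sub>v unit_vec n j) $ i = M $$ (i, j)"
      using ij M by (simp add: scalar_prod_right_unit[of _ n])
    ultimately show "M $$ (i, j) = (c \<cdot>\<^sub>m 1\<^sub>m n) $$ (i, j)" using ij by (auto simp: unit_vec_def)
  qed (use M in auto)
  thus thesis using that by blast
qed

definition \<chi> :: "'a \<Rightarrow> complex" where "\<chi> g = mtrace (R g)"

lemma chi_one: "\<chi> \<one> = of_nat n"
  by (simp add: \<chi>_def R_one mtrace_eq[of _ n])

lemma chi_commute:
  assumes "g \<in> carrier G" "h \<in> carrier G"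
  shows "\<chi> (g \<otimes> h) = \<chi> (h \<otimes> g)"
  unfolding \<chi>_def using assms by (simp add: R_mult mtrace_commute[of _ n])

lemma chi_powers:
  assumes "g \<in> carrier G" "card (carrier G) dvd N" "N > 0"
  obtains e where "\<And>k. \<chi> (g [^] (k :: nat)) = (\<Sum>i<n. zeta N ^ (e i * k))"
proof -
  have "g [^] N = \<one>"
  proof -
    obtain m where "N = card (carrier G) * m" using assms(2) by blast
    hence "g [^] N = (g [^] card (carrier G)) [^] m" using assms(1) by (simp add: nat_pow_pow)
    thus ?thesis using pow_order_eq_1[OF assms(1)] by (simp add: Coset.order_def)
  qed
  hence pw: "R g ^\<^sub>m N = 1\<^sub>m n" using R_pow[OF assms(1), of N] R_one by simp
  obtain e where "\<And>k. mtrace (R g ^\<^sub>m k) = (\<Sum>i<n. zeta N ^ (e i * k))"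
    by (rule finite_order_matrix_trace_powers[OF R_carrier[OF assms(1)] pw assms(3)]) blast
  thus thesis using that[of e] by (simp add: \<chi>_def R_pow[OF assms(1)])
qed

text \<open>The matrix \<open>M\<close>, the sum of the
  \<open>f h \<cdot>\<^sub>m R (inv h)\<close>, commutes with every \<open>R g\<close> because
  \<open>f\<close> is a class function. So it is a scalar, and the trace of \<open>M * R g\<close>
  is the convolution. It is used with \<open>f\<close> a Galois twist of \<chi>.\<close>

lemma convolution_scalar:
  fixes f :: "'a \<Rightarrow> complex"
  assumes f: "\<And>g h. g \<in> carrier G \<Longrightarrow> h \<in> carrier G \<Longrightarrow> f (inv g \<otimes> h \<otimes> g) = f h"
  obtains c where "\<And>g. g \<in> carrier G \<Longrightarrow> (\<Sum>h\<in>carrier G. f h * \<chi> (inv h \<otimes> g)) = c * \<chi> g"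
proof -
  define M where "M = msum n (carrier G) (\<lambda>h. f h \<cdot>\<^sub>m R (inv h))"
  have M: "M \<in> carrier_mat n n" by (simp add: M_def)
  have MR: "M * R g = msum n (carrier G) (\<lambda>h. f h \<cdot>\<^sub>m R (inv h \<otimes> g))" if g: "g \<in> carrier G" for g
    unfolding M_def using g
    by (subst mult_msum) (auto intro!: msum_cong simp: R_mult smult_carrier_mat mult_smult_assoc_mat[of _ n n _ n])
  have comm: "R g * M = M * R g" if g: "g \<in> carrier G" for g
  proof -
    have bij: "bij_betw (\<lambda>h. inv g \<otimes> h \<otimes> g) (carrier G) (carrier G)"
      by (rule bij_betw_byWitness[of _ "\<lambda>h. g \<otimes> h \<otimes> inv g"]) (use g in \<open>auto simp: m_assoc mult_inv_cancel\<close>)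
    have "R g * M = msum n (carrier G) (\<lambda>h. f h \<cdot>\<^sub>m R (g \<otimes> inv h))"
      unfolding M_def using g
      by (subst mult_msum) (auto intro!: msum_cong simp: R_mult smult_carrier_mat mult_smult_distrib[of _ n n _ n])
    also have "\<dots> = msum n (carrier G) (\<lambda>h. f (inv g \<otimes> h \<otimes> g) \<cdot>\<^sub>m R (g \<otimes> inv (inv g \<otimes> h \<otimes> g)))"
      by (rule msum_reindex[OF bij, symmetric])
    also have "\<dots> = M * R g"
      unfolding MR[OF g] using g
      by (intro msum_cong) (simp add: f inv_mult_group, simp add: m_assoc mult_inv_cancel)
    finally show ?thesis .
  qed
  obtain c where c: "M = c \<cdot>\<^sub>m 1\<^sub>m n" using schur_scalar[OF M comm] by blast
  have "(\<Sum>h\<in>carrier G. f h * \<chi> (inv h \<otimes> g)) = c * \<chi> g" if g: "g \<in> carrier G" for g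
  proof -
    have "(\<Sum>h\<in>carrier G. f h * \<chi> (inv h \<otimes> g)) = mtrace (M * R g)"
      unfolding MR[OF g] using g
      by (subst mtrace_msum) (auto simp: \<chi>_def mtrace_smult[of _ n] smult_carrier_mat)
    also have "M * R g = c \<cdot>\<^sub>m R g" unfolding c using g
      by (simp add: mult_smult_assoc_mat[of _ n n _ n] left_mult_one_mat[of _ n n])
    also have "mtrace \<dots> = c * \<chi> g" using g by (simp add: \<chi>_def mtrace_smult[of _ n])
    finally show ?thesis .
  qed
  thus thesis using that by blast
qed

text \<open>Averaging the matrix unit \<open>E\<close> at (j, k) over the group gives a scalar
  matrix, and the trace reveals the scalar. Its (j, k) entry is the sum of the products of the j-th
  diagonal entry of \<open>R h\<close> with the k-th of \<open>R (inv h)\<close>; summing over j and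
  k gives the norm.\<close>

lemma chi_norm: "(\<Sum>h\<in>carrier G. \<chi> h * \<chi> (inv h)) = of_nat (card (carrier G))"
proof -
  let ?o = "of_nat (card (carrier G)) :: complex"
  have entry: "(\<Sum>h\<in>carrier G. R h $$ (j, j) * R (inv h) $$ (k, k)) = (if j = k then ?o / of_nat n else 0)"
    if jk: "j < n" "k < n" for j k
  proof -
    define E where "E = mat n n (\<lambda>(a, b). if a = j \<and> b = k then 1 else 0 :: complex)"
    have E: "E \<in> carrier_mat n n" by (simp add: E_def)
    define M where "M = msum n (carrier G) (\<lambda>h. R h * E * R (inv h))"
    have M: "M \<in> carrier_mat n n" by (simp add: M_def)
    have car: "h \<in> carrier G \<Longrightarrow> R h * E * R (inv h) \<in> carrier_mat n n" for h
      using E by (auto intro!: mult_carrier_mat[of _ n n])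
    have comm: "R g * M = M * R g" if g: "g \<in> carrier G" for g
    proof -
      have bij: "bij_betw (\<lambda>h. g \<otimes> h) (carrier G) (carrier G)"
        by (rule bij_betw_byWitness[of _ "\<lambda>h. inv g \<otimes> h"]) (use g in \<open>auto simp: mult_inv_cancel\<close>)
      have "M * R g = msum n (carrier G) (\<lambda>h. R h * E * R (inv h \<otimes> g))"
        unfolding M_def using g E car
        by (subst mult_msum) (auto intro!: msum_cong simp: R_mult mult_carrier_mat[of _ n n _ n] assoc_mult_mat[of _ n n _ n _ n])
      also have "\<dots> = msum n (carrier G) (\<lambda>h. R (g \<otimes> h) * E * R (inv (g \<otimes> h) \<otimes> g))"
        by (rule msum_reindex[OF bij, symmetric])
      also have "\<dots> = msum n (carrier G) (\<lambda>h. R g * (R h * E * R (inv h)))"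
        using g E by (intro msum_cong) (simp add: inv_mult_group m_assoc R_mult mult_carrier_mat[of _ n n _ n] assoc_mult_mat[of _ n n _ n _ n])
      also have "\<dots> = R g * M" unfolding M_def using g car by (subst mult_msum) auto
      finally show ?thesis by simp
    qed
    obtain c where c: "M = c \<cdot>\<^sub>m 1\<^sub>m n" using schur_scalar[OF M comm] by blast
    have "mtrace (R h * E * R (inv h)) = mtrace E" if h: "h \<in> carrier G" for h
    proof -
      have "mtrace (R h * E * R (inv h)) = mtrace (R (inv h) * (R h * E))"
        using h E by (intro mtrace_commute[of _ n]) (auto intro: mult_carrier_mat[of _ n n])
      also have "R (inv h) * (R h * E) = (R (inv h) * R h) * E"
        using h E by (intro assoc_mult_mat[of _ n n _ n _ n, symmetric]) auto
      also have "R (inv h) * R h = R (inv h \<otimes> h)" using h by (intro R_mult[symmetric]) auto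
      also have "R (inv h \<otimes> h) * E = E" using h E by (simp add: R_one)
      finally show ?thesis .
    qed
    hence "mtrace M = ?o * mtrace E" unfolding M_def using car by (subst mtrace_msum) auto
    moreover have "mtrace M = c * of_nat n" unfolding c by (simp add: mtrace_smult[of _ n] mtrace_eq[of _ n])
    moreover have "mtrace E = (if j = k then 1 else 0)"
      using jk by (simp add: mtrace_eq[OF E]) (auto simp: E_def intro: sum.neutral)
    ultimately have cn: "c * of_nat n = (if j = k then ?o else 0)" by simp
    have "(\<Sum>h\<in>carrier G. R h $$ (j, j) * R (inv h) $$ (k, k)) = M $$ (j, k)"
    proof -
      have "(R h * E * R (inv h)) $$ (j, k) = R h $$ (j, j) * R (inv h) $$ (k, k)" if h: "h \<in> carrier G" for h
      proof -
        have "(R h * E) $$ (j, b) = (if b = k then R h $$ (j, j) else 0)" if "b < n" for b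
        proof -
          have "(R h * E) $$ (j, b) = (\<Sum>a<n. R h $$ (j, a) * (if a = j \<and> b = k then 1 else 0))"
            unfolding mult_mat_entry[OF R_carrier[OF h] E jk(1) that]
            using jk that by (intro sum.cong refl) (simp add: E_def)
          also have "\<dots> = (\<Sum>a<n. if a = j then (if b = k then R h $$ (j, j) else 0) else 0)"
            by (intro sum.cong) auto
          finally show ?thesis using jk by simp
        qed
        hence "(R h * E * R (inv h)) $$ (j, k) = (\<Sum>b<n. (if b = k then R h $$ (j, j) else 0) * R (inv h) $$ (b, k))"
          using h E jk by (subst mult_mat_entry[of _ n]) (auto intro: mult_carrier_mat[of _ n n])
        also have "\<dots> = (\<Sum>b<n. if b = k then R h $$ (j, j) * R (inv h) $$ (k, k) else 0)" by (intro sum.cong) auto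
        finally show ?thesis using jk by simp
      qed
      thus ?thesis unfolding M_def using jk by (simp add: msum_def)
    qed
    also have "\<dots> = (if j = k then c else 0)" unfolding c using jk by simp
    finally show ?thesis using cn n_pos by (auto simp: field_simps)
  qed
  have "(\<Sum>h\<in>carrier G. \<chi> h * \<chi> (inv h)) = (\<Sum>h\<in>carrier G. \<Sum>j<n. \<Sum>k<n. R h $$ (j, j) * R (inv h) $$ (k, k))"
    by (simp add: \<chi>_def mtrace_eq[OF R_carrier] sum_product)
  also have "\<dots> = (\<Sum>j<n. \<Sum>h\<in>carrier G. \<Sum>k<n. R h $$ (j, j) * R (inv h) $$ (k, k))" by (rule sum.swap)
  also have "\<dots> = (\<Sum>j<n. \<Sum>k<n. \<Sum>h\<in>carrier G. R h $$ (j, j) * R (inv h) $$ (k, k))"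
    by (intro sum.cong refl sum.swap)
  also have "\<dots> = (\<Sum>j<n. ?o / of_nat n)" by (intro sum.cong refl) (simp add: entry)
  also have "\<dots> = ?o" using n_pos by simp
  finally show ?thesis .
qed

end

lemma irreducible_charE:
  assumes "Group.group G" "finite (carrier G)" "irreducible_char G \<chi>"
  obtains n R where "matrix_irrep G n R" "\<And>g. g \<in> carrier G \<Longrightarrow> \<chi> g = matrix_irrep.\<chi> R g"
proof -
  obtain n R where nR: "irreducible_rep G n R" "\<forall>g\<in>carrier G. \<chi> g = sum_list (diag_mat (R g))"
    using assms(3) unfolding irreducible_char_def by blast
  interpret Group.group G by (rule assms(1))
  interpret matrix_irrep G n R by unfold_locales (use assms nR in auto)
  show thesis using that[of n R] matrix_irrep_axioms nR(2) by (simp add: \<chi>_def mtrace_def)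
qed

subsection \<open>Galois traces as averages over powers\<close>

context group
begin

lemma conj_pow:
  assumes "g \<in> carrier G" "h \<in> carrier G"
  shows "(inv g \<otimes> h \<otimes> g) [^] (k :: nat) = inv g \<otimes> h [^] k \<otimes> g"
proof (induction k)
  case (Suc k)
  have "(inv g \<otimes> h \<otimes> g) [^] Suc k = inv g \<otimes> h [^] k \<otimes> (g \<otimes> inv g) \<otimes> h \<otimes> g"
    using assms by (simp only: nat_pow_Suc Suc) (simp add: m_assoc mult_inv_cancel)
  thus ?case using assms by (simp add: m_assoc mult_inv_cancel)
qed (use assms in simp)

lemma pow_cong_ord:
  assumes "g \<in> carrier G" "[k = l] (mod ord g)"
  shows "g [^] k = g [^] (l :: nat)"
proof -
  have "g [^] m = g [^] (m mod ord g)" for m :: nat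
  proof -
    have "g [^] m = g [^] (ord g * (m div ord g) + m mod ord g)" by simp
    also have "\<dots> = (g [^] ord g) [^] (m div ord g) \<otimes> g [^] (m mod ord g)"
      using assms(1) by (simp only: nat_pow_mult[symmetric] nat_pow_pow[symmetric])
    finally show ?thesis using assms(1) by simp
  qed
  thus ?thesis using assms(2) by (metis cong_def)
qed

lemma pow_cong:
  assumes "card (carrier G) dvd N" "g \<in> carrier G" "[k = l] (mod N)"
  shows "g [^] k = g [^] (l :: nat)"
proof -
  have "ord g dvd N" using ord_dvd_group_order[OF assms(2)] assms(1) by (auto simp: Coset.order_def intro: dvd_trans)
  thus ?thesis using assms(2,3) by (intro pow_cong_ord) (auto intro: cong_dvd_modulus_nat)
qed

lemma pow_inverse:
  assumes "finite (carrier G)" "card (carrier G) dvd N" "N > 0" "coprime k N"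
  obtains l where "coprime l N" "[k * l = 1] (mod N)"
    "\<forall>g\<in>carrier G. (g [^] k) [^] l = g" "\<forall>g\<in>carrier G. (g [^] l) [^] k = g"
proof -
  obtain l where l: "[k * l = 1] (mod N)" using cong_solve_coprime_nat[OF assms(4)] by (metis One_nat_def)
  hence "coprime l N" by (metis cong_imp_coprime cong_sym coprime_1_left coprime_mult_left_iff)
  moreover have "(g [^] k) [^] l = g" "(g [^] l) [^] k = g" if "g \<in> carrier G" for g
    using pow_cong[OF assms(2) that l] that by (simp_all add: nat_pow_pow mult.commute)
  ultimately show thesis by (intro that[OF _ l]) auto
qed

lemma bij_betw_pow:
  assumes "finite (carrier G)" "card (carrier G) dvd N" "N > 0" "coprime k N"
  shows "bij_betw (\<lambda>g. g [^] k) (carrier G) (carrier G)"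
proof -
  obtain l where "coprime l N" "[k * l = 1] (mod N)"
    "\<forall>g\<in>carrier G. (g [^] k) [^] l = g" "\<forall>g\<in>carrier G. (g [^] l) [^] k = g"
    using pow_inverse[OF assms] .
  thus ?thesis by (intro bij_betw_byWitness[of _ "\<lambda>g. g [^] l"]) auto
qed

lemma inv_eq_pow:
  assumes "finite (carrier G)" "card (carrier G) dvd N" "N > 0" "g \<in> carrier G"
  shows "inv g = g [^] (N - 1)"
proof -
  have "g [^] (N - 1) \<otimes> g = g [^] N" using assms by (metis nat_pow_Suc Suc_diff_1)
  also have "\<dots> = \<one>" using pow_cong[OF assms(2,4), of N 0] by (simp add: cong_def)
  finally show ?thesis using assms by (intro inv_equality) auto
qed

end

lemma Rats_cnj: "x \<in> \<rat> \<Longrightarrow> cnj x = x"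
  by (elim Rats_cases') simp

text \<open>What irreducible characters share with the characters induced from them, and all that
  the computation of traces uses. It thus covers \<tau>1, which may be reducible.\<close>

definition galois_char :: "nat \<Rightarrow> ('a, 'b) monoid_scheme \<Rightarrow> ('a \<Rightarrow> complex) \<Rightarrow> bool" where
  "galois_char N G \<chi> \<longleftrightarrow> (\<forall>g\<in>carrier G. \<chi> g \<in> cyc_field N \<and>
     (\<forall>k. coprime k N \<longrightarrow> cyc_aut N k (\<chi> g) = \<chi> (g [^]\<^bsub>G\<^esub> k)))"

definition char_avg :: "nat \<Rightarrow> ('a, 'b) monoid_scheme \<Rightarrow> ('a \<Rightarrow> complex) \<Rightarrow> 'a \<Rightarrow> complex" where
  "char_avg N G \<chi> g = (\<Sum>k\<in>totatives N. \<chi> (g [^]\<^bsub>G\<^esub> k)) / of_nat (totient N)"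

lemma galois_charD:
  assumes "galois_char N G \<chi>" "g \<in> carrier G"
  shows "\<chi> g \<in> cyc_field N" "coprime k N \<Longrightarrow> cyc_aut N k (\<chi> g) = \<chi> (g [^]\<^bsub>G\<^esub> k)"
  using assms by (auto simp: galois_char_def)

lemma char_avg_eq_trace:
  assumes "galois_char N G \<chi>" "g \<in> carrier G"
  shows "char_avg N G \<chi> g = (\<Sum>k\<in>totatives N. cyc_aut N k (\<chi> g)) / of_nat (totient N)"
  unfolding char_avg_def using galois_charD(2)[OF assms] by (simp add: in_totatives_iff)

lemma char_avg_rational:
  assumes "N > 0" "galois_char N G \<chi>" "g \<in> carrier G"
  shows "char_avg N G \<chi> g \<in> \<rat>"
  unfolding char_avg_eq_trace[OF assms(2,3)]
  using cyc_aut_trace_rational[OF assms(1) galois_charD(1)[OF assms(2,3)]] by (intro Rats_divide) auto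

context group
begin

lemma char_avg_pow:
  assumes "finite (carrier G)" "card (carrier G) dvd N" "N > 0" "coprime l N" "g \<in> carrier G"
  shows "char_avg N G \<chi> (g [^] l) = char_avg N G \<chi> g"
proof -
  have "(\<Sum>k\<in>totatives N. \<chi> (g [^] (k * l))) = (\<Sum>k\<in>totatives N. \<chi> (g [^] k))"
    using pow_cong[OF assms(2,5)] by (intro sum_totatives_mult[OF assms(3,4)]) metis
  thus ?thesis using assms(5) by (simp add: char_avg_def nat_pow_pow mult.commute)
qed

text \<open>Inversion is the power with exponent \<open>N - 1\<close>, a unit modulo
  \<open>N\<close>. It brings the inner product of averages into the form, with arguments
  \<open>g\<close> and \<open>inv g\<close>, that Schur's lemma computes.\<close>

lemma char_avg_inv:
  assumes "finite (carrier G)" "card (carrier G) dvd N" "N > 0" "g \<in> carrier G"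
  shows "char_avg N G \<chi> (inv g) = char_avg N G \<chi> g"
proof -
  have "coprime (N - 1) N" using assms(3) by (metis coprime_diff_one_left_nat)
  thus ?thesis using char_avg_pow[OF assms(1-3) _ assms(4)] inv_eq_pow[OF assms] by simp
qed

text \<open>The theory of \<open>galois_stable_set\<close> for the set of values of \<chi>. As
  conjugation is passage to powers of the argument, the stabiliser consists of the exponents that
  leave \<chi> unchanged, and its index is the degree.\<close>

lemma galois_char_trace:
  assumes "finite (carrier G)" "N > 0" "galois_char N G \<chi>"
  shows "g \<in> carrier G \<Longrightarrow> char_tr G \<chi> g = of_nat (char_field_degree G \<chi>) * char_avg N G \<chi> g"
    and "card {k \<in> totatives N. \<forall>g\<in>carrier G. \<chi> (g [^] k) = \<chi> g} * char_field_degree G \<chi> = totient N"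
proof -
  interpret V: galois_stable_set N "\<chi> ` carrier G"
    by unfold_locales (use assms in \<open>auto simp: galois_charD in_totatives_iff\<close>)
  have K: "char_field G \<chi> = V.K" by (simp add: char_field_def V.K_def)
  have d: "char_field_degree G \<chi> = card V.auts" by (simp add: char_field_degree_def K V.dim_K)
  show "char_tr G \<chi> g = of_nat (char_field_degree G \<chi>) * char_avg N G \<chi> g" if g: "g \<in> carrier G"
  proof -
    have "\<chi> g \<in> V.K" using V.K_closed(1) g by auto
    from V.gal_trace[OF this] show ?thesis
      unfolding char_tr_def K d char_avg_eq_trace[OF assms(3) g] by simp
  qed
  have "V.stab = {k \<in> totatives N. \<forall>g\<in>carrier G. \<chi> (g [^] k) = \<chi> g}"
    unfolding V.stab_def using galois_charD(2)[OF assms(3)] by (auto simp: in_totatives_iff)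
  thus "card {k \<in> totatives N. \<forall>g\<in>carrier G. \<chi> (g [^] k) = \<chi> g} * char_field_degree G \<chi> = totient N"
    using V.card_auts_stab d by simp
qed

lemma char_tr_star_eq_avg:
  assumes "finite (carrier G)" "N > 0" "galois_char N G \<chi>" "g \<in> carrier G"
  shows "char_tr_star G \<chi> g = char_avg N G \<chi> g"
proof -
  have "char_field_degree G \<chi> \<noteq> 0"
    using galois_char_trace(2)[OF assms(1-3)] assms(2) by (metis mult_0_right totient_0_iff less_irrefl)
  thus ?thesis by (simp add: char_tr_star_def galois_char_trace(1)[OF assms(1-3)] assms(4))
qed

text \<open>For a unit \<open>k\<close>, the conjugators that bring \<open>g\<close> into
  \<open>H\<close> are those that bring \<open>g [^] k\<close> into \<open>H\<close>, since each of
  these elements is a power of the other. So the Galois action and the average can be taken term by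
  term in the induction sum.\<close>

lemma galois_char_ind:
  assumes "finite (carrier G)" "card (carrier G) dvd N" "N > 0" "subgroup H G"
    and \<chi>: "galois_char N (G\<lparr>carrier := H\<rparr>) \<chi>"
  shows "galois_char N G (ind_char G H \<chi>)"
    and "g \<in> carrier G \<Longrightarrow> char_avg N G (ind_char G H \<chi>) g
           = ind_char G H (char_avg N (G\<lparr>carrier := H\<rparr>) \<chi>) g"
proof -
  let ?S = "\<lambda>g. {x \<in> carrier G. inv x \<otimes> g \<otimes> x \<in> H}"
  have pw: "x [^]\<^bsub>G\<lparr>carrier := H\<rparr>\<^esub> k = x [^] (k :: nat)" for x k by (rule nat_pow_consistent[symmetric])
  have HG: "H \<subseteq> carrier G" using subgroup.subset[OF assms(4)] .
  have Hpow: "x [^] (k :: nat) \<in> H" if "x \<in> H" for x k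
    using that by (induction k) (auto intro: subgroup.m_closed[OF assms(4)] subgroup.one_closed[OF assms(4)])
  have S_pow: "?S (g [^] k) = ?S g" if g: "g \<in> carrier G" and k: "coprime k N" for g k
  proof -
    obtain l where l: "coprime l N" "[k * l = 1] (mod N)"
      "\<forall>g\<in>carrier G. (g [^] k) [^] l = g" "\<forall>g\<in>carrier G. (g [^] l) [^] k = g"
      using pow_inverse[OF assms(1-3) k] .
    have "inv x \<otimes> g [^] k \<otimes> x \<in> H \<longleftrightarrow> inv x \<otimes> g \<otimes> x \<in> H" if x: "x \<in> carrier G" for x
    proof -
      have e: "inv x \<otimes> g [^] k \<otimes> x = (inv x \<otimes> g \<otimes> x) [^] k" using conj_pow[OF x g] by simp
      show ?thesis unfolding e using Hpow l(3) x g
        by (metis inv_closed m_closed)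
    qed
    thus ?thesis by blast
  qed
  have ind_pow: "ind_char G H \<chi> (g [^] k) = (\<Sum>x\<in>?S g. \<chi> ((inv x \<otimes> g \<otimes> x) [^] k)) / of_nat (card H)"
    if g: "g \<in> carrier G" and k: "coprime k N" for g k
    unfolding ind_char_def S_pow[OF g k] using conj_pow g by simp
  have fS: "finite (?S g)" for g using assms(1) by simp
  have inH: "\<chi> (inv x \<otimes> g \<otimes> x) \<in> cyc_field N" if "x \<in> ?S g" for x g
    using that galois_charD(1)[OF \<chi>] by simp
  have "complex_of_rat (1 / of_nat (card H)) \<in> cyc_field N" by (rule cyc_field_closed[OF assms(3)])
  hence cH: "1 / of_nat (card H) \<in> cyc_field N" by (simp add: of_rat_divide)
  have cyc: "ind_char G H \<chi> g = (\<Sum>x\<in>?S g. \<chi> (inv x \<otimes> g \<otimes> x)) * (1 / of_nat (card H))" for g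
    by (simp add: ind_char_def)
  show "galois_char N G (ind_char G H \<chi>)"
    unfolding galois_char_def
  proof (intro ballI conjI allI impI)
    fix g assume g: "g \<in> carrier G"
    have s: "(\<Sum>x\<in>?S g. \<chi> (inv x \<otimes> g \<otimes> x)) \<in> cyc_field N"
      using inH by (rule cyc_field_sum[OF assms(3)])
    thus "ind_char G H \<chi> g \<in> cyc_field N" unfolding cyc using cH by (rule cyc_field_closed[OF assms(3)])
    fix k assume k: "coprime k N"
    have "cyc_aut N k (1 / of_nat (card H)) = 1 / of_nat (card H)"
      by (rule cyc_aut_Rats[OF assms(3) k]) simp
    moreover have sm: "cyc_aut N k (\<Sum>x\<in>?S g. \<chi> (inv x \<otimes> g \<otimes> x))
        = (\<Sum>x\<in>?S g. cyc_aut N k (\<chi> (inv x \<otimes> g \<otimes> x)))"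
      by (rule cyc_aut_sum[OF assms(3) k]) (rule inH)
    ultimately have "cyc_aut N k (ind_char G H \<chi> g)
        = (\<Sum>x\<in>?S g. cyc_aut N k (\<chi> (inv x \<otimes> g \<otimes> x))) * (1 / of_nat (card H))"
      unfolding cyc cyc_aut_mult[OF assms(3) k s cH] sm by simp
    also have "\<dots> = ind_char G H \<chi> (g [^] k)"
      unfolding ind_pow[OF g k] using galois_charD(2)[OF \<chi> _ k] by (simp add: pw)
    finally show "cyc_aut N k (ind_char G H \<chi> g) = ind_char G H \<chi> (g [^] k)" .
  qed
  show "char_avg N G (ind_char G H \<chi>) g = ind_char G H (char_avg N (G\<lparr>carrier := H\<rparr>) \<chi>) g"
    if g: "g \<in> carrier G"
  proof -
    have "(\<Sum>k\<in>totatives N. ind_char G H \<chi> (g [^] k))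
        = (\<Sum>k\<in>totatives N. (\<Sum>x\<in>?S g. \<chi> ((inv x \<otimes> g \<otimes> x) [^] k)) / of_nat (card H))"
      using ind_pow[OF g] by (intro sum.cong refl) (simp add: in_totatives_iff)
    also have "\<dots> = (\<Sum>x\<in>?S g. \<Sum>k\<in>totatives N. \<chi> ((inv x \<otimes> g \<otimes> x) [^] k)) / of_nat (card H)"
      by (subst sum.swap) (simp add: sum_divide_distrib)
    finally show ?thesis
      by (simp add: char_avg_def ind_char_def pw sum_divide_distrib mult.commute)
  qed
qed

end

section \<open>Orthogonality of Galois conjugates\<close>

context matrix_irrep
begin

lemma galois_char_chi:
  assumes "card (carrier G) dvd N" "N > 0"
  shows "galois_char N G \<chi>"
  unfolding galois_char_def
proof (intro ballI conjI allI impI)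
  fix g assume g: "g \<in> carrier G"
  obtain e where e: "\<And>k. \<chi> (g [^] (k :: nat)) = (\<Sum>i<n. zeta N ^ (e i * k))"
    using chi_powers[OF g assms] by blast
  have e1: "\<chi> g = (\<Sum>i<n. zeta N ^ e i)" using e[of 1] g by simp
  show "\<chi> g \<in> cyc_field N" unfolding e1 by (intro cyc_field_sum assms cyc_field_closed)
  fix k assume k: "coprime k N"
  show "cyc_aut N k (\<chi> g) = \<chi> (g [^] k)"
    unfolding e e1 using k by (subst cyc_aut_sum[OF assms(2)]) (auto simp: cyc_field_closed assms cyc_aut_zeta)
qed

text \<open>By Schur's lemma the convolution of \<chi> with its twist by \<open>k\<close> is
  \<open>c * \<chi>\<close>. With \<open>l\<close> inverse to \<open>k\<close>, the twist by
  \<open>l\<close> gives \<open>d * \<chi>\<close>; applying \<open>cyc_aut N k\<close> to this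
  identity turns it into the first convolution in reversed order, now equal to
  \<open>cyc_aut N k d\<close> times the twist by \<open>k\<close>. At the identity element the two
  constants agree, so either the twist equals \<chi> or \<open>c = 0\<close>, and the sum in
  question is \<open>c * \<chi> \<one>\<close>.\<close>

lemma chi_power_inner:
  assumes "card (carrier G) dvd N" "N > 0" "coprime k N"
  shows "(\<Sum>g\<in>carrier G. \<chi> (g [^] k) * \<chi> (inv g))
    = (if \<forall>g\<in>carrier G. \<chi> (g [^] k) = \<chi> g then of_nat (card (carrier G)) else 0)"
proof -
  note gal = galois_char_chi[OF assms(1,2)]
  have cls: "\<chi> ((inv g \<otimes> h \<otimes> g) [^] j) = \<chi> (h [^] j)" if "g \<in> carrier G" "h \<in> carrier G" for g h and j :: nat
    using that chi_commute[of "inv g \<otimes> h [^] j" g] by (simp add: conj_pow) (simp flip: m_assoc)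
  obtain c where c: "\<And>g. g \<in> carrier G \<Longrightarrow> (\<Sum>h\<in>carrier G. \<chi> (h [^] k) * \<chi> (inv h \<otimes> g)) = c * \<chi> g"
    using convolution_scalar[of "\<lambda>h. \<chi> (h [^] k)"] cls by blast
  obtain l where l: "coprime l N" "[k * l = 1] (mod N)"
    "\<forall>g\<in>carrier G. (g [^] k) [^] l = g" "\<forall>g\<in>carrier G. (g [^] l) [^] k = g"
    using pow_inverse[OF fin assms] .
  obtain d where d: "\<And>g. g \<in> carrier G \<Longrightarrow> (\<Sum>h\<in>carrier G. \<chi> (h [^] l) * \<chi> (inv h \<otimes> g)) = d * \<chi> g"
    using convolution_scalar[of "\<lambda>h. \<chi> (h [^] l)"] cls by blast
  note cl = cyc_field_closed[OF assms(2)]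
  have chiL: "\<chi> g \<in> cyc_field N" if "g \<in> carrier G" for g using galois_charD(1)[OF gal that] .
  \<comment> \<open>\<open>cyc_aut\<close> may be applied to \<open>d\<close> only once
    \<open>d\<close> is known to be cyclotomic; the degree \<chi>(1), which is the nonzero number
    \<open>n\<close>, is divided out.\<close>
  have dL: "d \<in> cyc_field N"
  proof -
    have "d * of_nat n \<in> cyc_field N"
      unfolding chi_one[symmetric] d[OF one_closed, symmetric]
      by (intro cyc_field_sum assms cl chiL) auto
    moreover have "complex_of_rat (1 / of_nat n) \<in> cyc_field N" by (rule cl)
    ultimately have "d * of_nat n * complex_of_rat (1 / of_nat n) \<in> cyc_field N" by (rule cl)
    thus ?thesis using n_pos by (simp add: of_rat_divide)
  qed
  have twist: "c * \<chi> g = cyc_aut N k d * \<chi> (g [^] k)" if g: "g \<in> carrier G" for g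
  proof -
    have "cyc_aut N k d * \<chi> (g [^] k) = cyc_aut N k (d * \<chi> g)"
      using g chiL dL assms by (simp add: cyc_aut_mult galois_charD(2)[OF gal])
    also have "\<dots> = (\<Sum>h\<in>carrier G. cyc_aut N k (\<chi> (h [^] l) * \<chi> (inv h \<otimes> g)))"
      unfolding d[OF g, symmetric] using g by (intro cyc_aut_sum assms cl chiL) auto
    also have "\<dots> = (\<Sum>h\<in>carrier G. \<chi> h * \<chi> ((inv h \<otimes> g) [^] k))"
      using g chiL assms l by (intro sum.cong refl) (simp add: cyc_aut_mult galois_charD(2)[OF gal])
    also have "\<dots> = (\<Sum>u\<in>carrier G. \<chi> (g \<otimes> inv u) * \<chi> (u [^] k))"
      by (rule sum.reindex_bij_witness[of _ "\<lambda>u. g \<otimes> inv u" "\<lambda>h. inv h \<otimes> g"])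
         (use g in \<open>auto simp: inv_mult_group m_assoc mult_inv_cancel\<close>)
    also have "\<dots> = (\<Sum>u\<in>carrier G. \<chi> (u [^] k) * \<chi> (inv u \<otimes> g))"
      using g chi_commute by (intro sum.cong refl) (simp add: mult.commute)
    also have "\<dots> = c * \<chi> g" by (rule c[OF g])
    finally show ?thesis by simp
  qed
  have cd: "c = cyc_aut N k d" using twist[of \<one>] n_pos by (simp add: chi_one)
  show ?thesis
  proof (cases "\<forall>g\<in>carrier G. \<chi> (g [^] k) = \<chi> g")
    case True
    thus ?thesis using chi_norm by simp
  next
    case False
    hence "c = 0" using twist cd by (metis mult_cancel_left)
    thus ?thesis using c[of \<one>] False by auto
  qed
qed

lemma char_avg_inner:
  assumes "card (carrier G) dvd N" "N > 0"
  shows "(\<Sum>g\<in>carrier G. char_avg N G \<chi> g * char_avg N G \<chi> (inv g))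
    = of_nat (card (carrier G)) / of_nat (char_field_degree G \<chi>)"
proof -
  let ?a = "char_avg N G \<chi>" and ?o = "of_nat (card (carrier G)) :: complex"
  let ?St = "{k \<in> totatives N. \<forall>g\<in>carrier G. \<chi> (g [^] k) = \<chi> g}"
  have shift: "(\<Sum>g\<in>carrier G. ?a g * \<chi> ((inv g) [^] l)) = (\<Sum>g\<in>carrier G. ?a g * \<chi> (inv g))"
    if l: "l \<in> totatives N" for l
  proof -
    have l': "coprime l N" using l by (simp add: in_totatives_iff)
    have "(\<Sum>g\<in>carrier G. ?a g * \<chi> ((inv g) [^] l)) = (\<Sum>g\<in>carrier G. ?a (g [^] l) * \<chi> (inv (g [^] l)))"
      using char_avg_pow[OF fin assms l'] by (intro sum.cong refl) (simp add: nat_pow_inv)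
    also have "\<dots> = (\<Sum>g\<in>carrier G. ?a g * \<chi> (inv g))"
      by (rule sum.reindex_bij_betw[OF bij_betw_pow[OF fin assms l']])
    finally show ?thesis .
  qed
  have phi: "of_nat (totient N) \<noteq> (0 :: complex)" using assms by simp
  have "(\<Sum>g\<in>carrier G. ?a g * ?a (inv g))
      = (\<Sum>l\<in>totatives N. \<Sum>g\<in>carrier G. ?a g * \<chi> ((inv g) [^] l)) / of_nat (totient N)"
    unfolding char_avg_def[of N G \<chi> "inv _"]
    by (subst sum.swap) (simp add: sum_distrib_left sum_divide_distrib)
  also have "\<dots> = (\<Sum>g\<in>carrier G. ?a g * \<chi> (inv g))"
    using shift phi by (simp add: totient_def)
  also have "\<dots> = (\<Sum>k\<in>totatives N. \<Sum>g\<in>carrier G. \<chi> (g [^] k) * \<chi> (inv g)) / of_nat (totient N)"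
    unfolding char_avg_def by (subst sum.swap) (simp add: sum_distrib_right sum_divide_distrib)
  also have "(\<Sum>k\<in>totatives N. \<Sum>g\<in>carrier G. \<chi> (g [^] k) * \<chi> (inv g))
      = (\<Sum>k\<in>totatives N. if \<forall>g\<in>carrier G. \<chi> (g [^] k) = \<chi> g then ?o else 0)"
    using chi_power_inner[OF assms] by (intro sum.cong refl) (simp add: in_totatives_iff)
  also have "\<dots> = of_nat (card ?St) * ?o"
    by (simp flip: sum.inter_filter)
  finally have *: "(\<Sum>g\<in>carrier G. ?a g * ?a (inv g)) = of_nat (card ?St) * ?o / of_nat (totient N)" .
  have ad: "of_nat (card ?St) * of_nat (char_field_degree G \<chi>) = (of_nat (totient N) :: complex)"
    unfolding galois_char_trace(2)[OF fin assms(2) galois_char_chi[OF assms], symmetric] of_nat_mult ..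
  hence "of_nat (card ?St) \<noteq> (0 :: complex)" using phi by force
  thus ?thesis unfolding * ad[symmetric] by (rule nonzero_mult_divide_mult_cancel_left)
qed

lemma char_tr_inner:
  assumes "card (carrier G) dvd N" "N > 0"
  shows "char_inner G (char_tr G \<chi>) (char_tr G \<chi>) = of_nat (char_field_degree G \<chi>)"
proof -
  let ?a = "char_avg N G \<chi>" and ?d = "of_nat (char_field_degree G \<chi>) :: complex"
  note gal = galois_char_chi[OF assms]
  have "char_tr G \<chi> g * cnj (char_tr G \<chi> g) = ?d * ?d * (?a g * ?a (inv g))" if g: "g \<in> carrier G" for g
  proof -
    have "cnj (?a g) = ?a g" by (rule Rats_cnj[OF char_avg_rational[OF assms(2) gal g]])
    thus ?thesis using g galois_char_trace(1)[OF fin assms(2) gal g] char_avg_inv[OF fin assms g] by simp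
  qed
  hence "char_inner G (char_tr G \<chi>) (char_tr G \<chi>)
     = ?d * ?d * (\<Sum>g\<in>carrier G. ?a g * ?a (inv g)) / of_nat (card (carrier G))"
    by (simp add: char_inner_def sum_distrib_left)
  moreover have "card (carrier G) \<noteq> 0" using fin by auto
  ultimately show ?thesis by (simp add: char_avg_inner[OF assms])
qed

end

subsection \<open>Induced characters and cyclic subgroups\<close>

lemma coprime_if_no_common_prime:
  fixes a b :: nat
  assumes "\<And>p. Factorial_Ring.prime p \<Longrightarrow> p dvd b \<Longrightarrow> \<not> p dvd a"
  shows "coprime a b"
proof (rule ccontr)
  assume "\<not> coprime a b"
  hence "gcd a b \<noteq> 1" by (simp add: coprime_iff_gcd_eq_1)
  then obtain p where "Factorial_Ring.prime p" "p dvd gcd a b" using prime_factor_nat by blast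
  thus False using assms by auto
qed

text \<open>With \<open>t\<close> the product of the primes that divide \<open>N\<close> but not
  \<open>j\<close>, every prime factor of \<open>N\<close> divides exactly one of \<open>j\<close>
  and \<open>m * t\<close>. The lift is needed because generators of a cyclic group are powers with
  exponents prime to its order, while the Galois action asks for exponents prime to
  \<open>N\<close>.\<close>

lemma coprime_lift:
  fixes j m N :: nat
  assumes "coprime j m" "m dvd N" "N > 0"
  obtains j' where "coprime j' N" "[j' = j] (mod m)"
proof -
  let ?S = "{p. Factorial_Ring.prime p \<and> p dvd N \<and> \<not> p dvd j}"
  have fin: "finite ?S" using assms(3) by (auto intro: finite_subset[of _ "{p. p dvd N}"])
  define t where "t = \<Prod>?S"
  have "\<not> p dvd j + m * t" if p: "Factorial_Ring.prime p" "p dvd N" for p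
  proof (cases "p dvd j")
    case True
    have "\<not> p dvd m" using True p(1) assms(1) by (metis coprime_common_divisor not_prime_unit)
    moreover have "\<not> p dvd t"
    proof
      assume "p dvd t"
      then obtain q where "q \<in> ?S" "p dvd q"
        using prime_dvd_prod_iff[OF fin p(1), of "\<lambda>x. x"] by (auto simp: t_def)
      moreover from this have "p = q" using p(1) by (auto intro: primes_dvd_imp_eq)
      ultimately show False using True by simp
    qed
    ultimately have "\<not> p dvd m * t" using p(1) by (simp add: prime_dvd_mult_iff)
    thus ?thesis using True by (simp add: dvd_add_right_iff)
  next
    case False
    hence "p \<in> ?S" using p by simp
    hence "p dvd t" unfolding t_def using fin by (intro dvd_prodI)
    thus ?thesis using False by (simp add: dvd_add_left_iff)
  qed
  hence "coprime (j + m * t) N" by (intro coprime_if_no_common_prime) blast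
  moreover have "[j + m * t = j] (mod m)" by (simp add: cong_def)
  ultimately show thesis using that by blast
qed

section \<open>Transitivity of induction and Frobenius reciprocity\<close>

context group
begin

lemma ind_char_alt:
  assumes "finite (carrier G)"
  shows "ind_char G H f g
    = (\<Sum>x\<in>carrier G. if inv x \<otimes> g \<otimes> x \<in> H then f (inv x \<otimes> g \<otimes> x) else 0) / of_nat (card H)"
  unfolding ind_char_def using assms by (simp add: sum.inter_filter)

text \<open>With \<open>f\<close> extended by zero, the double sum runs over the products
  \<open>x \<otimes> y\<close>. For fixed \<open>y\<close> in \<open>Q\<close> it is a translate of
  the sum over \<open>G\<close>, and the \<open>card Q\<close> equal copies cancel the outer
  denominator.\<close>

lemma ind_char_trans:
  assumes "finite (carrier G)" "subgroup Q G" "subgroup H (G\<lparr>carrier := Q\<rparr>)" "g \<in> carrier G"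
  shows "ind_char G Q (ind_char (G\<lparr>carrier := Q\<rparr>) H f) g = ind_char G H f g"
proof -
  have Q: "Q \<subseteq> carrier G" using subgroup.subset[OF assms(2)] .
  have HQ: "H \<subseteq> Q" using subgroup.subset[OF assms(3)] by simp
  have finQ: "finite Q" using finite_subset[OF Q assms(1)] .
  define f0 where "f0 u = (if u \<in> H then f u else 0)" for u
  have inn: "ind_char (G\<lparr>carrier := Q\<rparr>) H f u = (\<Sum>y\<in>Q. f0 (inv y \<otimes> u \<otimes> y)) / of_nat (card H)" for u
    unfolding f0_def using group.ind_char_alt[OF subgroup_imp_group[OF assms(2)], of H f u] finQ
    by (simp add: m_inv_consistent[OF assms(2)] cong: sum.cong if_cong)
  have step: "(if inv x \<otimes> g \<otimes> x \<in> Q then \<Sum>y\<in>Q. f0 (inv y \<otimes> (inv x \<otimes> g \<otimes> x) \<otimes> y) else 0)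
     = (\<Sum>y\<in>Q. f0 (inv (x \<otimes> y) \<otimes> g \<otimes> (x \<otimes> y)))" if x: "x \<in> carrier G" for x
  proof -
    have e: "inv y \<otimes> (inv x \<otimes> g \<otimes> x) \<otimes> y = inv (x \<otimes> y) \<otimes> g \<otimes> (x \<otimes> y)" if "y \<in> Q" for y
      using that x Q assms(4) by (simp add: inv_mult_group m_assoc subset_eq)
    \<comment> \<open>Conjugation by elements of \<open>Q\<close> cannot bring an element from
      outside \<open>Q\<close> into \<open>H\<close>, so the terms that the outer induction omits
      are zero anyway.\<close>
    have "f0 (inv y \<otimes> (inv x \<otimes> g \<otimes> x) \<otimes> y) = 0" if "y \<in> Q" "inv x \<otimes> g \<otimes> x \<notin> Q" for y
    proof -
      have "inv y \<otimes> (inv x \<otimes> g \<otimes> x) \<otimes> y \<notin> Q"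
      proof
        let ?u = "inv x \<otimes> g \<otimes> x"
        assume "inv y \<otimes> ?u \<otimes> y \<in> Q"
        hence "y \<otimes> (inv y \<otimes> ?u \<otimes> y) \<otimes> inv y \<in> Q"
          using that(1) by (meson assms(2) subgroup.m_closed subgroup.m_inv_closed)
        also have "y \<otimes> (inv y \<otimes> ?u \<otimes> y) \<otimes> inv y = ?u"
          using that(1) Q x assms(4) by (simp add: m_assoc mult_inv_cancel subset_eq)
        finally show False using that(2) by simp
      qed
      thus ?thesis using HQ by (auto simp: f0_def)
    qed
    thus ?thesis using e by (auto intro!: sum.cong)
  qed
  have "ind_char G Q (ind_char (G\<lparr>carrier := Q\<rparr>) H f) g
     = (\<Sum>x\<in>carrier G. \<Sum>y\<in>Q. f0 (inv (x \<otimes> y) \<otimes> g \<otimes> (x \<otimes> y))) / of_nat (card H) / of_nat (card Q)"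
    unfolding ind_char_alt[OF assms(1), of Q] inn sum_divide_distrib[of _ "carrier G" "of_nat (card H)"]
    by (intro arg_cong[of _ _ "\<lambda>z. z / of_nat (card Q)"] sum.cong refl) (subst step[symmetric], auto)
  also have "(\<Sum>x\<in>carrier G. \<Sum>y\<in>Q. f0 (inv (x \<otimes> y) \<otimes> g \<otimes> (x \<otimes> y)))
     = (\<Sum>y\<in>Q. \<Sum>x\<in>carrier G. f0 (inv (x \<otimes> y) \<otimes> g \<otimes> (x \<otimes> y)))" by (rule sum.swap)
  also have "\<dots> = (\<Sum>y\<in>Q. \<Sum>x\<in>carrier G. f0 (inv x \<otimes> g \<otimes> x))"
  proof (rule sum.cong[OF refl])
    fix y assume "y \<in> Q"
    hence "bij_betw (\<lambda>x. x \<otimes> y) (carrier G) (carrier G)"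
      using Q by (intro bij_betw_byWitness[of _ "\<lambda>x. x \<otimes> inv y"]) (auto simp: m_assoc)
    thus "(\<Sum>x\<in>carrier G. f0 (inv (x \<otimes> y) \<otimes> g \<otimes> (x \<otimes> y))) = (\<Sum>x\<in>carrier G. f0 (inv x \<otimes> g \<otimes> x))"
      by (rule sum.reindex_bij_betw)
  qed
  also have "\<dots> = of_nat (card Q) * (\<Sum>x\<in>carrier G. f0 (inv x \<otimes> g \<otimes> x))" by simp
  finally have "ind_char G Q (ind_char (G\<lparr>carrier := Q\<rparr>) H f) g
     = of_nat (card Q) * (\<Sum>x\<in>carrier G. f0 (inv x \<otimes> g \<otimes> x)) / of_nat (card H) / of_nat (card Q)" .
  moreover have "card Q \<noteq> 0" using finQ subgroup.one_closed[OF assms(2)] by auto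
  ultimately show ?thesis unfolding ind_char_alt[OF assms(1), of H] f0_def by simp
qed

lemma ind_char_class:
  assumes "finite (carrier G)" "g \<in> carrier G" "x \<in> carrier G"
  shows "ind_char G H f (inv x \<otimes> g \<otimes> x) = ind_char G H f g"
proof -
  let ?f = "\<lambda>u. if u \<in> H then f u else 0"
  have bij: "bij_betw (\<lambda>y. x \<otimes> y) (carrier G) (carrier G)"
    using assms by (intro bij_betw_byWitness[of _ "\<lambda>y. inv x \<otimes> y"]) (auto simp: mult_inv_cancel)
  have "(\<Sum>y\<in>carrier G. ?f (inv y \<otimes> (inv x \<otimes> g \<otimes> x) \<otimes> y))
      = (\<Sum>y\<in>carrier G. ?f (inv (x \<otimes> y) \<otimes> g \<otimes> (x \<otimes> y)))"
    using assms by (intro sum.cong refl) (simp add: inv_mult_group m_assoc)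
  also have "\<dots> = (\<Sum>y\<in>carrier G. ?f (inv y \<otimes> g \<otimes> y))"
    by (rule sum.reindex_bij_betw[OF bij])
  finally show ?thesis unfolding ind_char_alt[OF assms(1)] by simp
qed

text \<open>Bilinear, without complex conjugation, because it is applied to averages, whose values
  are rational. Conjugating the summation variable by \<open>x\<close> makes the sum over
  \<open>x\<close> constant.\<close>

lemma ind_char_frobenius:
  assumes "finite (carrier G)" "H \<subseteq> carrier G"
    and F: "\<And>g x. g \<in> carrier G \<Longrightarrow> x \<in> carrier G \<Longrightarrow> F (inv x \<otimes> g \<otimes> x) = F g"
  shows "(\<Sum>g\<in>carrier G. ind_char G H f g * F g)
    = of_nat (card (carrier G)) / of_nat (card H) * (\<Sum>h\<in>H. f h * F h)"
proof -
  let ?f = "\<lambda>u. if u \<in> H then f u else 0"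
  have "(\<Sum>g\<in>carrier G. ind_char G H f g * F g)
     = (\<Sum>g\<in>carrier G. \<Sum>x\<in>carrier G. ?f (inv x \<otimes> g \<otimes> x) * F (inv x \<otimes> g \<otimes> x)) / of_nat (card H)"
    unfolding ind_char_alt[OF assms(1)] sum_divide_distrib sum_distrib_right
    by (intro sum.cong refl) (simp add: F)
  also have "(\<Sum>g\<in>carrier G. \<Sum>x\<in>carrier G. ?f (inv x \<otimes> g \<otimes> x) * F (inv x \<otimes> g \<otimes> x))
     = (\<Sum>x\<in>carrier G. \<Sum>g\<in>carrier G. ?f (inv x \<otimes> g \<otimes> x) * F (inv x \<otimes> g \<otimes> x))" by (rule sum.swap)
  also have "\<dots> = (\<Sum>x\<in>carrier G. \<Sum>g\<in>carrier G. ?f g * F g)"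
  proof (rule sum.cong[OF refl])
    fix x assume x: "x \<in> carrier G"
    have "bij_betw (\<lambda>g. inv x \<otimes> g \<otimes> x) (carrier G) (carrier G)"
      by (rule bij_betw_byWitness[of _ "\<lambda>g. x \<otimes> g \<otimes> inv x"]) (use x in \<open>auto simp: m_assoc mult_inv_cancel\<close>)
    thus "(\<Sum>g\<in>carrier G. ?f (inv x \<otimes> g \<otimes> x) * F (inv x \<otimes> g \<otimes> x)) = (\<Sum>g\<in>carrier G. ?f g * F g)"
      by (rule sum.reindex_bij_betw)
  qed
  also have "(\<Sum>g\<in>carrier G. ?f g * F g) = (\<Sum>h\<in>H. f h * F h)"
    using assms(1,2) by (intro sum.mono_neutral_cong_right) auto
  finally show ?thesis by simp
qed

section \<open>Conjugate subgroups and generators of cyclic groups\<close>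

lemma conj_subset_eq: "conj_subset G g U = (\<lambda>u. g \<otimes> u \<otimes> inv g) ` U"
  by (auto simp: conj_subset_def l_coset_def r_coset_def)

lemma conj_subset_comp:
  assumes "g \<in> carrier G" "h \<in> carrier G" "U \<subseteq> carrier G"
  shows "conj_subset G g (conj_subset G h U) = conj_subset G (g \<otimes> h) U"
  unfolding conj_subset_eq image_image
  using assms by (intro image_cong refl) (auto simp: inv_mult_group m_assoc)

lemma conj_subset_one: "U \<subseteq> carrier G \<Longrightarrow> conj_subset G \<one> U = U"
  unfolding conj_subset_eq by (force simp: image_iff)

lemma conj_subset_sub: "g \<in> carrier G \<Longrightarrow> U \<subseteq> carrier G \<Longrightarrow> conj_subset G g U \<subseteq> carrier G"
  unfolding conj_subset_eq by auto

lemma card_conj_subset: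
  assumes "g \<in> carrier G" "U \<subseteq> carrier G"
  shows "card (conj_subset G g U) = card U"
  unfolding conj_subset_eq using assms by (intro card_image inj_onI) (auto simp: subset_eq)

lemma normalizer_eq:
  "U \<subseteq> carrier G \<Longrightarrow> normalizer G U = {g \<in> carrier G. conj_subset G g U = U}"
  by (simp add: normalizer_def stabilizer_def conj_subset_def)

lemma conjugate_in_sym:
  assumes "U \<subseteq> carrier G" "conjugate_in G D U"
  shows "conjugate_in G U D"
proof -
  obtain g where g: "g \<in> carrier G" "D = conj_subset G g U" using assms(2) by (auto simp: conjugate_in_def)
  have "conj_subset G (inv g) D = U" using g assms(1) by (simp add: conj_subset_comp conj_subset_one)
  thus ?thesis using g(1) by (auto simp: conjugate_in_def intro!: bexI[of _ "inv g"])
qed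

lemma conjugate_in_trans:
  assumes "U \<subseteq> carrier G" "conjugate_in G E D" "conjugate_in G D U"
  shows "conjugate_in G E U"
  using assms by (auto simp: conjugate_in_def conj_subset_comp)

lemma conjugate_in_refl: "U \<subseteq> carrier G \<Longrightarrow> conjugate_in G U U"
  unfolding conjugate_in_def by (rule bexI[of _ \<one>]) (simp_all add: conj_subset_one)

text \<open>If \<open>D\<close> and \<open>E\<close> are the conjugates of \<open>U\<close> by
  \<open>a\<close> and \<open>b\<close>, then
  \<open>x \<mapsto> inv b \<otimes> x \<otimes> a\<close> carries the conjugators from
  \<open>D\<close> to \<open>E\<close> onto the normaliser of \<open>U\<close>.\<close>

lemma card_conjugators:
  assumes "U \<subseteq> carrier G" "conjugate_in G D U" "conjugate_in G E U"
  shows "card {x \<in> carrier G. conj_subset G x D = E} = card (normalizer G U)"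
proof -
  obtain a b where ab: "a \<in> carrier G" "D = conj_subset G a U" "b \<in> carrier G" "E = conj_subset G b U"
    using assms(2,3) by (auto simp: conjugate_in_def)
  have "conj_subset G (inv b \<otimes> x \<otimes> a) U = U" if "x \<in> carrier G" "conj_subset G x D = E" for x
  proof -
    have "conj_subset G (inv b \<otimes> x \<otimes> a) U = conj_subset G (inv b) (conj_subset G x D)"
      using that(1) ab assms(1) by (simp add: conj_subset_comp m_assoc conj_subset_sub)
    thus ?thesis unfolding that(2) using ab assms(1) by (simp add: conj_subset_comp conj_subset_one)
  qed
  moreover have "conj_subset G (b \<otimes> y \<otimes> inv a) D = E" if "y \<in> carrier G" "conj_subset G y U = U" for y
  proof -
    have "conj_subset G (b \<otimes> y \<otimes> inv a) D = conj_subset G b (conj_subset G y U)"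
      using that(1) ab assms(1) by (simp add: conj_subset_comp m_assoc)
    thus ?thesis using that(2) ab(4) by simp
  qed
  ultimately have "bij_betw (\<lambda>x. inv b \<otimes> x \<otimes> a) {x \<in> carrier G. conj_subset G x D = E} (normalizer G U)"
    unfolding normalizer_eq[OF assms(1)]
    by (intro bij_betw_byWitness[of _ "\<lambda>y. b \<otimes> y \<otimes> inv a"]) (use ab in \<open>auto simp: m_assoc mult_inv_cancel\<close>)
  thus ?thesis by (rule bij_betw_same_card)
qed

lemma conj_subset_generate:
  assumes "finite (carrier G)" "g \<in> carrier G" "h \<in> carrier G"
  shows "conj_subset G (inv g) (generate G {h}) = generate G {inv g \<otimes> h \<otimes> g}"
  unfolding conj_subset_eq using assms
  by (auto simp: generate_pow_on_finite_carrier conj_pow image_iff)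

lemma cyclic_subgroups_eq:
  assumes "finite (carrier G)"
  shows "cyclic_subgroups G = (\<lambda>u. generate G {u}) ` carrier G"
proof (intro equalityI subsetI)
  fix U assume "U \<in> cyclic_subgroups G"
  hence U: "subgroup U G" "cyclic_group (G\<lparr>carrier := U\<rparr>)" by (auto simp: cyclic_subgroups_def)
  interpret U: Group.group "G\<lparr>carrier := U\<rparr>" using subgroup_imp_group[OF U(1)] .
  obtain x where x: "x \<in> U" "U = range (\<lambda>n::int. x [^]\<^bsub>G\<lparr>carrier := U\<rparr>\<^esub> n)"
    using U(2) unfolding U.cyclic_group by auto
  have xG: "x \<in> carrier G" using subgroup.subset[OF U(1)] x(1) by auto
  have "x [^]\<^bsub>G\<lparr>carrier := U\<rparr>\<^esub> n = x [^] n" for n :: int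
    using int_pow_consistent[OF U(1) x(1), of n] by simp
  hence "U = range (\<lambda>n::int. x [^] n)" using x(2) by simp
  hence "U = generate G {x}" unfolding generate_pow[OF xG] by auto
  thus "U \<in> (\<lambda>u. generate G {u}) ` carrier G" using xG by blast
next
  fix U assume "U \<in> (\<lambda>u. generate G {u}) ` carrier G"
  then obtain x where x: "x \<in> carrier G" "U = generate G {x}" by blast
  have U: "subgroup U G" unfolding x(2) by (rule generate_is_subgroup) (use x in auto)
  interpret U: Group.group "G\<lparr>carrier := U\<rparr>" using subgroup_imp_group[OF U] .
  have xU: "x \<in> U" unfolding x(2) by (rule generate.incl) simp
  have "x [^]\<^bsub>G\<lparr>carrier := U\<rparr>\<^esub> n = x [^] n" for n :: int
    using int_pow_consistent[OF U xU, of n] by simp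
  hence "U = range (\<lambda>n::int. x [^]\<^bsub>G\<lparr>carrier := U\<rparr>\<^esub> n)"
    unfolding x(2) generate_pow[OF x(1)] by auto
  hence "cyclic_group (G\<lparr>carrier := U\<rparr>)" unfolding U.cyclic_group using xU by auto
  thus "U \<in> cyclic_subgroups G" using U by (simp add: cyclic_subgroups_def)
qed

lemma generate_subset:
  assumes "subgroup H G" "h \<in> H"
  shows "generate G {h} \<subseteq> H"
  using generate_subgroup_incl[OF _ assms(1), of "{h}"] assms(2) by simp

lemma same_generate_pow:
  assumes "finite (carrier G)" "u \<in> carrier G" "h \<in> carrier G" "generate G {h} = generate G {u}"
  obtains k where "k \<in> totatives (ord u)" "h = u [^] k"
proof -
  have "h \<in> generate G {u}" unfolding assms(4)[symmetric] by (rule generate.incl) simp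
  then obtain k0 :: nat where k0: "h = u [^] k0"
    using generate_pow_on_finite_carrier[OF assms(1,2)] by auto
  have o: "ord u > 0" using ord_ge_1[OF assms(1,2)] by simp
  \<comment> \<open>Exponent 0 is replaced by the order, as \<open>totatives n\<close> is a subset
    of {1..n}; this matters for the trivial subgroup.\<close>
  define k where "k = (if k0 mod ord u = 0 then ord u else k0 mod ord u)"
  have k: "k > 0" "k \<le> ord u" using o by (auto simp: k_def less_imp_le)
  have "[k = k0] (mod ord u)" by (auto simp: k_def cong_def)
  hence hk: "h = u [^] k" unfolding k0 using pow_cong_ord[OF assms(2)] by (metis cong_sym)
  have "ord h = ord u" using assms(3,4) generate_pow_card[OF assms(2)] generate_pow_card[OF assms(3)] by simp
  hence "ord u div gcd (ord u) k = ord u" using ord_pow_gen[OF assms(2), of k] k(1) hk by simp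
  hence "gcd (ord u) k = 1" using o by (metis div_eq_dividend_iff)
  hence "k \<in> totatives (ord u)" using k by (simp add: totatives_def coprime_iff_gcd_eq_1 gcd.commute)
  thus thesis using that hk by blast
qed

lemma card_generators:
  assumes "finite (carrier G)" "u \<in> carrier G"
  shows "card {h \<in> carrier G. generate G {h} = generate G {u}} = totient (card (generate G {u}))"
proof -
  have ord: "card (generate G {u}) = ord u" using generate_pow_card[OF assms(2)] by simp
  have "bij_betw (\<lambda>k. u [^] k) (totatives (ord u)) {h \<in> carrier G. generate G {h} = generate G {u}}"
  proof (rule bij_betwI')
    fix k l assume "k \<in> totatives (ord u)" "l \<in> totatives (ord u)"
    thus "u [^] k = u [^] l \<longleftrightarrow> k = l"
      using inj_on_eq_iff[OF ord_inj'[OF assms(2)], of k l] by (simp add: totatives_def Suc_le_eq)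
  next
    fix k assume k: "k \<in> totatives (ord u)"
    have uk: "u [^] k \<in> carrier G" using assms by simp
    have "ord (u [^] k) = ord u"
      using k ord_pow_gen[OF assms(2), of k] by (auto simp: totatives_def coprime_iff_gcd_eq_1 gcd.commute)
    hence c: "card (generate G {u [^] k}) = card (generate G {u})"
      using generate_pow_card[OF uk] ord by simp
    have "generate G {u [^] k} \<subseteq> generate G {u}"
      using generate_pow_on_finite_carrier[OF assms] assms(2)
      by (intro generate_subset generate_is_subgroup) auto
    moreover have "finite (generate G {u})"
      using generate_incl[of "{u}"] assms finite_subset by auto
    ultimately have "generate G {u [^] k} = generate G {u}" using c by (simp add: card_subset_eq)
    thus "u [^] k \<in> {h \<in> carrier G. generate G {h} = generate G {u}}" using uk by simp
  next
    fix h assume "h \<in> {h \<in> carrier G. generate G {h} = generate G {u}}"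
    hence h: "h \<in> carrier G" "generate G {h} = generate G {u}" by auto
    obtain k where "k \<in> totatives (ord u)" "h = u [^] k" using same_generate_pow[OF assms h] .
    thus "\<exists>k\<in>totatives (ord u). h = u [^] k" by blast
  qed
  thus ?thesis unfolding ord by (simp add: bij_betw_same_card totient_def)
qed

end

section \<open>From elements to classes of cyclic subgroups\<close>

context group
begin

text \<open>The generator picked by \<open>val_at_cyclic\<close> is a power of \<open>h\<close>
  whose exponent is prime to \<open>ord h\<close>. Modulo \<open>ord h\<close> this exponent can be
  chosen prime to \<open>N\<close>, and such powers do not change the average.\<close>

lemma val_at_cyclic_avg:
  assumes "finite (carrier G)" "card (carrier G) dvd N" "N > 0" "subgroup H G"
    and \<chi>: "galois_char N (G\<lparr>carrier := H\<rparr>) \<chi>" and h: "h \<in> H"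
  shows "val_at_cyclic G (char_tr_star (G\<lparr>carrier := H\<rparr>) \<chi>) (generate G {h})
    = char_avg N (G\<lparr>carrier := H\<rparr>) \<chi> h"
proof -
  interpret H: Group.group "G\<lparr>carrier := H\<rparr>" using subgroup_imp_group[OF assms(4)] .
  have HG: "H \<subseteq> carrier G" using subgroup.subset[OF assms(4)] .
  have fin: "finite (carrier (G\<lparr>carrier := H\<rparr>))" using finite_subset[OF HG assms(1)] by simp
  have cH: "card (carrier (G\<lparr>carrier := H\<rparr>)) dvd N"
  proof -
    have "card H dvd card (carrier G)"
      using lagrange[OF assms(4)] unfolding Coset.order_def by (metis dvd_triv_right)
    thus ?thesis using assms(2) by (auto intro: dvd_trans)
  qed
  define y where "y = (SOME y. y \<in> carrier G \<and> generate G {y} = generate G {h})"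
  have "y \<in> carrier G \<and> generate G {y} = generate G {h}"
    unfolding y_def by (rule someI[of _ h]) (use h HG in auto)
  hence y: "y \<in> carrier G" "generate G {y} = generate G {h}" by auto
  have hG: "h \<in> carrier G" using h HG by auto
  obtain k where k: "k \<in> totatives (ord h)" "y = h [^] k" using same_generate_pow[OF assms(1) hG y] .
  have "ord h dvd N" using ord_dvd_group_order[OF hG] assms(2) by (auto simp: Coset.order_def intro: dvd_trans)
  moreover have "coprime k (ord h)" using k(1) by (simp add: in_totatives_iff)
  ultimately obtain j where j: "coprime j N" "[j = k] (mod ord h)" using coprime_lift assms(3) by metis
  have yj: "y = h [^]\<^bsub>G\<lparr>carrier := H\<rparr>\<^esub> j"
    using pow_cong_ord[OF hG j(2)] k(2) by (simp add: nat_pow_consistent[symmetric])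
  have "y \<in> H" unfolding yj using H.nat_pow_closed[of h j] h by simp
  hence "char_tr_star (G\<lparr>carrier := H\<rparr>) \<chi> y = char_avg N (G\<lparr>carrier := H\<rparr>) \<chi> y"
    using H.char_tr_star_eq_avg[OF fin assms(3) \<chi>] by simp
  also have "\<dots> = char_avg N (G\<lparr>carrier := H\<rparr>) \<chi> h"
    unfolding yj using H.char_avg_pow[OF fin cH assms(3) j(1)] h by simp
  finally show ?thesis by (simp add: val_at_cyclic_def y_def)
qed

lemma subgroup_in_subgroup_iff:
  assumes "subgroup H G"
  shows "subgroup D (G\<lparr>carrier := H\<rparr>) \<longleftrightarrow> subgroup D G \<and> D \<subseteq> H"
  using assms incl_subgroup[OF assms, of D] subgroup_incl[of D H] subgroup.subset[of D "G\<lparr>carrier := H\<rparr>"]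
  by auto

lemma conj_subset_cyclic:
  assumes "finite (carrier G)" "U \<in> cyclic_subgroups G" "g \<in> carrier G"
  shows "conj_subset G g U \<in> cyclic_subgroups G"
proof -
  obtain u where u: "u \<in> carrier G" "U = generate G {u}" using assms(1,2) by (auto simp: cyclic_subgroups_eq)
  have "conj_subset G (inv (inv g)) U = generate G {inv (inv g) \<otimes> u \<otimes> inv g}"
    unfolding u(2) using conj_subset_generate[OF assms(1) _ u(1), of "inv g"] assms(3) by simp
  thus ?thesis using assms(1,3) u(1) by (simp add: cyclic_subgroups_eq)
qed

lemma cyclic_subgroup_carrier: "U \<in> cyclic_subgroups G \<Longrightarrow> U \<subseteq> carrier G"
  by (auto simp: cyclic_subgroups_def dest: subgroup.subset)

lemma class_rep:
  assumes "finite (carrier G)" "C \<in> CC_cyc G"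
  shows "class_rep C \<in> cyclic_subgroups G" "C = {D. conjugate_in G D (class_rep C)}"
proof -
  obtain U0 where U0: "U0 \<in> cyclic_subgroups G" "C = {conj_subset G g U0 | g. g \<in> carrier G}"
    using assms(2) by (auto simp: CC_cyc_def orbits_def orbit_def)
  note U0c = cyclic_subgroup_carrier[OF U0(1)]
  have "U0 \<in> C" using conj_subset_one[OF U0c] unfolding U0(2) by (metis (mono_tags, lifting) mem_Collect_eq one_closed)
  hence "class_rep C \<in> C" unfolding class_rep_def by (rule someI)
  then obtain g where g: "g \<in> carrier G" "class_rep C = conj_subset G g U0" unfolding U0(2) by blast
  show cyc: "class_rep C \<in> cyclic_subgroups G" unfolding g(2) by (rule conj_subset_cyclic[OF assms(1) U0(1) g(1)])
  have C: "C = {D. conjugate_in G D U0}" unfolding U0(2) conjugate_in_def by blast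
  have "conjugate_in G (class_rep C) U0" using g by (auto simp: conjugate_in_def)
  thus "C = {D. conjugate_in G D (class_rep C)}"
    using conjugate_in_sym[OF U0c] conjugate_in_trans[OF U0c] conjugate_in_trans[OF cyclic_subgroup_carrier[OF cyc]]
    by (subst C) blast
qed

text \<open>The summand depends only on the conjugate subgroup that \<open>x\<close> produces.
  Sorting the \<open>x\<close> by it, each subgroup of \<open>H\<close> conjugate to
  \<open>U\<close> is reached as often as the normaliser of \<open>U\<close> has elements;
  \<open>x\<close> is first inverted to match the direction of \<open>conj_subset\<close>.\<close>

lemma sum_conjugates:
  fixes v :: "'a set \<Rightarrow> complex"
  assumes "finite (carrier G)" "subgroup H G" "U \<in> cyclic_subgroups G" "h \<in> carrier G"
    and "conjugate_in G (generate G {h}) U"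
  shows "(\<Sum>x\<in>{x \<in> carrier G. inv x \<otimes> h \<otimes> x \<in> H}. v (generate G {inv x \<otimes> h \<otimes> x}))
    = of_nat (card (normalizer G U)) *
      (\<Sum>D | subgroup D (G\<lparr>carrier := H\<rparr>) \<and> conjugate_in G D U. v D)"
proof -
  note Uc = cyclic_subgroup_carrier[OF assms(3)]
  let ?D = "generate G {h}" and ?T = "{D. subgroup D (G\<lparr>carrier := H\<rparr>) \<and> conjugate_in G D U}"
  let ?X = "{x \<in> carrier G. conj_subset G x ?D \<in> ?T}"
  have HG: "H \<subseteq> carrier G" using subgroup.subset[OF assms(2)] .
  have Dc: "?D \<subseteq> carrier G" using generate_incl assms(4) by auto
  have finT: "finite ?T"
    by (rule finite_subset[of _ "Pow H"]) (use finite_subset[OF HG assms(1)] in \<open>auto simp: subgroup_in_subgroup_iff[OF assms(2)]\<close>)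
  have conj: "conj_subset G (inv x) ?D = generate G {inv x \<otimes> h \<otimes> x}" if "x \<in> carrier G" for x
    by (rule conj_subset_generate[OF assms(1) that assms(4)])
  have iff: "inv x \<otimes> h \<otimes> x \<in> H \<longleftrightarrow> conj_subset G (inv x) ?D \<in> ?T" if x: "x \<in> carrier G" for x
  proof
    assume "inv x \<otimes> h \<otimes> x \<in> H"
    hence "generate G {inv x \<otimes> h \<otimes> x} \<subseteq> H" by (rule generate_subset[OF assms(2)])
    moreover have "subgroup (generate G {inv x \<otimes> h \<otimes> x}) G"
      by (rule generate_is_subgroup) (use x assms(4) in auto)
    moreover have "conjugate_in G (conj_subset G (inv x) ?D) U"
      by (rule conjugate_in_trans[OF Uc _ assms(5)]) (use x in \<open>auto simp: conjugate_in_def\<close>)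
    ultimately show "conj_subset G (inv x) ?D \<in> ?T"
      unfolding conj[OF x] by (simp add: subgroup_in_subgroup_iff[OF assms(2)])
  next
    assume "conj_subset G (inv x) ?D \<in> ?T"
    hence "generate G {inv x \<otimes> h \<otimes> x} \<subseteq> H" unfolding conj[OF x] by (simp add: subgroup_in_subgroup_iff[OF assms(2)])
    moreover have "inv x \<otimes> h \<otimes> x \<in> generate G {inv x \<otimes> h \<otimes> x}" by (rule generate.incl) simp
    ultimately show "inv x \<otimes> h \<otimes> x \<in> H" by blast
  qed
  have "(\<Sum>x\<in>{x \<in> carrier G. inv x \<otimes> h \<otimes> x \<in> H}. v (generate G {inv x \<otimes> h \<otimes> x}))
      = (\<Sum>x\<in>{x \<in> carrier G. conj_subset G (inv x) ?D \<in> ?T}. v (conj_subset G (inv x) ?D))"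
    by (rule sum.cong) (use iff conj in auto)
  also have "\<dots> = (\<Sum>x\<in>?X. v (conj_subset G x ?D))"
    by (rule sum.reindex_bij_witness[of _ "m_inv G" "m_inv G"]) auto
  also have "\<dots> = (\<Sum>D\<in>?T. \<Sum>x\<in>{x \<in> ?X. conj_subset G x ?D = D}. v (conj_subset G x ?D))"
    by (rule sum.group[symmetric]) (use assms(1) finT in auto)
  also have "\<dots> = (\<Sum>D\<in>?T. of_nat (card (normalizer G U)) * v D)"
  proof (rule sum.cong[OF refl])
    fix D assume D: "D \<in> ?T"
    have "{x \<in> ?X. conj_subset G x ?D = D} = {x \<in> carrier G. conj_subset G x ?D = D}" using D by auto
    thus "(\<Sum>x\<in>{x \<in> ?X. conj_subset G x ?D = D}. v (conj_subset G x ?D)) = of_nat (card (normalizer G U)) * v D"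
      using card_conjugators[OF Uc assms(5), of D] D by simp
  qed
  finally show ?thesis by (simp add: sum_distrib_left)
qed

text \<open>A pure count with arbitrary \<open>v1\<close> and \<open>v2\<close>. By
  \<open>sum_conjugates\<close> the inner sum depends only on the class of
  \<open>generate G {h}\<close>, so the \<open>h\<close> can be sorted by class and, within a class,
  by the subgroup they generate.\<close>

lemma sum_over_cyclic_classes:
  fixes v1 v2 :: "'a set \<Rightarrow> complex"
  assumes fin: "finite (carrier G)" and H1: "subgroup H1 G" and H2: "subgroup H2 G"
  shows "(\<Sum>h\<in>H2. v2 (generate G {h}) *
      (\<Sum>x\<in>{x \<in> carrier G. inv x \<otimes> h \<otimes> x \<in> H1}. v1 (generate G {inv x \<otimes> h \<otimes> x})))
    = (\<Sum>C\<in>CC_cyc G. let U = class_rep C in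
        of_nat (card (normalizer G U)) * of_nat (totient (card U)) *
        (\<Sum>D | subgroup D (G\<lparr>carrier := H1\<rparr>) \<and> conjugate_in G D U. v1 D) *
        (\<Sum>D | subgroup D (G\<lparr>carrier := H2\<rparr>) \<and> conjugate_in G D U. v2 D))"
proof -
  let ?W = "\<lambda>h. v2 (generate G {h}) *
      (\<Sum>x\<in>{x \<in> carrier G. inv x \<otimes> h \<otimes> x \<in> H1}. v1 (generate G {inv x \<otimes> h \<otimes> x}))"
  let ?T = "\<lambda>H U. {D. subgroup D (G\<lparr>carrier := H\<rparr>) \<and> conjugate_in G D U}"
  have H2G: "H2 \<subseteq> carrier G" using subgroup.subset[OF H2] .
  have finH2: "finite H2" using finite_subset[OF H2G fin] .
  have fincyc: "finite (cyclic_subgroups G)" using fin by (simp add: cyclic_subgroups_eq)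
  have finCC: "finite (CC_cyc G)"
    unfolding CC_cyc_def orbits_def using fincyc by (auto simp: setcompr_eq_image)
  have finT: "finite (?T H2 U)" for U
    by (rule finite_subset[of _ "Pow H2"]) (use finH2 in \<open>auto simp: subgroup_in_subgroup_iff[OF H2]\<close>)
  let ?c = "\<lambda>h. orbit G (conj_subset G) (generate G {h})"
  have genc: "generate G {h} \<subseteq> carrier G" if "h \<in> H2" for h
    by (rule generate_incl) (use that H2G in auto)
  have orb: "?c h = {D. conjugate_in G D (generate G {h})}" for h
    by (auto simp: orbit_def conjugate_in_def)
  have c_in: "?c ` H2 \<subseteq> CC_cyc G"
    using H2G by (auto simp: CC_cyc_def orbits_def cyclic_subgroups_eq[OF fin])
  have c_iff: "?c h = C \<longleftrightarrow> conjugate_in G (generate G {h}) (class_rep C)" if h: "h \<in> H2" and C: "C \<in> CC_cyc G" for h C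
  proof
    assume "?c h = C"
    moreover have "generate G {h} \<in> ?c h" unfolding orb using conjugate_in_refl[OF genc[OF h]] by simp
    ultimately show "conjugate_in G (generate G {h}) (class_rep C)" using class_rep(2)[OF fin C] by blast
  next
    assume *: "conjugate_in G (generate G {h}) (class_rep C)"
    note Uc = cyclic_subgroup_carrier[OF class_rep(1)[OF fin C]]
    show "?c h = C"
      unfolding orb using class_rep(2)[OF fin C] conjugate_in_trans[OF Uc _ *]
        conjugate_in_trans[OF genc[OF h] _ conjugate_in_sym[OF Uc *]] by blast
  qed
  have "(\<Sum>h\<in>H2. ?W h) = (\<Sum>C\<in>CC_cyc G. \<Sum>h\<in>{h \<in> H2. ?c h = C}. ?W h)"
    by (rule sum.group[OF finH2 finCC c_in, symmetric])
  also have "\<dots> = (\<Sum>C\<in>CC_cyc G. let U = class_rep C in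
        of_nat (card (normalizer G U)) * of_nat (totient (card U)) *
        (\<Sum>D\<in>?T H1 U. v1 D) * (\<Sum>D\<in>?T H2 U. v2 D))"
  proof (rule sum.cong[OF refl])
    fix C assume C: "C \<in> CC_cyc G"
    define U where "U = class_rep C"
    have U: "U \<in> cyclic_subgroups G" unfolding U_def by (rule class_rep[OF fin C])
    note Uc = cyclic_subgroup_carrier[OF U]
    let ?n = "of_nat (card (normalizer G U)) * (\<Sum>D\<in>?T H1 U. v1 D)"
    have fibre: "card {h \<in> H2. ?c h = C \<and> generate G {h} = D} = totient (card U)" if D: "D \<in> ?T H2 U" for D
    proof -
      have DG: "conjugate_in G D U" "subgroup D G" "D \<subseteq> H2" using D by (auto simp: subgroup_in_subgroup_iff[OF H2])
      then obtain g where g: "g \<in> carrier G" "D = conj_subset G g U" by (auto simp: conjugate_in_def)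
      hence "D \<in> cyclic_subgroups G" using conj_subset_cyclic[OF fin U] by simp
      then obtain u where u: "u \<in> carrier G" "D = generate G {u}" by (auto simp: cyclic_subgroups_eq[OF fin])
      \<comment> \<open>Every generator of \<open>D\<close> lies in \<open>D\<close> and hence in
        \<open>H2\<close>, so the fibre over \<open>D\<close> consists of all its generators, and
        their number depends on the order of \<open>U\<close> alone.\<close>
      have hH2: "h \<in> H2" if "generate G {h} = D" for h using that DG(3) generate.incl[of h "{h}" G] by auto
      have "?c h = C" if "generate G {h} = D" for h
        using c_iff[OF hH2[OF that] C] DG(1) that by (simp add: U_def)
      hence "{h \<in> H2. ?c h = C \<and> generate G {h} = D} = {h \<in> carrier G. generate G {h} = generate G {u}}"
        using hH2 H2G unfolding u(2) by blast
      thus ?thesis using card_generators[OF fin u(1)] g u(2) card_conj_subset[OF g(1) Uc] by simp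
    qed
    have "(\<Sum>h\<in>{h \<in> H2. ?c h = C}. ?W h) = (\<Sum>h\<in>{h \<in> H2. ?c h = C}. v2 (generate G {h}) * ?n)"
    proof (rule sum.cong[OF refl])
      fix h assume "h \<in> {h \<in> H2. ?c h = C}"
      hence hh: "h \<in> H2" "conjugate_in G (generate G {h}) U" using c_iff[OF _ C] by (auto simp: U_def)
      hence "h \<in> carrier G" using H2G by auto
      from sum_conjugates[OF fin H1 U this hh(2), of v1] show "?W h = v2 (generate G {h}) * ?n" by simp
    qed
    also have "\<dots> = (\<Sum>D\<in>?T H2 U. \<Sum>h\<in>{h \<in> {h \<in> H2. ?c h = C}. generate G {h} = D}. v2 (generate G {h}) * ?n)"
    proof (rule sum.group[symmetric])
      show "(\<lambda>h. generate G {h}) ` {h \<in> H2. ?c h = C} \<subseteq> ?T H2 U"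
        using c_iff[OF _ C] generate_subset[OF H2] H2G unfolding U_def
        by (auto simp: subgroup_in_subgroup_iff[OF H2] intro!: generate_is_subgroup)
    qed (use finH2 finT in auto)
    also have "\<dots> = (\<Sum>D\<in>?T H2 U. of_nat (totient (card U)) * (v2 D * ?n))"
      using fibre by (intro sum.cong refl) (simp add: conj_assoc)
    also have "\<dots> = of_nat (card (normalizer G U)) * of_nat (totient (card U)) *
        (\<Sum>D\<in>?T H1 U. v1 D) * (\<Sum>D\<in>?T H2 U. v2 D)"
      by (simp add: sum_distrib_left[symmetric] sum_distrib_right[symmetric] mult_ac)
    finally show "(\<Sum>h\<in>{h \<in> H2. ?c h = C}. ?W h) = (let U = class_rep C in
        of_nat (card (normalizer G U)) * of_nat (totient (card U)) *
        (\<Sum>D\<in>?T H1 U. v1 D) * (\<Sum>D\<in>?T H2 U. v2 D))" unfolding U_def Let_def .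
  qed
  finally show ?thesis .
qed

end

section \<open>Assembling the formula\<close>

lemma irreducible_galois_char:
  assumes "Group.group G" "finite (carrier G)" "card (carrier G) dvd N" "N > 0" "irreducible_char G \<chi>"
  shows "galois_char N G \<chi>"
proof -
  obtain n R where nR: "matrix_irrep G n R" "\<And>g. g \<in> carrier G \<Longrightarrow> \<chi> g = matrix_irrep.\<chi> R g"
    using irreducible_charE[OF assms(1,2,5)] by blast
  interpret matrix_irrep G n R by (rule nR(1))
  show ?thesis using galois_char_chi[OF assms(3,4)] nR(2) by (simp add: galois_char_def)
qed

lemma char_field_cong:
  assumes "\<And>g. g \<in> carrier G \<Longrightarrow> \<chi> g = \<chi>' g"
  shows "char_field G \<chi> = char_field G \<chi>'"
  unfolding char_field_def using assms by (metis image_cong)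

lemma irreducible_char_tr_inner:
  assumes "Group.group G" "finite (carrier G)" "irreducible_char G \<chi>"
  shows "char_inner G (char_tr G \<chi>) (char_tr G \<chi>) = of_nat (char_field_degree G \<chi>)"
proof -
  obtain n R where nR: "matrix_irrep G n R" "\<And>g. g \<in> carrier G \<Longrightarrow> \<chi> g = matrix_irrep.\<chi> R g"
    using irreducible_charE[OF assms] by blast
  interpret matrix_irrep G n R by (rule nR(1))
  have K: "char_field G \<chi>' = char_field G \<chi>" if "\<chi>' = matrix_irrep.\<chi> R" for \<chi>'
    using char_field_cong[of G \<chi>' \<chi>] nR(2) that by simp
  have N: "card (carrier G) > 0" using fin by (auto simp: card_gt_0_iff)
  have "char_inner G (char_tr G \<chi>) (char_tr G \<chi>) = char_inner G (char_tr G (matrix_irrep.\<chi> R)) (char_tr G (matrix_irrep.\<chi> R))"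
    using nR(2) K by (simp add: char_inner_def char_tr_def)
  thus ?thesis using char_tr_inner[OF dvd_refl N] K by (simp add: char_field_degree_def)
qed

theorem corollary3p8:
  fixes G (structure)
    and H1 Q1 H2 Q2 :: "'a set"
    and \<chi>1 \<chi>2 \<tau>1 \<tau>2 \<rho>1 \<rho>2 :: "'a \<Rightarrow> complex"
  assumes "group G" and "finite (carrier G)"
    and "subgroup Q1 G" and "subgroup H1 (G\<lparr>carrier := Q1\<rparr>)"
    and "subgroup Q2 G" and "subgroup H2 (G\<lparr>carrier := Q2\<rparr>)"
    and "irreducible_char (G\<lparr>carrier := H1\<rparr>) \<chi>1"
    and "irreducible_char (G\<lparr>carrier := H2\<rparr>) \<chi>2"
    and "\<tau>1 = ind_char (G\<lparr>carrier := Q1\<rparr>) H1 \<chi>1"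
    and "\<tau>2 = ind_char (G\<lparr>carrier := Q2\<rparr>) H2 \<chi>2"
    and "\<rho>1 = char_tr (G\<lparr>carrier := Q1\<rparr>) \<tau>1"
    and "\<rho>2 = char_tr (G\<lparr>carrier := Q2\<rparr>) \<tau>2"
    and "irreducible_char (G\<lparr>carrier := Q2\<rparr>) \<tau>2"
  shows "char_mu (G\<lparr>carrier := Q2\<rparr>) \<rho>2 (restrict (ind_char G Q1 \<rho>1) Q2) =
    of_nat (char_field_degree (G\<lparr>carrier := Q1\<rparr>) \<tau>1) / (of_nat (card H1) * of_nat (card H2)) *
    (\<Sum>C \<in> CC_cyc G. let U = class_rep C in
       of_nat (card (normalizer G U)) * of_nat (totient (card U)) *
       (\<Sum>D1 | subgroup D1 (G\<lparr>carrier := H1\<rparr>) \<and> conjugate_in G D1 U.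
          val_at_cyclic G (char_tr_star (G\<lparr>carrier := H1\<rparr>) \<chi>1) D1) *
       (\<Sum>D2 | subgroup D2 (G\<lparr>carrier := H2\<rparr>) \<and> conjugate_in G D2 U.
          val_at_cyclic G (char_tr_star (G\<lparr>carrier := H2\<rparr>) \<chi>2) D2))"
proof -
  interpret Group.group G by (rule assms(1))
  define N where "N = card (carrier G)"
  have N: "N > 0" "card (carrier G) dvd N" using assms(2) by (auto simp: N_def card_gt_0_iff)
  have facts: "Group.group (G\<lparr>carrier := H\<rparr>)" "finite H" "card H dvd N" "card H \<noteq> 0" "H \<subseteq> carrier G"
    if "subgroup H G" for H
  proof -
    show "Group.group (G\<lparr>carrier := H\<rparr>)" by (rule subgroup_imp_group[OF that])
    show HG: "H \<subseteq> carrier G" by (rule subgroup.subset[OF that])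
    show "finite H" by (rule finite_subset[OF HG assms(2)])
    thus "card H \<noteq> 0" using subgroup.one_closed[OF that] by auto
    show "card H dvd N" using lagrange[OF that] unfolding N_def Coset.order_def by (metis dvd_triv_right)
  qed
  have H: "subgroup H1 G" "subgroup H2 G" using incl_subgroup assms(3-6) by blast+
  note Q1 = facts[OF assms(3)] and Q2 = facts[OF assms(5)] and H1 = facts[OF H(1)] and H2 = facts[OF H(2)]
  interpret Q1: Group.group "G\<lparr>carrier := Q1\<rparr>" by (rule Q1(1))
  interpret Q2: Group.group "G\<lparr>carrier := Q2\<rparr>" by (rule Q2(1))
  have gal: "galois_char N (G\<lparr>carrier := H1\<rparr>) \<chi>1" "galois_char N (G\<lparr>carrier := H2\<rparr>) \<chi>2"
    by (rule irreducible_galois_char; use H1 H2 N(1) assms(7,8) in simp)+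
  define f1 where "f1 = char_avg N (G\<lparr>carrier := H1\<rparr>) \<chi>1"
  define f2 where "f2 = char_avg N (G\<lparr>carrier := H2\<rparr>) \<chi>2"
  define d1 where "d1 = char_field_degree (G\<lparr>carrier := Q1\<rparr>) \<tau>1"
  define d2 where "d2 = char_field_degree (G\<lparr>carrier := Q2\<rparr>) \<tau>2"
  define F where "F = ind_char G H1 f1"
  let ?Q1 = "G\<lparr>carrier := Q1\<rparr>" and ?Q2 = "G\<lparr>carrier := Q2\<rparr>"
  have gal1: "galois_char N ?Q1 \<tau>1" and avg1: "g \<in> Q1 \<Longrightarrow> char_avg N ?Q1 \<tau>1 g = ind_char ?Q1 H1 f1 g" for g
    using Q1.galois_char_ind(1)[of N H1 \<chi>1] Q1.galois_char_ind(2)[of N H1 \<chi>1 g] Q1 N(1) assms(4) gal(1) by (simp_all add: assms(9) f1_def)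
  have gal2: "galois_char N ?Q2 \<tau>2" and avg2: "g \<in> Q2 \<Longrightarrow> char_avg N ?Q2 \<tau>2 g = ind_char ?Q2 H2 f2 g" for g
    using Q2.galois_char_ind(1)[of N H2 \<chi>2] Q2.galois_char_ind(2)[of N H2 \<chi>2 g] Q2 N(1) assms(6) gal(2) by (simp_all add: assms(10) f2_def)
  have rho1: "\<rho>1 g = of_nat d1 * ind_char ?Q1 H1 f1 g" if "g \<in> Q1" for g
    using Q1.galois_char_trace(1)[of N \<tau>1 g] gal1 avg1 that Q1 N(1) by (simp add: assms(11) d1_def)
  have rho2: "\<rho>2 g = of_nat d2 * ind_char ?Q2 H2 f2 g" if "g \<in> Q2" for g
    using Q2.galois_char_trace(1)[of N \<tau>2 g] gal2 avg2 that Q2 N(1) by (simp add: assms(12) d2_def)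
  have d2: "of_nat d2 \<noteq> (0 :: complex)"
    using Q2.galois_char_trace(2)[of N \<tau>2] gal2 Q2 N(1) by (auto simp: d2_def)
  have ind1: "ind_char G Q1 \<rho>1 g = of_nat d1 * F g" if g: "g \<in> carrier G" for g
  proof -
    \<comment> \<open>The degree \<open>d1\<close> is a constant and passes through the induction
      from \<open>Q1\<close>; transitivity leaves the average induced from
      \<open>H1\<close>.\<close>
    have "ind_char G Q1 \<rho>1 g = of_nat d1 * ind_char G Q1 (ind_char ?Q1 H1 f1) g"
      unfolding ind_char_def[of G Q1] by (simp add: rho1 sum_distrib_left)
    thus ?thesis unfolding F_def by (simp add: ind_char_trans[OF assms(2,3,4) g])
  qed
  have F_rat: "F g \<in> \<rat>" for g
    unfolding F_def ind_char_def f1_def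
    by (intro Rats_divide Rats_sum Rats_of_nat) (use char_avg_rational[OF N(1) gal(1)] in auto)
  have F_class: "F (inv\<^bsub>?Q2\<^esub> x \<otimes>\<^bsub>?Q2\<^esub> g \<otimes>\<^bsub>?Q2\<^esub> x) = F g" if "g \<in> carrier ?Q2" "x \<in> carrier ?Q2" for g x
    using that Q2(5) ind_char_class[OF assms(2)] by (simp add: F_def m_inv_consistent[OF assms(5)] subset_eq)
  \<comment> \<open>The second argument has rational values, so the conjugation in
    \<open>char_inner\<close> disappears and the bilinear form of Frobenius reciprocity
    applies.\<close>
  have "char_inner ?Q2 \<rho>2 (restrict (ind_char G Q1 \<rho>1) Q2)
      = (\<Sum>g\<in>Q2. of_nat d2 * ind_char ?Q2 H2 f2 g * (of_nat d1 * F g)) / of_nat (card Q2)"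
    unfolding char_inner_def using Q2(5) ind1 rho2 Rats_cnj[OF F_rat] by (auto intro!: sum.cong)
  also have "\<dots> = of_nat d2 * of_nat d1 * (\<Sum>g\<in>carrier ?Q2. ind_char ?Q2 H2 f2 g * F g) / of_nat (card Q2)"
    by (simp add: sum_distrib_left mult_ac)
  also have "\<dots> = of_nat d2 * of_nat d1 / of_nat (card H2) * (\<Sum>h\<in>H2. f2 h * F h)"
    using Q2.ind_char_frobenius[of H2 F f2] F_class Q2 subgroup.subset[OF assms(6)] by simp
  finally have inner: "char_inner ?Q2 \<rho>2 (restrict (ind_char G Q1 \<rho>1) Q2)
    = of_nat d2 * of_nat d1 / of_nat (card H2) * (\<Sum>h\<in>H2. f2 h * F h)" .
  \<comment> \<open>Here the irreducibility of \<tau>2 enters: the norm of its trace cancels the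
    factor \<open>d2\<close>, which is why only the degree of \<tau>1 survives.\<close>
  have "char_inner ?Q2 \<rho>2 \<rho>2 = of_nat d2"
    unfolding assms(12) d2_def by (rule irreducible_char_tr_inner) (use Q2 assms(13) in auto)
  hence mu: "char_mu ?Q2 \<rho>2 (restrict (ind_char G Q1 \<rho>1) Q2)
      = of_nat d1 / of_nat (card H2) * (\<Sum>h\<in>H2. f2 h * F h)"
    unfolding char_mu_def inner using d2 by simp
  define v1 where "v1 = val_at_cyclic G (char_tr_star (G\<lparr>carrier := H1\<rparr>) \<chi>1)"
  define v2 where "v2 = val_at_cyclic G (char_tr_star (G\<lparr>carrier := H2\<rparr>) \<chi>2)"
  have f: "h \<in> H1 \<Longrightarrow> f1 h = v1 (generate G {h})" "h \<in> H2 \<Longrightarrow> f2 h = v2 (generate G {h})" for h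
    unfolding f1_def f2_def v1_def v2_def
    using val_at_cyclic_avg[OF assms(2) N(2,1)] H gal by simp_all
  have "(\<Sum>h\<in>H2. f2 h * F h) = (\<Sum>h\<in>H2. v2 (generate G {h}) *
      (\<Sum>x\<in>{x \<in> carrier G. inv x \<otimes> h \<otimes> x \<in> H1}. v1 (generate G {inv x \<otimes> h \<otimes> x}))) / of_nat (card H1)"
    unfolding F_def ind_char_def sum_divide_distrib[of _ H2] by (simp add: f)
  also note sum_over_cyclic_classes[OF assms(2) H]
  finally show ?thesis
    unfolding mu d1_def[symmetric] v1_def[symmetric] v2_def[symmetric] by simp
qed

end
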